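(* Let $k$ be a field of characteristic zero, let $D=k[d_1,\dots,d_n]$, let $M$ be a finitely generated $D$-module, and let $R=M^*=\hom_k(M,k)$. When $M$ is $n$-pure, the minimum number of generators of $R$ as a $D$-module is equal to the maximum number of isotypical components that can be found among the various components $\mathrm{soc}_{\mathfrak m}(M)$ of the socle of $M$ (equivalently among the various components of the top of $R$), that is, to $$\max_{\mathfrak m\in \mathrm{ass}(M)}\ \dim_{D/\mathfrak m}\mathrm{soc}_{\mathfrak m}(M).$$
   Context: $D=k[d_1,\dots,d_n]$ is the commutative polynomial ring in $n$ commuting formal derivatives over the field of constants $k$. A nonzero finitely generated $D$-module $M$ is $n$-pure if $cd_D(Dm)=n$ for all $0\ne m\in M$, where $cd_D(N)=n-d(N)$ and $d(N)$ is the Krull dimension of $D/\mathrm{ann}_D(N)$; this is equivalent to $\dim_k(M)<\infty$, and then $\mathrm{ass}(M)\subset \max(D)$, where $\mathrm{ass}(M)$ is the set of associated primes of $M$ and $\max(D)$ the set of maximal ideals. $R=M^*=\hom_k(M,k)$, called the (inverse) system, is a $D$-module through $(d_if)(x)=f(d_ix)$ (the paper's sign convention for constant coefficients). For $\mathfrak m\in\mathrm{ass}(M)$, $\mathrm{soc}_{\mathfrak m}(M)$ is the sum of all simple submodules of $M$ isomorphic to $D/\mathfrak m$, i.e. the submodule of elements killed by $\mathfrak m$; it is a direct sum of copies of $D/\mathfrak m$, called isotypical components. The socle of $M$ is $\mathrm{soc}(M)=\bigoplus_{\mathfrak m}\mathrm{soc}_{\mathfrak m}(M)$, the sum being over $\mathfrak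 m\in\mathrm{ass}(M)$. The top of $R$ is $\mathrm{top}(R)=R/\mathrm{rad}(R)$, where $\mathrm{rad}(R)$ is the intersection of all maximal proper submodules of $R$; its component at $\mathfrak m$ is $\mathrm{top}_{\mathfrak m}(R)=R/\mathfrak mR$, dual to $\mathrm{soc}_{\mathfrak m}(M)$. *)

theory Defs
  imports
    "HOL-Algebra.QuotRing"
    "HOL-Library.Poly_Mapping"
    "HOL-Library.Extended_Nat"
    "Jordan_Normal_Form.Missing_VectorSpace"
begin

section \<open>The polynomial ring\<close>

text \<open>
  Polynomials are finitely supported maps from exponent vectors to coefficients, with the
  convolution product of \<^theory>\<open>HOL-Library.Poly_Mapping\<close>.  In \<open>poly_ring n\<close> the variables
  \<open>d\<^sub>1, \<dots>, d\<^sub>n\<close> are numbered \<open>0, \<dots>, n - 1\<close>.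
\<close>

type_synonym 'k mpoly = "(nat \<Rightarrow>\<^sub>0 nat) \<Rightarrow>\<^sub>0 'k"

definition const :: "'k::zero \<Rightarrow> 'k mpoly" where
  "const c = Poly_Mapping.single 0 c"

definition poly_ring :: "nat \<Rightarrow> ('k::field mpoly) ring" where
  "poly_ring n =
    \<lparr>carrier = {p. \<forall>m\<in>Poly_Mapping.keys p. Poly_Mapping.keys m \<subseteq> {..<n}}, mult = (*), one = 1, zero = 0, add = (+)\<rparr>"

lemma cring_poly_ring: "cring (poly_ring n :: ('k::field mpoly) ring)"
proof (rule cringI)
  show "abelian_group (poly_ring n :: ('k mpoly) ring)"
  proof (rule abelian_groupI)
    fix x y :: "'k mpoly"
    assume "x \<in> carrier (poly_ring n)" "y \<in> carrier (poly_ring n)"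
    then show "x \<oplus>\<^bsub>poly_ring n\<^esub> y \<in> carrier (poly_ring n)"
      using Poly_Mapping.keys_add[of x y] by (auto simp: poly_ring_def)
  next
    fix x :: "'k mpoly"
    assume "x \<in> carrier (poly_ring n)"
    then show "\<exists>y\<in>carrier (poly_ring n). y \<oplus>\<^bsub>poly_ring n\<^esub> x = \<zero>\<^bsub>poly_ring n\<^esub>"
      by (intro bexI[of _ "- x"]) (auto simp: poly_ring_def)
  qed (auto simp: poly_ring_def add_ac)
  show "Group.comm_monoid (poly_ring n :: ('k mpoly) ring)"
  proof (rule comm_monoidI)
    fix x y :: "'k mpoly"
    assume *: "x \<in> carrier (poly_ring n)" "y \<in> carrier (poly_ring n)"
    have "Poly_Mapping.keys m \<subseteq> {..<n}" if "m \<in> Poly_Mapping.keys (x * y)" for m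
    proof -
      from that keys_mult[of x y] obtain a b
        where ab: "m = a + b" "a \<in> Poly_Mapping.keys x" "b \<in> Poly_Mapping.keys y" by blast
      then show ?thesis
        using * Poly_Mapping.keys_add[of a b] by (force simp: poly_ring_def)
    qed
    then show "x \<otimes>\<^bsub>poly_ring n\<^esub> y \<in> carrier (poly_ring n)"
      by (simp add: poly_ring_def)
  qed (auto simp: poly_ring_def mult_ac)
qed (auto simp: poly_ring_def algebra_simps)

lemma const_in_carrier: "const c \<in> carrier (poly_ring n)"
  by (simp add: poly_ring_def const_def)


section \<open>Generators, quotients, isomorphisms\<close>

definition finitely_generated ::
  "('a, 'c) ring_scheme \<Rightarrow> ('a, 'm, 'd) module_scheme \<Rightarrow> bool" where
  "finitely_generated D M \<longleftrightarrow> (\<exists>S. finite S \<and> S \<subseteq> carrier M \<and> module.span D M S = carrier M)"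

text \<open>The value is \<open>\<infinity>\<close> if there is no finite generating set.\<close>

definition min_generators ::
  "('a, 'c) ring_scheme \<Rightarrow> ('a, 'm, 'd) module_scheme \<Rightarrow> enat" where
  "min_generators D M =
    (INF S \<in> {S. finite S \<and> S \<subseteq> carrier M \<and> module.span D M S = carrier M}. enat (card S))"

definition module_isomorphic ::
  "('a, 'c) ring_scheme \<Rightarrow> ('a, 'm, 'd) module_scheme \<Rightarrow> ('a, 'l, 'e) module_scheme \<Rightarrow> bool" where
  "module_isomorphic D M N \<longleftrightarrow> (\<exists>f \<in> module_hom D M N. bij_betw f (carrier M) (carrier N))"

text \<open>
  The record type of modules extends that of rings; the fields \<open>mult\<close> and \<open>one\<close> carry no meaning
  for a module and are filled arbitrarily.
\<close>

definition regular_module :: "('a, 'c) ring_scheme \<Rightarrow> ('a, 'a) module" where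
  "regular_module D =
    \<lparr>carrier = carrier D, mult = mult D, one = one D, zero = zero D, add = add D, smult = mult D\<rparr>"

definition quotient_module :: "('a, 'm, 'd) module_scheme \<Rightarrow> 'm set \<Rightarrow> ('a, 'm set) module" where
  "quotient_module M N =
    \<lparr>carrier = a_rcosets\<^bsub>M\<^esub> N, mult = (\<lambda>X Y. N), one = N, zero = N, add = set_add M,
     smult = (\<lambda>p X. \<Union>x\<in>X. N +>\<^bsub>M\<^esub> (p \<odot>\<^bsub>M\<^esub> x))\<rparr>"

text \<open>The direct sum of \<open>r\<close> copies of \<open>N\<close>.\<close>

definition direct_power :: "('a, 'm, 'd) module_scheme \<Rightarrow> nat \<Rightarrow> ('a, nat \<Rightarrow> 'm) module" where
  "direct_power N r =
    \<lparr>carrier = (\<Pi>\<^sub>E i\<in>{..<r}. carrier N),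
     mult = (\<lambda>u v. \<lambda>i\<in>{..<r}. \<zero>\<^bsub>N\<^esub>), one = (\<lambda>i\<in>{..<r}. \<zero>\<^bsub>N\<^esub>), zero = (\<lambda>i\<in>{..<r}. \<zero>\<^bsub>N\<^esub>),
     add = (\<lambda>u v. \<lambda>i\<in>{..<r}. u i \<oplus>\<^bsub>N\<^esub> v i), smult = (\<lambda>p u. \<lambda>i\<in>{..<r}. p \<odot>\<^bsub>N\<^esub> u i)\<rparr>"

definition ideal_smult ::
  "('a, 'c) ring_scheme \<Rightarrow> 'a set \<Rightarrow> ('a, 'm, 'd) module_scheme \<Rightarrow> 'm set" where
  "ideal_smult D I M = module.span D M {p \<odot>\<^bsub>M\<^esub> x | p x. p \<in> I \<and> x \<in> carrier M}"


section \<open>Annihilators, associated primes and purity\<close>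

definition annihilator ::
  "('a, 'c) ring_scheme \<Rightarrow> ('a, 'm, 'd) module_scheme \<Rightarrow> 'm set \<Rightarrow> 'a set" where
  "annihilator D M N = {p \<in> carrier D. \<forall>x\<in>N. p \<odot>\<^bsub>M\<^esub> x = \<zero>\<^bsub>M\<^esub>}"

definition ass :: "('a, 'c) ring_scheme \<Rightarrow> ('a, 'm, 'd) module_scheme \<Rightarrow> 'a set set" where
  "ass D M = {P. primeideal P D \<and> (\<exists>x\<in>carrier M. P = annihilator D M {x})}"

definition krull_dim :: "('a, 'c) ring_scheme \<Rightarrow> enat" where
  "krull_dim A = Sup {enat r | r. \<exists>P :: nat \<Rightarrow> 'a set.
     (\<forall>i\<le>r. primeideal (P i) A) \<and> (\<forall>i<r. P i \<subset> P (Suc i))}"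

definition cyclic_submodule ::
  "('a, 'c) ring_scheme \<Rightarrow> ('a, 'm, 'd) module_scheme \<Rightarrow> 'm \<Rightarrow> 'm set" where
  "cyclic_submodule D M x = {p \<odot>\<^bsub>M\<^esub> x | p. p \<in> carrier D}"

text \<open>
  The subtraction on \<^typ>\<open>enat\<close> truncates, but a quotient of the polynomial ring in \<open>n\<close>
  variables over a field has Krull dimension at most \<open>n\<close>.
\<close>

definition cd :: "nat \<Rightarrow> ('k::field mpoly, 'm, 'd) module_scheme \<Rightarrow> 'm set \<Rightarrow> enat" where
  "cd n M N = enat n - krull_dim (poly_ring n Quot annihilator (poly_ring n) M N)"

definition n_pure :: "nat \<Rightarrow> ('k::field mpoly, 'm, 'd) module_scheme \<Rightarrow> bool" where
  "n_pure n M \<longleftrightarrow> carrier M \<noteq> {\<zero>\<^bsub>M\<^esub>} \<and>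
     (\<forall>x \<in> carrier M - {\<zero>\<^bsub>M\<^esub>}. cd n M (cyclic_submodule (poly_ring n) M x) = enat n)"


section \<open>The inverse system\<close>

text \<open>
  Linear forms on \<open>M\<close> are functions on the carrier, made extensional so that equality of forms is
  equality of functions.  The scalar multiplication is the \<open>k\<close>-linear extension of
  \<open>(d\<^sub>i f)(x) = f(d\<^sub>i x)\<close> to all polynomials.
\<close>

definition inverse_system ::
  "('k::field mpoly, 'm, 'd) module_scheme \<Rightarrow> ('k mpoly, 'm \<Rightarrow> 'k) module" where
  "inverse_system M =
    \<lparr>carrier = {f \<in> extensional (carrier M).
        (\<forall>x\<in>carrier M. \<forall>y\<in>carrier M. f (x \<oplus>\<^bsub>M\<^esub> y) = f x + f y) \<and>
        (\<forall>c. \<forall>x\<in>carrier M. f (const c \<odot>\<^bsub>M\<^esub> x) = c * f x)},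
     mult = (\<lambda>f g. \<lambda>x\<in>carrier M. 0), one = (\<lambda>x\<in>carrier M. 0), zero = (\<lambda>x\<in>carrier M. 0),
     add = (\<lambda>f g. \<lambda>x\<in>carrier M. f x + g x),
     smult = (\<lambda>p f. \<lambda>x\<in>carrier M. f (p \<odot>\<^bsub>M\<^esub> x))\<rparr>"

lemma module_inverse_system:
  fixes M :: "('k::field mpoly, 'm, 'd) module_scheme"
  assumes "module (poly_ring n) M"
  shows "module (poly_ring n) (inverse_system M)"
proof -
  interpret M: module "poly_ring n" M by fact
  have const: "const c \<odot>\<^bsub>M\<^esub> x \<in> carrier M" if "x \<in> carrier M" for c :: 'k and x
    using that const_in_carrier[of c n] by simp
  have comm: "p \<odot>\<^bsub>M\<^esub> (q \<odot>\<^bsub>M\<^esub> x) = q \<odot>\<^bsub>M\<^esub> (p \<odot>\<^bsub>M\<^esub> x)"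
    if "p \<in> carrier (poly_ring n)" "q \<in> carrier (poly_ring n)" "x \<in> carrier M" for p q x
    using that by (simp flip: M.smult_assoc1 add: M.m_comm)
  show ?thesis
  proof (rule moduleI)
    show "abelian_group (inverse_system M)"
    proof (rule abelian_groupI)
      fix f
      assume f: "f \<in> carrier (inverse_system M)"
      show "\<exists>g\<in>carrier (inverse_system M). g \<oplus>\<^bsub>inverse_system M\<^esub> f = \<zero>\<^bsub>inverse_system M\<^esub>"
        by (rule bexI[of _ "\<lambda>x\<in>carrier M. - f x"])
          (use f const in \<open>auto simp: inverse_system_def fun_eq_iff\<close>)
    qed (use const in \<open>auto simp: inverse_system_def fun_eq_iff extensional_def algebra_simps\<close>)
  next
    fix p q :: "'k mpoly" and f
    assume "p \<in> carrier (poly_ring n)" "q \<in> carrier (poly_ring n)" "f \<in> carrier (inverse_system M)"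
    then show "(p \<oplus>\<^bsub>poly_ring n\<^esub> q) \<odot>\<^bsub>inverse_system M\<^esub> f
        = p \<odot>\<^bsub>inverse_system M\<^esub> f \<oplus>\<^bsub>inverse_system M\<^esub> q \<odot>\<^bsub>inverse_system M\<^esub> f"
      by (auto simp: inverse_system_def fun_eq_iff M.smult_l_distr)
  next
    fix p q :: "'k mpoly" and f
    assume "p \<in> carrier (poly_ring n)" "q \<in> carrier (poly_ring n)" "f \<in> carrier (inverse_system M)"
    then show "(p \<otimes>\<^bsub>poly_ring n\<^esub> q) \<odot>\<^bsub>inverse_system M\<^esub> f
        = p \<odot>\<^bsub>inverse_system M\<^esub> (q \<odot>\<^bsub>inverse_system M\<^esub> f)"
      by (auto simp: inverse_system_def fun_eq_iff M.smult_assoc1 comm)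
  next
    fix f
    assume "f \<in> carrier (inverse_system M)"
    then show "\<one>\<^bsub>poly_ring n\<^esub> \<odot>\<^bsub>inverse_system M\<^esub> f = f"
      by (auto simp: inverse_system_def fun_eq_iff extensional_def)
  next
    fix p :: "'k mpoly" and f
    assume "p \<in> carrier (poly_ring n)" "f \<in> carrier (inverse_system M)"
    then show "p \<odot>\<^bsub>inverse_system M\<^esub> f \<in> carrier (inverse_system M)"
      by (auto simp: inverse_system_def M.smult_r_distr comm[OF _ const_in_carrier] const)
  next
    fix p :: "'k mpoly" and f g
    assume "p \<in> carrier (poly_ring n)"
    then show "p \<odot>\<^bsub>inverse_system M\<^esub> (f \<oplus>\<^bsub>inverse_system M\<^esub> g)
        = p \<odot>\<^bsub>inverse_system M\<^esub> f \<oplus>\<^bsub>inverse_system M\<^esub> p \<odot>\<^bsub>inverse_system M\<^esub> g"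
      by (auto simp: inverse_system_def fun_eq_iff)
  qed (rule cring_poly_ring)
qed


section \<open>Socle and top components\<close>

definition simple_module :: "('a, 'c) ring_scheme \<Rightarrow> ('a, 'm, 'd) module_scheme \<Rightarrow> bool" where
  "simple_module D N \<longleftrightarrow> module D N \<and> carrier N \<noteq> {\<zero>\<^bsub>N\<^esub>} \<and>
     (\<forall>H. LinearCombinations.submodule D H N \<longrightarrow> H = {\<zero>\<^bsub>N\<^esub>} \<or> H = carrier N)"

abbreviation residue_module :: "('a, 'c) ring_scheme \<Rightarrow> 'a set \<Rightarrow> ('a, 'a set) module" where
  "residue_module D \<mm> \<equiv> quotient_module (regular_module D) \<mm>"

definition soc_component ::
  "('a, 'c) ring_scheme \<Rightarrow> 'a set \<Rightarrow> ('a, 'm, 'd) module_scheme \<Rightarrow> ('a, 'm, 'd) module_scheme" where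
  "soc_component D \<mm> M = M\<lparr>carrier := module.span D M
     (\<Union>{N. LinearCombinations.submodule D N M \<and> simple_module D (M\<lparr>carrier := N\<rparr>) \<and>
        module_isomorphic D (M\<lparr>carrier := N\<rparr>) (residue_module D \<mm>)})\<rparr>"

definition top_component ::
  "('a, 'c) ring_scheme \<Rightarrow> 'a set \<Rightarrow> ('a, 'm, 'd) module_scheme \<Rightarrow> ('a, 'm set) module" where
  "top_component D \<mm> R = quotient_module R (ideal_smult D \<mm> R)"

text \<open>
  The number \<open>r\<close> of isotypical components of \<open>N\<close>, where \<open>N\<close> is a direct sum of \<open>r\<close> copies of
  \<open>D/\<mm>\<close>.  For a maximal ideal \<open>\<mm>\<close> there is at most one such \<open>r\<close>, so the infimum merely selects it;
  the value is \<open>\<infinity>\<close> if there is none.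
\<close>

definition num_isotypical ::
  "('a, 'c) ring_scheme \<Rightarrow> 'a set \<Rightarrow> ('a, 'm, 'd) module_scheme \<Rightarrow> enat" where
  "num_isotypical D \<mm> N =
    (INF r \<in> {r. module_isomorphic D N (direct_power (residue_module D \<mm>) r)}. enat r)"

text \<open>
  A \<open>D\<close>-module killed by \<open>\<mm>\<close>, as a vector space over the residue field \<open>D/\<mm>\<close>.  A residue class acts
  through any of its representatives.
\<close>

definition over_residue_field :: "('a, 'm, 'd) module_scheme \<Rightarrow> ('a set, 'm) module" where
  "over_residue_field N =
    \<lparr>carrier = carrier N, mult = mult N, one = one N, zero = zero N, add = add N,
     smult = (\<lambda>X x. (SOME p. p \<in> X) \<odot>\<^bsub>N\<^esub> x)\<rparr>"

definition residue_dim ::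
  "('a, 'c) ring_scheme \<Rightarrow> 'a set \<Rightarrow> ('a, 'm, 'd) module_scheme \<Rightarrow> enat" where
  "residue_dim D \<mm> N =
    (if vectorspace.fin_dim (D Quot \<mm>) (over_residue_field N)
     then enat (vectorspace.dim (D Quot \<mm>) (over_residue_field N)) else \<infinity>)"

end

theory Submission
  imports "HOL-Algebra.Finite_Extensions" "HOL-Computational_Algebra.Polynomial" Defs
begin

text \<open>
  Purity says that every prime ideal containing \<open>ann(x)\<close>, \<open>x \<noteq> 0\<close>, is maximal.  If no nonzero
  polynomial in \<open>d\<^sub>i\<close> belonged to \<open>ann(x)\<close>, a prime ideal over \<open>ann(x)\<close> maximal among those avoiding
  \<open>k[d\<^sub>i] - {0}\<close> would be a maximal ideal with a residue field transcendental over \<open>k\<close>, against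
  Zariski's lemma.  Hence \<open>M\<close> is finite-dimensional over \<open>k\<close>.

  Restricting linear forms from \<open>M\<close> to \<open>soc\<^sub>\<mm>(M) \<cong> F\<^sup>r\<close>, \<open>F = D/\<mm>\<close>, and identifying the dual of \<open>F\<^sup>r\<close>
  with \<open>F\<^sup>r\<close> gives a \<open>D\<close>-linear map from \<open>R\<close> onto \<open>F\<^sup>r\<close>; by double orthogonality its kernel is \<open>\<mm>R\<close>.
  So \<open>R/\<mm>R \<cong> F\<^sup>r\<close>, and \<open>R\<close> needs at least \<open>r\<close> generators.  Conversely, by the Chinese remainder
  theorem \<open>max r\<close> elements of \<open>R\<close> can be chosen to generate all the quotients \<open>R/\<mm>R\<close> at once.  The
  submodule of \<open>M\<close> orthogonal to them meets no \<open>soc\<^sub>\<mm>(M)\<close>, so it is zero and they generate \<open>R\<close>.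
\<close>

text \<open>From the definition of Krull dimension by chains only one fact is drawn: two primes over
  \<open>ann(x)\<close> are never strictly nested. The obstacle is the passage from maximal ideals
  to finite dimension, hence Zariski's lemma, proved by induction on the generators; its core is
  that inverting a single element of \<open>K[x]\<close>, \<open>x\<close> transcendental, never
  produces a field. Once every element of \<open>M\<close> is killed by a nonzero polynomial in each
  variable, finitely many monomials applied to the generators span \<open>M\<close> over
  \<open>k\<close>. The identification of the dual of \<open>F\<close> with \<open>F\<close> is not
  canonical: it depends on a linear form on \<open>F\<close> that is nonzero at 1, here read off
  from a form on \<open>M\<close> that does not vanish at a chosen socle element. Any such form
  works, since nonzero elements of \<open>F\<close> are invertible. Multiplication by elements of
  \<open>D\<close> is self-adjoint for the resulting pairing, and this makes the restriction map
  \<open>D\<close>-linear. The generators of \<open>R\<close> are chosen to hit the unit vectors of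
  all the spaces \<open>F^r\<close> simultaneously; in a space with \<open>r\<close> below the
  maximum, the surplus generators are sent to zero.\<close>

hide_const (open) Polynomial_Divisibility.poly_ring Module.submodule

section \<open>Zariski's lemma\<close>

context field
begin

lemma mem_Span_if_combine:
  assumes K: "subfield K R" and Us: "set Us \<subseteq> carrier R"
  shows "v \<in> Span K Us \<longleftrightarrow> (\<exists>Ks. set Ks \<subseteq> K \<and> length Ks = length Us \<and> v = combine Ks Us)"
  using Span_eq_combine_set_length_version[OF K Us] by auto

text \<open>The fraction field of a subring \<open>A\<close>, realised inside the ambient field so
  that it can serve as a base field for the same extension.\<close>

definition fractions :: "'a set \<Rightarrow> 'a set" where
  "fractions A = {a \<otimes> inv b | a b. a \<in> A \<and> b \<in> A - {\<zero>}}"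

text \<open>Membership is tested by clearing a denominator, so that closure properties reduce to
  identities between products and never to computations with inverses.\<close>

lemma fractionsI:
  assumes "z \<in> carrier R" "b \<in> A - {\<zero>}" "b \<otimes> z \<in> A" "A \<subseteq> carrier R"
  shows "z \<in> fractions A"
proof -
  have b: "b \<in> Units R" using assms field_Units by auto
  then have bc: "b \<in> carrier R" "inv b \<in> carrier R" by auto
  have "(b \<otimes> z) \<otimes> inv b = z \<otimes> (b \<otimes> inv b)" using assms(1) bc by (simp only: m_ac m_closed)
  then have "z = (b \<otimes> z) \<otimes> inv b" using assms(1) b by simp
  then show ?thesis using assms unfolding fractions_def by blast
qed

lemma fractionsE:
  assumes "z \<in> fractions A" "A \<subseteq> carrier R"
  obtains b where "b \<in> A - {\<zero>}" "b \<otimes> z \<in> A" "z \<in> carrier R"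
proof -
  from assms obtain a b where ab: "z = a \<otimes> inv b" "a \<in> A" "b \<in> A - {\<zero>}"
    unfolding fractions_def by blast
  have b: "b \<in> Units R" "b \<in> carrier R" "a \<in> carrier R" using ab assms field_Units by auto
  then have "b \<otimes> z = a" using ab(1)
    by (metis Units_inv_closed Units_r_inv m_assoc m_comm r_one)
  then show ?thesis using that[of b] ab b by simp
qed

lemma subring_subset_fractions:
  assumes "subring A R" shows "A \<subseteq> fractions A"
  using fractionsI[of _ \<one> A] subringE(1,3)[OF assms] by auto

lemma subfield_fractions:
  assumes A: "subring A R"
  shows "subfield (fractions A) R"
proof -
  note sub = subringE[OF A]
  have Ac: "A \<subseteq> carrier R" by (rule sub(1))
  have nz: "b \<otimes> c \<in> A - {\<zero>}" if "b \<in> A - {\<zero>}" "c \<in> A - {\<zero>}" for b c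
    using that sub integral[of b c] by auto
  show ?thesis
  proof (rule subfieldI'[OF subringI])
    show "fractions A \<subseteq> carrier R" using fractionsE[OF _ Ac] by blast
    show "\<one> \<in> fractions A" using subring_subset_fractions[OF A] sub(3) by blast
  next
    fix x y assume x: "x \<in> fractions A" and y: "y \<in> fractions A"
    from x obtain b where b: "b \<in> A - {\<zero>}" "b \<otimes> x \<in> A" "x \<in> carrier R" by (rule fractionsE[OF _ Ac])
    from y obtain c where c: "c \<in> A - {\<zero>}" "c \<otimes> y \<in> A" "y \<in> carrier R" by (rule fractionsE[OF _ Ac])
    have bc: "b \<in> carrier R" "c \<in> carrier R" "b \<in> A" "c \<in> A" using b c Ac by auto
    have "b \<otimes> (\<ominus> x) = \<ominus> (b \<otimes> x)" using b bc by (simp add: r_minus)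
    then show "\<ominus> x \<in> fractions A" using b sub(5) by (intro fractionsI[OF _ b(1) _ Ac]) auto
    have "(b \<otimes> c) \<otimes> (x \<otimes> y) = (b \<otimes> x) \<otimes> (c \<otimes> y)" using b c bc
      by (simp add: m_ac)
    then show "x \<otimes> y \<in> fractions A" using b c sub(6) by (intro fractionsI[OF _ nz[OF b(1) c(1)] _ Ac]) auto
    have "(b \<otimes> c) \<otimes> (x \<oplus> y) = c \<otimes> (b \<otimes> x) \<oplus> b \<otimes> (c \<otimes> y)" using b c bc
      by (simp add: m_ac r_distr)
    then show "x \<oplus> y \<in> fractions A" using b c sub(6,7) bc
      by (intro fractionsI[OF _ nz[OF b(1) c(1)] _ Ac]) auto
  next
    fix z assume z: "z \<in> fractions A - {\<zero>}"
    then obtain b where b: "b \<in> A - {\<zero>}" "b \<otimes> z \<in> A" "z \<in> carrier R" using fractionsE[OF _ Ac] by blast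
    have zU: "z \<in> Units R" using z b field_Units by auto
    have "(b \<otimes> z) \<otimes> inv z = b" using b Ac zU by (auto simp: m_assoc)
    moreover have "b \<otimes> z \<noteq> \<zero>" using b z Ac integral[of b z] by auto
    ultimately show "inv z \<in> fractions A" using b zU by (intro fractionsI[of _ "b \<otimes> z" A, OF _ _ _ Ac]) auto
  qed
qed

text \<open>For \<open>f\<close> nonzero this is the localisation \<open>A[1/f]\<close> inside the
  ambient field, again described by clearing denominators.\<close>

definition inverting :: "'a set \<Rightarrow> 'a \<Rightarrow> 'a set" where
  "inverting A f = {z \<in> carrier R. \<exists>N::nat. f [^] N \<otimes> z \<in> A}"

text \<open>Multiplying by a power of \<open>g\<close> repairs the extra factor. This lets
  denominators of different elements be merged into their product.\<close>

lemma inverting_mono: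
  assumes A: "subring A R" and "f \<in> A" "g \<in> A"
  shows "inverting A f \<subseteq> inverting A (f \<otimes> g)"
proof
  note sub = subringE[OF A]
  fix z assume "z \<in> inverting A f"
  then obtain N :: nat where z: "z \<in> carrier R" "f [^] N \<otimes> z \<in> A" unfolding inverting_def by auto
  have c: "f \<in> carrier R" "g \<in> carrier R" using assms sub(1) by auto
  have "g [^] N \<in> A" using assms(3) sub(3,6) by (induct N) auto
  moreover have "(f \<otimes> g) [^] N \<otimes> z = g [^] N \<otimes> (f [^] N \<otimes> z)"
    using c z by (simp add: nat_pow_distrib m_ac)
  ultimately show "z \<in> inverting A (f \<otimes> g)" unfolding inverting_def using z sub(6)
    by (auto intro!: exI[of _ N])
qed

lemma subring_inverting:
  assumes A: "subring A R" and f: "f \<in> A"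
  shows "subring (inverting A f) R" "A \<subseteq> inverting A f"
proof -
  note sub = subringE[OF A]
  have Ac: "A \<subseteq> carrier R" by (rule sub(1))
  have fN: "f [^] N \<in> A" for N :: nat using f sub(3,6) by (induct N) auto
  have fc: "f \<in> carrier R" using f Ac by auto
  show "A \<subseteq> inverting A f"
    unfolding inverting_def using Ac by (auto intro!: exI[of _ "0::nat"])
  show "subring (inverting A f) R"
  proof (rule subringI)
    show "inverting A f \<subseteq> carrier R" unfolding inverting_def by auto
    show "\<one> \<in> inverting A f" using \<open>A \<subseteq> inverting A f\<close> sub(3) by auto
  next
    fix x y assume "x \<in> inverting A f" "y \<in> inverting A f"
    then obtain N M :: nat where
      x: "x \<in> carrier R" "f [^] N \<otimes> x \<in> A" and y: "y \<in> carrier R" "f [^] M \<otimes> y \<in> A"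
      unfolding inverting_def by auto
    have "f [^] N \<otimes> (\<ominus> x) = \<ominus> (f [^] N \<otimes> x)" using x fc by (simp add: r_minus)
    then show "\<ominus> x \<in> inverting A f" unfolding inverting_def using x sub(5) by (auto intro!: exI[of _ N])
    have "f [^] (N + M) \<otimes> (x \<otimes> y) = (f [^] N \<otimes> x) \<otimes> (f [^] M \<otimes> y)" 
      using x y fc by (simp add: nat_pow_mult[symmetric] m_ac)
    then show "x \<otimes> y \<in> inverting A f" unfolding inverting_def using x y sub(6)
      by (auto intro!: exI[of _ "N + M"])
    have "f [^] (N + M) \<otimes> (x \<oplus> y) = f [^] M \<otimes> (f [^] N \<otimes> x) \<oplus> f [^] N \<otimes> (f [^] M \<otimes> y)" 
      using x y fc by (simp add: nat_pow_mult[symmetric] m_ac r_distr)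
    then show "x \<oplus> y \<in> inverting A f" unfolding inverting_def using x y sub(6,7) fN
      by (auto intro!: exI[of _ "N + M"])
  qed
qed

lemma common_denominator:
  assumes A: "subring A R" and "finite C" "C \<subseteq> fractions A"
  obtains f where "f \<in> A - {\<zero>}" "C \<subseteq> inverting A f"
proof -
  note sub = subringE[OF A]
  have "\<exists>f. f \<in> A - {\<zero>} \<and> C \<subseteq> inverting A f"
    using assms(2,3)
  proof (induct C)
    case empty
    then show ?case using sub(3) by auto
  next
    case (insert c C)
    then obtain f where f: "f \<in> A - {\<zero>}" "C \<subseteq> inverting A f" by auto
    from insert obtain b where b: "b \<in> A - {\<zero>}" "b \<otimes> c \<in> A" "c \<in> carrier R"
      using fractionsE[OF _ sub(1)] by blast
    have fb: "f \<in> A" "b \<in> A" using f b by auto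
    have "c \<in> inverting A b" unfolding inverting_def using b fb sub(1) by (auto intro!: exI[of _ "1::nat"])
    moreover have "b \<otimes> f = f \<otimes> b" using fb sub(1) by (intro m_comm) auto
    ultimately have "c \<in> inverting A (f \<otimes> b)" using inverting_mono[OF A fb(2,1)] by auto
    moreover have "C \<subseteq> inverting A (f \<otimes> b)" using f(2) inverting_mono[OF A fb] by auto
    moreover have "f \<otimes> b \<in> A - {\<zero>}" using f b sub integral[of f b] by auto
    ultimately show ?case by auto
  qed
  then show ?thesis using that by blast
qed

text \<open>Put \<open>q = 1 + f x\<close>. Its inverse lies in \<open>A[1/f]\<close>, so
  \<open>q\<close> divides a power of \<open>f\<close> in \<open>A\<close>, hence a power of
  \<open>f x = q - 1\<close>. But \<open>q - 1\<close> is congruent to -1 modulo \<open>q\<close>,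
  so \<open>q\<close> divides 1. This is the ring-theoretic form of Euclid's construction of an
  element coprime to \<open>f\<close>.\<close>

lemma unit_if_fraction_ring_inverting:
  assumes A: "subring A R" and x: "x \<in> A" and f: "f \<in> A"
    and frac: "fractions A \<subseteq> inverting A f" and nz: "\<one> \<oplus> f \<otimes> x \<noteq> \<zero>"
  shows "\<exists>b\<in>A. (\<one> \<oplus> f \<otimes> x) \<otimes> b = \<one>"
proof -
  note sub = subringE[OF A]
  have c: "x \<in> carrier R" "f \<in> carrier R" using x f sub(1) by auto
  define q where "q = \<one> \<oplus> f \<otimes> x"
  have qA: "q \<in> A" unfolding q_def using x f sub(3,6,7) by auto
  then have qc: "q \<in> carrier R" using sub(1) by auto
  have qU: "q \<in> Units R" using qc nz field_Units q_def by auto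
  have "inv q \<in> fractions A"
    by (rule fractionsI[of _ q]) (use qA nz qU q_def sub(1,3) in auto)
  then obtain N :: nat where N: "f [^] N \<otimes> inv q \<in> A" using frac unfolding inverting_def by auto
  have xN: "x [^] N \<in> A" using x sub(3,6) by (induct N) auto
  \<comment> \<open>The quotient of \<open>(f x)^N\<close> by \<open>q\<close>: both factors in the
    definition lie in \<open>A\<close>, although \<open>inv q\<close> need not.\<close>
  define a where "a = x [^] N \<otimes> (f [^] N \<otimes> inv q)"
  have a: "a \<in> A" unfolding a_def using N xN sub(6) by auto
  have fx: "f \<otimes> x = q \<ominus> \<one>" unfolding q_def using c by (simp add: minus_eq a_comm[of \<one>] a_assoc r_neg)
  have "q \<otimes> a = (f \<otimes> x) [^] N"
  proof -
    have "q \<otimes> a = (f [^] N \<otimes> x [^] N) \<otimes> (q \<otimes> inv q)"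
      unfolding a_def using c qc qU Units_inv_closed[OF qU] by (simp only: m_ac m_closed nat_pow_closed)
    then show ?thesis using c qU by (simp add: nat_pow_distrib)
  qed
  then have "\<exists>b\<in>A. q \<otimes> b = (q \<ominus> \<one>) [^] N" using a fx by auto
  then show ?thesis unfolding q_def[symmetric]
  proof (induct N)
    case 0
    then show ?case by auto
  next
    case (Suc N)
    then obtain b where b: "b \<in> A" "q \<otimes> b = (q \<ominus> \<one>) [^] Suc N" by auto
    have q1: "q \<ominus> \<one> \<in> A" using x f sub(6) by (simp add: fx[symmetric])
    have q1N: "(q \<ominus> \<one>) [^] N \<in> A" using q1 sub(3,6) by (induct N) auto
    have bc: "b \<in> carrier R" "(q \<ominus> \<one>) [^] N \<in> carrier R" using b q1N sub(1) by auto
    let ?e = "(q \<ominus> \<one>) [^] N"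
    \<comment> \<open>Descent on the exponent: from \<open>q b = e (q - 1)\<close> follows
      \<open>e = q e - e (q - 1) = q (e - b)\<close>, so \<open>q\<close> already divides the lower
      power \<open>e\<close>.\<close>
    have "q \<otimes> (?e \<ominus> b) = q \<otimes> ?e \<ominus> ?e \<otimes> (q \<ominus> \<one>)"
      using b(2) bc qc by (simp add: minus_eq r_distr r_minus)
    also have "\<dots> = ?e"
      using bc(2) qc m_comm[of q ?e] by (simp add: minus_eq r_distr r_minus minus_add r_neg2)
    finally have "q \<otimes> (?e \<ominus> b) = ?e" .
    moreover have "(q \<ominus> \<one>) [^] N \<ominus> b \<in> A" using q1N b sub(5,7) by (simp add: minus_eq)
    ultimately show ?case using Suc(1) by blast
  qed
qed

text \<open>Otherwise \<open>1 + f x\<close> would be a unit of \<open>K[x]\<close> by the preceding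
  lemma; as \<open>x\<close> is transcendental, \<open>K[x]\<close> is a polynomial ring, and its
  units are constants, whereas \<open>1 + f x\<close> has positive degree.\<close>

lemma fractions_simple_extension_not_inverting:
  assumes K: "subfield K R" and x: "x \<in> carrier R" and tr: "(transcendental over K) x"
    and f: "f \<in> simple_extension K x - {\<zero>}"
  shows "\<not> fractions (simple_extension K x) \<subseteq> inverting (simple_extension K x) f"
proof
  let ?A = "simple_extension K x"
  assume sub: "fractions ?A \<subseteq> inverting ?A f"
  note Kr = subfieldE(1)[OF K]
  have Kc: "K \<subseteq> carrier R" by (rule subfieldE(3)[OF K])
  have A: "subring ?A R" by (rule simple_extension_is_subring[OF Kr x])
  have xA: "x \<in> ?A" by (rule simple_extension_mem[OF Kr x])
  have img: "?A = (\<lambda>p. eval p x) ` carrier (K[X])" by (rule simple_extension_as_eval_img[OF Kc x])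
  interpret UP: domain "K[X]" by (rule univ_poly_is_domain[OF Kr])
  interpret ev: ring_hom_ring "K[X]" R "\<lambda>p. eval p x" by (rule eval_ring_hom[OF Kr x])
  have inj: "inj_on (\<lambda>p. eval p x) (carrier (K[X]))" using tr unfolding over_def transcendental_def .
  obtain p where p: "p \<in> carrier (K[X])" "eval p x = f" using f img by auto
  have pK: "polynomial K p" using p univ_poly_carrier by auto
  have pne: "p \<noteq> []" using p f by auto
  \<comment> \<open>Coefficient lists start with the leading coefficient, so appending
    \<open>\<one>\<close> turns \<open>p\<close> into \<open>X p + 1\<close>, whose value at
    \<open>x\<close> is \<open>1 + f x\<close>.\<close>
  define Q where "Q = p @ [\<one>]"
  have pol: "polynomial K Q" using pK pne subringE(3)[OF Kr] unfolding Q_def polynomial_def by auto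
  then have Qc: "Q \<in> carrier (K[X])" using univ_poly_carrier by auto
  have "set p \<subseteq> carrier R" using pK Kc unfolding polynomial_def by auto
  then have evQ: "eval Q x = \<one> \<oplus> f \<otimes> x" unfolding Q_def
    using eval_append_aux[of p \<one> x] x p f subringE(1)[OF A] by (auto simp: a_comm)
  have Qnz: "Q \<noteq> []" unfolding Q_def by auto
  have "eval Q x \<noteq> \<zero>"
  proof
    assume "eval Q x = \<zero>"
    then have "Q = []" using inj_onD[OF inj _ Qc, of "[]"] UP.zero_closed by (simp add: univ_poly_zero)
    then show False using Qnz by simp
  qed
  then obtain b where b: "b \<in> ?A" "eval Q x \<otimes> b = \<one>"
    using unit_if_fraction_ring_inverting[OF A xA _ sub] f evQ by auto
  then obtain r where r: "r \<in> carrier (K[X])" "eval r x = b" using img by auto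
  have "eval (Q \<otimes>\<^bsub>K[X]\<^esub> r) x = eval \<one>\<^bsub>K[X]\<^esub> x" using b r Qc by simp
  then have "Q \<otimes>\<^bsub>K[X]\<^esub> r = \<one>\<^bsub>K[X]\<^esub>" using inj_onD[OF inj] r Qc by auto
  then have "Q \<in> Units (K[X])" using r Qc UP.m_comm[of Q r] unfolding Units_def by auto
  then show False using univ_poly_units[OF K] pne unfolding Q_def by auto
qed

lemma combine_mult_mem:
  assumes L: "subring L R" and W: "subgroup W (add_monoid R)"
    and LW: "\<And>l w. l \<in> L \<Longrightarrow> w \<in> W \<Longrightarrow> l \<otimes> w \<in> W"
    and t: "t \<in> carrier R" and Us: "set Us \<subseteq> carrier R" "\<And>u. u \<in> set Us \<Longrightarrow> t \<otimes> u \<in> W"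
    and Ls: "set Ls \<subseteq> L"
  shows "t \<otimes> combine Ls Us \<in> W"
  using Ls Us
proof (induct Ls Us rule: combine.induct)
  case (1 k Ks u Us)
  have kc: "k \<in> carrier R" "set Ks \<subseteq> carrier R" using 1(2) subringE(1)[OF L] by auto
  have "t \<otimes> combine (k # Ks) (u # Us) = k \<otimes> (t \<otimes> u) \<oplus> t \<otimes> combine Ks Us"
    using kc 1(3) t by (simp add: r_distr m_ac)
  moreover have "k \<otimes> (t \<otimes> u) \<in> W" using 1 LW by auto
  moreover have "t \<otimes> combine Ks Us \<in> W" using 1 by auto
  ultimately show ?case using subgroup.m_closed[OF W] by simp
qed (use subgroup.one_closed[OF W] t in auto)

text \<open>
  If \<open>F = K[x, xs]\<close> is finite over \<open>K(x)\<close>, with basis \<open>Us\<close>, then inverting a common denominator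
  \<open>f\<close> of the finitely many coordinates of the products \<open>x u\<close>, \<open>x\<^sub>i u\<close> makes the
  \<open>K[x, 1/f]\<close>-span of \<open>Us\<close> all of \<open>F\<close>; comparing coordinates, \<open>K(x) = K[x, 1/f]\<close>.
\<close>

lemma algebraic_if_finite_over_fractions:
  assumes K: "subfield K R" and x: "x \<in> carrier R" and xs: "set xs \<subseteq> carrier R"
    and fg: "finite_extension K (x # xs) = carrier R"
    and fin: "finite_dimension (fractions (simple_extension K x)) (carrier R)"
  shows "(algebraic over K) x"
proof (rule ccontr)
  assume "\<not> (algebraic over K) x"
  then have tr: "(transcendental over K) x" by (simp add: over_def)
  let ?A = "simple_extension K x"
  let ?Q = "fractions ?A"
  note Kr = subfieldE(1)[OF K]
  have Kc: "K \<subseteq> carrier R" by (rule subfieldE(3)[OF K])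
  have A: "subring ?A R" by (rule simple_extension_is_subring[OF Kr x])
  have Q: "subfield ?Q R" by (rule subfield_fractions[OF A])
  obtain m where m: "dimension m ?Q (carrier R)" using fin by auto
  obtain Us where Us: "set Us \<subseteq> carrier R" "independent ?Q Us" "Span ?Q Us = carrier R"
    using exists_base[OF Q m] by auto
  have coord: "\<exists>Ks. set Ks \<subseteq> ?Q \<and> length Ks = length Us \<and> v = combine Ks Us" if "v \<in> carrier R" for v
    using mem_Span_if_combine[OF Q Us(1)] that Us(3) by auto
  define c where "c v = (SOME Ks. set Ks \<subseteq> ?Q \<and> length Ks = length Us \<and> v = combine Ks Us)" for v
  have c: "set (c v) \<subseteq> ?Q" "length (c v) = length Us" "v = combine (c v) Us" if "v \<in> carrier R" for v
    using someI_ex[OF coord[OF that]] unfolding c_def by blast+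
  define T where "T = (\<lambda>(t, u). t \<otimes> u) ` (set (x # xs) \<times> set Us)"
  have Tc: "T \<subseteq> carrier R" unfolding T_def using x xs Us by auto
  have "finite (\<Union>v\<in>T. set (c v))" unfolding T_def by auto
  moreover have "(\<Union>v\<in>T. set (c v)) \<subseteq> ?Q" using c Tc by blast
  ultimately obtain f where f: "f \<in> ?A - {\<zero>}" "(\<Union>v\<in>T. set (c v)) \<subseteq> inverting ?A f"
    using common_denominator[OF A] by metis
  let ?L = "inverting ?A f"
  have L: "subring ?L R" and AL: "?A \<subseteq> ?L" using subring_inverting[OF A] f by auto
  note Ls = subringE[OF L]
  \<comment> \<open>Coordinates are unique only over the fraction field, so the comparison at the
    end needs the localisation to lie inside it.\<close>
  have LQ: "?L \<subseteq> ?Q"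
  proof
    fix z assume "z \<in> ?L"
    then obtain N :: nat where z: "z \<in> carrier R" "f [^] N \<otimes> z \<in> ?A" unfolding inverting_def by auto
    have "f [^] N \<in> ?A" using f subringE(3,6)[OF A] by (induct N) auto
    moreover have "f [^] N \<noteq> \<zero>" using f subringE(1)[OF A] by (induct N) (auto simp: integral_iff subset_iff)
    ultimately show "z \<in> ?Q" using fractionsI[OF z(1) _ z(2)] subringE(1)[OF A] by auto
  qed
  define W where "W = {combine Ks Us | Ks. set Ks \<subseteq> ?L \<and> length Ks = length Us}"
  have Wc: "W \<subseteq> carrier R" unfolding W_def using Us(1) Ls(1) combine_in_carrier by blast
  have LW: "l \<otimes> w \<in> W" if "l \<in> ?L" "w \<in> W" for l w
  proof -
    from that obtain Ks where Ks: "w = combine Ks Us" "set Ks \<subseteq> ?L" "length Ks = length Us"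
      unfolding W_def by auto
    have "l \<otimes> w = combine (map ((\<otimes>) l) Ks) Us"
      unfolding Ks(1) by (rule combine_r_distr) (use Ks that Us Ls(1) in auto)
    moreover have "set (map ((\<otimes>) l) Ks) \<subseteq> ?L" using Ks that Ls(6) by auto
    ultimately show ?thesis unfolding W_def using Ks by (auto intro!: exI[of _ "map ((\<otimes>) l) Ks"])
  qed
  have add: "v \<oplus> w \<in> W" if vw: "v \<in> W" "w \<in> W" for v w
  proof -
    from vw obtain Ks where Ks: "v = combine Ks Us" "set Ks \<subseteq> ?L" "length Ks = length Us"
      unfolding W_def by auto
    from vw obtain Ks' where Ks': "w = combine Ks' Us" "set Ks' \<subseteq> ?L" "length Ks' = length Us"
      unfolding W_def by auto
    have "v \<oplus> w = combine (map2 (\<oplus>) Ks Ks') Us"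
      unfolding Ks(1) Ks'(1) by (rule combine_add) (use Ks Ks' Us Ls(1) in auto)
    moreover have "set (map2 (\<oplus>) Ks Ks') \<subseteq> ?L" using Ks(2) Ks'(2) Ls(7)
      by (auto intro!: Ls(7) dest: set_zip_leftD[THEN subsetD[OF Ks(2)]] set_zip_rightD[THEN subsetD[OF Ks'(2)]])
    ultimately show ?thesis unfolding W_def using Ks Ks' by (auto intro!: exI[of _ "map2 (\<oplus>) Ks Ks'"])
  qed
  have neg: "\<ominus> w \<in> W" if "w \<in> W" for w
  proof -
    have "\<ominus> w = (\<ominus> \<one>) \<otimes> w" using that Wc by (simp add: l_minus subset_iff)
    then show ?thesis using LW[OF _ that, of "\<ominus> \<one>"] Ls(3,5) by auto
  qed
  have zero: "\<zero> \<in> W"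
    unfolding W_def using combine_replicate[OF Us(1)] Ls(2)
    by (auto intro!: exI[of _ "replicate (length Us) \<zero>"])
  have Wg: "subgroup W (add_monoid R)"
    by (rule add.subgroupI) (use Wc zero neg add in auto)
  have UW: "t \<otimes> u \<in> W" if t: "t \<in> set (x # xs)" and u: "u \<in> set Us" for t u
  proof -
    have tu: "t \<otimes> u \<in> T" unfolding T_def using t u by auto
    then have "set (c (t \<otimes> u)) \<subseteq> ?L" using f by auto
    then show ?thesis unfolding W_def using c[of "t \<otimes> u"] tu Tc by blast
  qed
  have stab: "t \<otimes> w \<in> W" if t: "t \<in> set (x # xs)" and w: "w \<in> W" for t w
  proof -
    from w obtain Ks where Ks: "w = combine Ks Us" "set Ks \<subseteq> ?L" unfolding W_def by auto
    show ?thesis unfolding Ks(1)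
      by (rule combine_mult_mem[OF L Wg LW _ Us(1) UW[OF t] Ks(2)]) (use t x xs in auto)
  qed
  \<comment> \<open>The multipliers of \<open>W\<close> form a subring. It contains \<open>K\<close>
    and all the generators, hence everything; so \<open>W\<close> is stable under the whole field
    although only the generators were checked.\<close>
  let ?S = "{t \<in> carrier R. \<forall>w\<in>W. t \<otimes> w \<in> W}"
  have "subring ?S R"
  proof (rule subringI)
    show "\<one> \<in> ?S" using Wc by auto
  next
    fix s t assume s: "s \<in> ?S" and t: "t \<in> ?S"
    show "\<ominus> s \<in> ?S" using s Wc neg by (auto simp: l_minus subset_iff)
    have "s \<otimes> t \<otimes> w = s \<otimes> (t \<otimes> w)" if "w \<in> W" for w using s t that Wc by (auto simp: m_assoc)
    then show "s \<otimes> t \<in> ?S" using s t by auto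
    have "(s \<oplus> t) \<otimes> w = s \<otimes> w \<oplus> t \<otimes> w" if "w \<in> W" for w using s t that Wc by (auto simp: l_distr)
    then show "s \<oplus> t \<in> ?S" using s t add by auto
  qed auto
  moreover have "K \<subseteq> ?S" using simple_extension_incl[OF Kc x] AL LW Kc by auto
  moreover have "set (x # xs) \<subseteq> ?S" using stab x xs by auto
  ultimately have "finite_extension K (x # xs) \<subseteq> ?S" by (rule finite_extension_subring_incl)
  then have all: "t \<otimes> w \<in> W" if "t \<in> carrier R" "w \<in> W" for t w using fg that by auto
  have "Us \<noteq> []"
  proof
    assume "Us = []"
    then have "carrier R = {\<zero>}" using Us(3) by simp
    then show False using one_not_zero one_closed by (metis singletonD)
  qed
  then obtain u Us' where U: "Us = u # Us'" by (cases Us) auto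
  have uc: "u \<in> carrier R" "set Us' \<subseteq> carrier R" using U Us by auto
  have uW: "u \<in> W"
  proof -
    have "u = combine (\<one> # replicate (length Us') \<zero>) Us"
      unfolding U using uc combine_replicate[of Us'] by simp
    then show ?thesis unfolding W_def using Ls(2,3) U
      by (auto intro!: exI[of _ "\<one> # replicate (length Us') \<zero>"])
  qed
  \<comment> \<open>For \<open>u\<close> the first basis vector, \<open>y u\<close> has coordinates
    \<open>(y, 0, ..., 0)\<close> over the fraction field; as an element of \<open>W\<close> it also
    has coordinates in the localisation. Uniqueness puts \<open>y\<close> there.\<close>
  have "?Q \<subseteq> ?L"
  proof
    fix y assume y: "y \<in> ?Q"
    then have yc: "y \<in> carrier R" using subfieldE(3)[OF Q] by auto
    then obtain Ks where Ks: "y \<otimes> u = combine Ks Us" "set Ks \<subseteq> ?L" "length Ks = length Us"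
      using all[OF yc uW] unfolding W_def by auto
    let ?Ys = "y # replicate (length Us') \<zero>"
    have "y \<otimes> u = combine ?Ys Us"
      unfolding U using uc yc combine_replicate[of Us'] by simp
    moreover have "set ?Ys \<subseteq> ?Q" "length ?Ys = length Us"
      using y U subfieldE(1)[OF Q, THEN subringE(2)] by auto
    moreover have "y \<otimes> u \<in> Span ?Q Us" using Us(3) uc yc by simp
    moreover have "set Ks \<subseteq> ?Q" using Ks(2) LQ by blast
    ultimately have "Ks = ?Ys"
      using unique_decomposition[OF Q Us(2), of "y \<otimes> u"] Ks(1,3) by blast
    then show "y \<in> ?L" using Ks by auto
  qed
  then show False using fractions_simple_extension_not_inverting[OF K x tr f(1)] by simp
qed

text \<open>The induction varies the base field. Over the fraction field of \<open>K[x]\<close> one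
  generator less is needed, so the field is finite over it and \<open>x\<close> is algebraic over
  \<open>K\<close>. Then \<open>K[x]\<close> is itself a field, the induction hypothesis applies to
  it, and dimensions multiply in the tower.\<close>

theorem zariski_lemma:
  assumes "subfield K R" "set xs \<subseteq> carrier R" "finite_extension K xs = carrier R"
  shows "finite_dimension K (carrier R)"
  using assms
proof (induct xs arbitrary: K)
  case Nil
  then show ?case using finite_dimensionI[OF dimension_one] by auto
next
  case (Cons x xs)
  let ?A = "simple_extension K x"
  note K = Cons(2)
  note Kr = subfieldE(1)[OF K]
  have Kc: "K \<subseteq> carrier R" by (rule subfieldE(3)[OF K])
  have x: "x \<in> carrier R" and xs: "set xs \<subseteq> carrier R" using Cons(3) by auto
  have A: "subring ?A R" by (rule simple_extension_is_subring[OF Kr x])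
  \<comment> \<open>Stated for any subfield above \<open>K[x]\<close> because it is used twice: for
    the fraction field, while \<open>x\<close> might still be transcendental, and for
    \<open>K[x]\<close> once \<open>x\<close> is known to be algebraic.\<close>
  have ext: "finite_dimension K' (carrier R)" if K': "subfield K' R" "?A \<subseteq> K'" for K'
  proof (rule Cons(1)[OF K'(1) xs])
    have "subring (finite_extension K' xs) R" using finite_extension_is_subring[OF subfieldE(1)[OF K'(1)] xs] .
    moreover have K'x: "K' \<subseteq> finite_extension K' xs" by (rule finite_extension_incl[OF subfieldE(3)[OF K'(1)] xs])
    have "K \<subseteq> finite_extension K' xs" "x \<in> finite_extension K' xs"
      using K'x K'(2) simple_extension_incl[OF Kc x] simple_extension_mem[OF Kr x] by blast+
    moreover have "set xs \<subseteq> finite_extension K' xs"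
      by (rule finite_extension_mem[OF subfieldE(1)[OF K'(1)] xs])
    ultimately have "finite_extension K (x # xs) \<subseteq> finite_extension K' xs"
      by (intro finite_extension_subring_incl) auto
    then show "finite_extension K' xs = carrier R"
      using Cons(4) finite_extension_in_carrier[OF subfieldE(3)[OF K'(1)] xs] by auto
  qed
  have alg: "(algebraic over K) x"
    using algebraic_if_finite_over_fractions[OF K x xs Cons(4)]
      ext[OF subfield_fractions[OF A] subring_subset_fractions[OF A]] by blast
  have sf: "subfield ?A R" using simple_extension_is_subfield[OF K x] alg by simp
  show ?case
    using telescopic_base_dim(1)[OF K sf _ ext[OF sf]] finite_dimension_simple_extension[OF K x] alg
    by simp
qed

end

section \<open>Prime ideals avoiding a multiplicative set\<close>

text \<open>Krull's argument: by Zorn's lemma some ideal is maximal among those that contain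
  \<open>I\<close> and avoid \<open>S\<close>. If \<open>a\<close> and \<open>b\<close> lie outside
  it, enlarging by either one meets \<open>S\<close>; the product of the two elements so found is in
  \<open>S\<close>, and would lie in the ideal if \<open>a b\<close> did.\<close>

lemma (in cring) primeideal_avoiding:
  assumes I: "ideal I R" and S: "S \<subseteq> carrier R" "\<one> \<in> S" "\<And>x y. x \<in> S \<Longrightarrow> y \<in> S \<Longrightarrow> x \<otimes> y \<in> S"
    and disj: "I \<inter> S = {}"
  obtains P where "primeideal P R" "I \<subseteq> P" "P \<inter> S = {}"
proof -
  let ?F = "{J. ideal J R \<and> I \<subseteq> J \<and> J \<inter> S = {}}"
  have "\<exists>P\<in>?F. \<forall>J\<in>?F. P \<subseteq> J \<longrightarrow> J = P"
  proof (rule subset_Zorn)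
    fix C assume C: "subset.chain ?F C"
    show "\<exists>U\<in>?F. \<forall>J\<in>C. J \<subseteq> U"
    proof (cases "C = {}")
      case True
      then show ?thesis using I disj by auto
    next
      case False
      have "subset.chain {J. ideal J R} C" using C unfolding pred_on.chain_def by auto
      then have "ideal (\<Union>C) R" using chain_Union_is_ideal[of C] False by simp
      moreover have "I \<subseteq> J" "J \<inter> S = {}" if "J \<in> C" for J using C that unfolding pred_on.chain_def by auto
      then have "I \<subseteq> \<Union>C" "\<Union>C \<inter> S = {}" using False by blast+
      ultimately show ?thesis by (intro bexI[of _ "\<Union>C"]) auto
    qed
  qed
  then obtain P where P: "ideal P R" "I \<subseteq> P" "P \<inter> S = {}"
    and "\<forall>J\<in>?F. P \<subseteq> J \<longrightarrow> J = P"
    by (elim bexE CollectE conjE)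
  then have max: "J = P" if "ideal J R" "P \<subseteq> J" "J \<inter> S = {}" for J
    using that by simp
  interpret P: ideal P R by fact
  \<comment> \<open>Adjoining \<open>a\<close> gives a strictly larger ideal, so maximality forces
    it to meet \<open>S\<close>.\<close>
  have meets: "\<exists>s\<in>S. \<exists>r\<in>carrier R. \<exists>p\<in>P. s = p \<oplus> r \<otimes> a" if a: "a \<in> carrier R" "a \<notin> P" for a
  proof -
    have J: "ideal (P <+>\<^bsub>R\<^esub> PIdl a) R" by (rule add_ideals[OF P(1) cgenideal_ideal[OF a(1)]])
    have PJ: "P \<subseteq> P <+>\<^bsub>R\<^esub> PIdl a" 
    proof
      fix p assume "p \<in> P"
      moreover have "\<zero> \<in> PIdl a" using additive_subgroup.zero_closed[OF ideal.axioms(1)[OF cgenideal_ideal[OF a(1)]]] .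
      moreover have "p = p \<oplus> \<zero>" using \<open>p \<in> P\<close> by simp
      ultimately show "p \<in> P <+>\<^bsub>R\<^esub> PIdl a" unfolding set_add_def' by blast
    qed
    have "\<zero> \<oplus> a \<in> P <+>\<^bsub>R\<^esub> PIdl a"
      using P.zero_closed cgenideal_self[OF a(1)] unfolding set_add_def' by blast
    then have "a \<in> P <+>\<^bsub>R\<^esub> PIdl a" using a(1) by simp
    then have "(P <+>\<^bsub>R\<^esub> PIdl a) \<inter> S \<noteq> {}" using max[OF J PJ] a by auto
    then obtain s where "s \<in> S" "s \<in> P <+>\<^bsub>R\<^esub> PIdl a" by auto
    then show ?thesis unfolding set_add_def' cgenideal_def by blast
  qed
  have "primeideal P R"
  proof (rule primeidealI[OF P(1) is_cring])
    show "carrier R \<noteq> P" using P(3) S by auto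
  next
    fix a b assume ab: "a \<in> carrier R" "b \<in> carrier R" "a \<otimes> b \<in> P"
    show "a \<in> P \<or> b \<in> P"
    proof (rule ccontr)
      assume "\<not> (a \<in> P \<or> b \<in> P)"
      then obtain s r p t q u where s: "s \<in> S" "r \<in> carrier R" "p \<in> P" "s = p \<oplus> r \<otimes> a"
        and t: "t \<in> S" "q \<in> carrier R" "u \<in> P" "t = u \<oplus> q \<otimes> b"
        using meets[OF ab(1)] meets[OF ab(2)] by blast
      have c: "p \<in> carrier R" "u \<in> carrier R" using s t P.Icarr by auto
      have "s \<otimes> t = p \<otimes> t \<oplus> (r \<otimes> a) \<otimes> u \<oplus> (r \<otimes> q) \<otimes> (a \<otimes> b)"
        unfolding s(4) t(4) using s(2) t(2) ab c by (simp add: l_distr r_distr m_ac a_ac)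
      moreover have "t \<in> carrier R" using t S by auto
      moreover have "p \<otimes> t \<in> P" using P.I_r_closed[OF s(3)] calculation(2) .
      moreover have "(r \<otimes> a) \<otimes> u \<in> P" using P.I_l_closed[OF t(3)] s(2) ab(1) by simp
      moreover have "(r \<otimes> q) \<otimes> (a \<otimes> b) \<in> P" using P.I_l_closed[OF ab(3)] s(2) t(2) by simp
      ultimately have "s \<otimes> t \<in> P" using P.a_closed by simp
      then show False using S(3)[OF s(1) t(1)] P(3) by auto
    qed
  qed
  then show ?thesis using that P by blast
qed

lemma (in ring) quotient_mem_iff:
  assumes "ideal I R" "ideal P R" "I \<subseteq> P" "a \<in> carrier R"
  shows "I +> a \<in> (+>) I ` P \<longleftrightarrow> a \<in> P"
proof
  assume "I +> a \<in> (+>) I ` P"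
  then obtain p where p: "p \<in> P" "I +> a = I +> p" by auto
  interpret P: ideal P R by fact
  have pc: "p \<in> carrier R" using p P.Icarr by auto
  then have "a \<ominus> p \<in> P" using quotient_eq_iff_same_a_r_cos[OF assms(1,4) pc] p assms(3) by auto
  then have "(a \<ominus> p) \<oplus> p \<in> P" using p by auto
  then show "a \<in> P" using assms(4) pc by (simp add: minus_eq a_assoc l_neg)
qed auto

lemma (in cring) primeideal_quotient:
  assumes I: "ideal I R" and P: "primeideal P R" and IP: "I \<subseteq> P"
  shows "primeideal ((+>) I ` P) (R Quot I)"
proof -
  interpret I: ideal I R by fact
  interpret P: primeideal P R by fact
  have Pi: "ideal P R" ..
  show ?thesis
  proof (rule primeidealI)
    show "ideal ((+>) I ` P) (R Quot I)" by (rule ring_ideal_imp_quot_ideal[OF I Pi])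
    show "cring (R Quot I)" by (rule I.quotient_is_cring[OF is_cring])
    have "I +> \<one> \<notin> (+>) I ` P"
      using quotient_mem_iff[OF I Pi IP one_closed] P.I_notcarr P.one_imp_carrier by auto
    moreover have "I +> \<one> \<in> carrier (R Quot I)" unfolding FactRing_simps by auto
    ultimately show "carrier (R Quot I) \<noteq> (+>) I ` P" by metis
  next
    fix a b assume "a \<in> carrier (R Quot I)" "b \<in> carrier (R Quot I)"
      and ab: "a \<otimes>\<^bsub>R Quot I\<^esub> b \<in> (+>) I ` P"
    then obtain x y where xy: "x \<in> carrier R" "y \<in> carrier R" "a = I +> x" "b = I +> y"
      unfolding FactRing_simps by auto
    have "a \<otimes>\<^bsub>R Quot I\<^esub> b = I +> (x \<otimes> y)"
      unfolding FactRing_def using xy I.rcoset_mult_add by simp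
    then have "x \<otimes> y \<in> P" using ab quotient_mem_iff[OF I Pi IP] xy by simp
    then have "x \<in> P \<or> y \<in> P" using P.I_prime xy by auto
    then show "a \<in> (+>) I ` P \<or> b \<in> (+>) I ` P" using xy by auto
  qed
qed

text \<open>A proper ideal strictly above \<open>P\<close> is contained in a prime \<open>Q\<close>,
  obtained by avoiding \<open>{\<one>}\<close>. The images of \<open>P\<close> and \<open>Q\<close>
  then form a chain of length 1 in the quotient.\<close>

lemma (in cring) maximalideal_if_krull_dim_0:
  assumes I: "ideal I R" and P: "primeideal P R" "I \<subseteq> P" and dim: "krull_dim (R Quot I) = 0"
  shows "maximalideal P R"
proof -
  interpret P: primeideal P R by fact
  have Pi: "ideal P R" ..
  show ?thesis
  proof (rule maximalidealI[OF Pi P.I_notcarr])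
    fix J assume J: "ideal J R" "P \<subseteq> J" "J \<subseteq> carrier R"
    show "J = P \<or> J = carrier R"
    proof (rule ccontr)
      assume *: "\<not> (J = P \<or> J = carrier R)"
      then have "J \<inter> {\<one>} = {}" using ideal.one_imp_carrier[OF J(1)] by auto
      then obtain Q where Q: "primeideal Q R" "J \<subseteq> Q"
        using primeideal_avoiding[OF J(1), of "{\<one>}"] by auto
      interpret Q: primeideal Q R by fact
      have Qi: "ideal Q R" ..
      obtain q where q: "q \<in> Q" "q \<notin> P" using * J Q by auto
      \<comment> \<open>Chains are indexed by all natural numbers, but only indices 0 and 1 are
        inspected; the constant tail is padding.\<close>
      define Ps where "Ps i = (+>) I ` (if i = 0 then P else Q)" for i :: nat
      have "Ps 0 \<subset> Ps 1"
        unfolding Ps_def using J(2) Q(2) quotient_mem_iff[OF I Pi P(2), of q] q Q.Icarr by auto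
      moreover have "primeideal (Ps i) (R Quot I)" for i
        unfolding Ps_def using primeideal_quotient[OF I P] primeideal_quotient[OF I Q(1)] P(2) J(2) Q(2) by auto
      ultimately have "enat 1 \<le> krull_dim (R Quot I)"
        unfolding krull_dim_def by (intro Sup_upper) (auto intro!: exI[of _ 1] exI[of _ Ps])
      then show False using dim by (simp add: enat_0_iff)
    qed
  qed
qed

section \<open>Constants and variables\<close>

lemma poly_ring_simps [simp]:
  "p \<otimes>\<^bsub>poly_ring n\<^esub> q = p * q" "\<one>\<^bsub>poly_ring n\<^esub> = 1" "p \<oplus>\<^bsub>poly_ring n\<^esub> q = p + q" "\<zero>\<^bsub>poly_ring n\<^esub> = 0"
  by (simp_all add: poly_ring_def)

lemma poly_ring_closed [simp]:
  assumes "p \<in> carrier (poly_ring n)" "q \<in> carrier (poly_ring n)"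
  shows "p + q \<in> carrier (poly_ring n)" "p * q \<in> carrier (poly_ring n)"
  using cring.cring_simprules(1)[OF cring_poly_ring assms] cring.cring_simprules(5)[OF cring_poly_ring assms]
  by simp_all

lemma poly_ring_closed_0_1 [simp]: "0 \<in> carrier (poly_ring n)" "1 \<in> carrier (poly_ring n)"
  by (simp_all add: poly_ring_def)

lemma poly_ring_closed_uminus [simp]: "p \<in> carrier (poly_ring n) \<Longrightarrow> - p \<in> carrier (poly_ring n)"
  by (simp add: poly_ring_def)

lemma poly_ring_closed_minus [simp]:
  "p \<in> carrier (poly_ring n) \<Longrightarrow> q \<in> carrier (poly_ring n) \<Longrightarrow> p - q \<in> carrier (poly_ring n)"
  using poly_ring_closed(1)[of p n "- q"] by simp

lemma poly_ring_uminus [simp]: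
  assumes "p \<in> carrier (poly_ring n)" shows "\<ominus>\<^bsub>poly_ring n\<^esub> p = - p"
proof -
  interpret cring "poly_ring n :: ('a mpoly) ring" by (rule cring_poly_ring)
  have "p \<oplus>\<^bsub>poly_ring n\<^esub> - p = \<zero>\<^bsub>poly_ring n\<^esub>" by simp
  then show ?thesis using assms by (metis minus_equality a_comm poly_ring_closed_uminus)
qed

lemma poly_ring_minus [simp]:
  "p \<in> carrier (poly_ring n) \<Longrightarrow> q \<in> carrier (poly_ring n) \<Longrightarrow> p \<ominus>\<^bsub>poly_ring n\<^esub> q = p - q"
  by (simp add: a_minus_def)

lemma poly_ring_closed_sum [simp]:
  "(\<And>i. i \<in> A \<Longrightarrow> f i \<in> carrier (poly_ring n)) \<Longrightarrow> sum f A \<in> carrier (poly_ring n)"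
  by (induct A rule: infinite_finite_induct) auto

lemma poly_ring_closed_prod [simp]:
  "(\<And>i. i \<in> A \<Longrightarrow> f i \<in> carrier (poly_ring n)) \<Longrightarrow> prod f A \<in> carrier (poly_ring n)"
  by (induct A rule: infinite_finite_induct) auto

lemma poly_ring_closed_power [simp]: "p \<in> carrier (poly_ring n) \<Longrightarrow> p ^ k \<in> carrier (poly_ring n)"
  by (induct k) auto

lemmas const_closed [simp] = const_in_carrier

lemma const_0 [simp]: "const 0 = 0" by (simp add: const_def)
lemma const_1 [simp]: "const 1 = 1" by (simp add: const_def)
lemma const_add: "const (a + b) = const a + const b" by (simp add: const_def single_add)
lemma const_mult: "const (a * b) = const a * (const b :: 'a::comm_semiring_1 mpoly)" by (simp add: const_def mult_single)
lemma const_uminus: "const (- a) = - (const a :: 'a::ab_group_add mpoly)" by (simp add: const_def single_uminus)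
lemma const_eq_0_iff [simp]: "const a = 0 \<longleftrightarrow> a = 0"
  unfolding const_def by (metis lookup_single_eq lookup_zero single_zero)
lemma const_eq_iff [simp]: "const a = const b \<longleftrightarrow> a = b"
  unfolding const_def by (metis lookup_single_eq)
lemma const_inverse: "a \<noteq> 0 \<Longrightarrow> const a * const (inverse a) = (1 :: 'a::field mpoly)"
  by (simp add: const_mult[symmetric])

section \<open>Variables as ring generators\<close>

definition indet :: "nat \<Rightarrow> 'k::zero_neq_one mpoly" where
  "indet i = Poly_Mapping.single (Poly_Mapping.single i 1) 1"

lemma indet_closed [simp]: "i < n \<Longrightarrow> indet i \<in> carrier (poly_ring n)"
  by (simp add: indet_def poly_ring_def)

lemma indet_power: "(indet i :: 'k::comm_semiring_1 mpoly) ^ e = Poly_Mapping.single (Poly_Mapping.single i e) 1"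
  by (induct e) (simp_all add: indet_def mult_single single_add[symmetric])

lemma monomial_eq_prod:
  assumes "finite A" "Poly_Mapping.keys m \<subseteq> A"
  shows "(Poly_Mapping.single m 1 :: 'k::comm_semiring_1 mpoly) = (\<Prod>i\<in>A. indet i ^ Poly_Mapping.lookup m i)"
  using assms
proof (induct A arbitrary: m)
  case empty
  then show ?case by simp
next
  case (insert i A)
  let ?m = "m - Poly_Mapping.single i (Poly_Mapping.lookup m i)"
  have lk: "Poly_Mapping.lookup ?m j = (if j = i then 0 else Poly_Mapping.lookup m j)" for j
    by (auto simp: lookup_minus lookup_single when_def)
  have "m = Poly_Mapping.single i (Poly_Mapping.lookup m i) + ?m"
    by (rule poly_mapping_eqI) (simp add: lookup_add lookup_single lk when_def)
  then have "Poly_Mapping.single m (1::'k) = indet i ^ Poly_Mapping.lookup m i * Poly_Mapping.single ?m 1"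
    by (metis mult_single mult_1 indet_power)
  also have "Poly_Mapping.single ?m (1::'k) = (\<Prod>j\<in>A. indet j ^ Poly_Mapping.lookup ?m j)"
    by (rule insert(3)) (use insert(4) lk in \<open>auto simp: in_keys_iff subset_iff split: if_splits\<close>)
  also have "\<dots> = (\<Prod>j\<in>A. indet j ^ Poly_Mapping.lookup m j)"
    by (rule prod.cong) (use insert(2) lk in auto)
  finally show ?case using insert by simp
qed

lemma mpoly_eq_sum:
  "p = (\<Sum>m\<in>Poly_Mapping.keys p. const (Poly_Mapping.lookup p m) * Poly_Mapping.single m 1)"
  for p :: "'k::comm_semiring_1 mpoly"
proof (rule poly_mapping_eqI)
  fix m
  show "Poly_Mapping.lookup p m = Poly_Mapping.lookup (\<Sum>m\<in>Poly_Mapping.keys p. const (Poly_Mapping.lookup p m) * Poly_Mapping.single m 1) m"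
    by (simp add: const_def mult_single lookup_sum lookup_single when_def in_keys_iff)
qed

text \<open>Constants and variables generate the polynomial ring, since every polynomial is a finite
  sum of constants times products of powers of variables. Stability of a subspace under all of
  \<open>D\<close> thus needs checking only for these generators.\<close>

lemma poly_ring_induct [consumes 1, case_names const var add mult]:
  assumes p: "p \<in> carrier (poly_ring n)"
    and const: "\<And>c. Q (const c)" and var: "\<And>i. i < n \<Longrightarrow> Q (indet i)"
    and add: "\<And>p q. p \<in> carrier (poly_ring n) \<Longrightarrow> q \<in> carrier (poly_ring n) \<Longrightarrow> Q p \<Longrightarrow> Q q \<Longrightarrow> Q (p + q)"
    and mult: "\<And>p q. p \<in> carrier (poly_ring n) \<Longrightarrow> q \<in> carrier (poly_ring n) \<Longrightarrow> Q p \<Longrightarrow> Q q \<Longrightarrow> Q (p * q)"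
  shows "Q p"
proof -
  have pow: "Q (indet i ^ e)" if "i < n" for i e
    by (induct e) (use const[of 1] that var mult in auto)
  have prod: "Q (\<Prod>i<k. indet i ^ e i)" if "k \<le> n" for k and e :: "nat \<Rightarrow> nat"
    using that
  proof (induct k)
    case 0
    then show ?case using const[of 1] by simp
  next
    case (Suc k)
    have "(\<Prod>i<k. indet i ^ e i) \<in> carrier (poly_ring n)"
      using Suc(2) by (intro poly_ring_closed_prod poly_ring_closed_power indet_closed) auto
    then show ?case using Suc pow[of k "e k"] by (auto intro!: mult)
  qed
  have mono: "Q (const (Poly_Mapping.lookup p m) * Poly_Mapping.single m 1)" if "m \<in> Poly_Mapping.keys p" for m
  proof -
    have "Poly_Mapping.keys m \<subseteq> {..<n}" using p that by (auto simp: poly_ring_def)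
    then have "(Poly_Mapping.single m 1 :: 'a mpoly) = (\<Prod>i<n. indet i ^ Poly_Mapping.lookup m i)"
      by (intro monomial_eq_prod) auto
    moreover have "(\<Prod>i<n. indet i ^ Poly_Mapping.lookup m i) \<in> carrier (poly_ring n)"
      by (intro poly_ring_closed_prod poly_ring_closed_power indet_closed) auto
    ultimately show ?thesis using mult[OF const_closed _ const prod[of n "Poly_Mapping.lookup m"]] by simp
  qed
  have termc: "const (Poly_Mapping.lookup p m) * Poly_Mapping.single m 1 \<in> carrier (poly_ring n)"
    if "m \<in> Poly_Mapping.keys p" for m
    using p that by (simp add: poly_ring_def const_def mult_single)
  have "Q (\<Sum>m\<in>A. const (Poly_Mapping.lookup p m) * Poly_Mapping.single m 1)" if "A \<subseteq> Poly_Mapping.keys p" for A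
    using finite_subset[OF that finite_keys] that
  proof (induct A)
    case empty
    then show ?case using const[of 0] by simp
  next
    case (insert m A)
    then have "Q (const (Poly_Mapping.lookup p m) * Poly_Mapping.single m 1
        + (\<Sum>m\<in>A. const (Poly_Mapping.lookup p m) * Poly_Mapping.single m 1))"
      using termc mono by (intro add poly_ring_closed_sum) auto
    then show ?case using insert by simp
  qed
  from this[OF order_refl] show ?thesis unfolding mpoly_eq_sum[of p, symmetric] .
qed

text \<open>The element \<open>g(d_i)\<close> of \<open>k[d_i]\<close>. Keeping \<open>g\<close> a
  univariate polynomial gives access to its degree and to the absence of zero divisors.\<close>

definition poly_in_var :: "nat \<Rightarrow> 'k::comm_semiring_1 poly \<Rightarrow> 'k mpoly" where
  "poly_in_var i g = poly (map_poly const g) (indet i)"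

lemma poly_in_var_0 [simp]: "poly_in_var i 0 = 0"
  by (simp add: poly_in_var_def)

lemma poly_in_var_pCons [simp]: "poly_in_var i (pCons a g) = const a + indet i * poly_in_var i g"
  unfolding poly_in_var_def by (subst map_poly_pCons) (simp_all only: const_0 poly_pCons)

lemma poly_in_var_1 [simp]: "poly_in_var i 1 = 1"
  unfolding one_pCons by simp

lemma poly_in_var_add: "poly_in_var i (g + h) = poly_in_var i g + poly_in_var i h"
  by (induct g h rule: poly_induct2) (simp_all add: const_add algebra_simps)

lemma poly_in_var_smult: "poly_in_var i (Polynomial.smult a g) = const a * poly_in_var i g"
  by (induct g) (simp_all add: const_mult algebra_simps)

lemma poly_in_var_mult: "poly_in_var i (g * h) = poly_in_var i g * poly_in_var i h"
  by (induct g) (simp_all add: poly_in_var_add poly_in_var_smult algebra_simps)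

lemma poly_in_var_monom: "poly_in_var i (Polynomial.monom a e) = const a * indet i ^ e"
  by (induct e) (simp_all add: monom_0 monom_Suc algebra_simps)

lemma poly_in_var_closed [simp]: "i < n \<Longrightarrow> poly_in_var i g \<in> carrier (poly_ring n)"
  by (induct g) simp_all

section \<open>Zero-dimensional quotients of the polynomial ring\<close>

text \<open>The residue field is generated over the image of \<open>k\<close> by the classes of the
  variables, so Zariski's lemma makes it finite and each variable algebraic. What remains is to lift
  the algebraic equation to coefficients in \<open>k\<close>.\<close>

lemma residue_field_algebraic:
  assumes P: "maximalideal P (poly_ring n)" and i: "i < n"
  obtains g where "g \<noteq> 0" "poly_in_var i g \<in> P"
proof -
  let ?D = "poly_ring n :: ('a mpoly) ring"
  interpret D: cring ?D by (rule cring_poly_ring)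
  interpret P: maximalideal P ?D by fact
  have Pi: "ideal P ?D" ..
  let ?F = "?D Quot P"
  interpret F: field ?F by (rule P.quotient_is_field[OF cring_poly_ring])
  let ?h = "(+>\<^bsub>?D\<^esub>) P"
  interpret h: ring_hom_ring ?D ?F ?h by (rule P.rcos_ring_hom_ring)
  have F: "carrier ?F = ?h ` carrier ?D" unfolding FactRing_simps by auto
  have h_eq: "?h p = ?h q \<longleftrightarrow> p - q \<in> P" if "p \<in> carrier ?D" "q \<in> carrier ?D" for p q
    using D.quotient_eq_iff_same_a_r_cos[OF Pi that] that by simp
  have h0: "?h p = \<zero>\<^bsub>?F\<^esub> \<longleftrightarrow> p \<in> P" if "p \<in> carrier ?D" for p
    using h_eq[OF that, of 0] h.hom_zero by simp
  \<comment> \<open>The copy of \<open>k\<close> inside the residue field; field extensions are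
    treated as subfields of one fixed field.\<close>
  define K where "K = ?h ` range const"
  have hc: "?h (const a) \<in> carrier ?F" for a by simp
  have ha: "?h (p + q) = ?h p \<oplus>\<^bsub>?F\<^esub> ?h q" if "p \<in> carrier ?D" "q \<in> carrier ?D" for p q
    using h.hom_add[OF that] by simp
  have hm: "?h (p * q) = ?h p \<otimes>\<^bsub>?F\<^esub> ?h q" if "p \<in> carrier ?D" "q \<in> carrier ?D" for p q
    using h.hom_mult[OF that] by simp
  have hn: "?h (- p) = \<ominus>\<^bsub>?F\<^esub> ?h p" if "p \<in> carrier ?D" for p
    using h.hom_a_inv[OF that] that by simp
  have h1: "?h 1 = \<one>\<^bsub>?F\<^esub>" using h.hom_one by simp
  have K: "subfield K ?F"
  proof (rule F.subfieldI'[OF F.subringI])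
    show "K \<subseteq> carrier ?F" unfolding K_def using hc by auto
    show "\<one>\<^bsub>?F\<^esub> \<in> K" unfolding K_def using h1 by (metis const_1 imageI rangeI)
  next
    fix x y assume "x \<in> K" "y \<in> K"
    then obtain a b where x: "x = ?h (const a)" and y: "y = ?h (const b)" unfolding K_def by auto
    show "\<ominus>\<^bsub>?F\<^esub> x \<in> K" unfolding x K_def using hn[of "const a"] by (metis const_closed const_uminus imageI rangeI)
    show "x \<otimes>\<^bsub>?F\<^esub> y \<in> K" unfolding x y K_def using hm[of "const a" "const b"] by (metis const_closed const_mult imageI rangeI)
    show "x \<oplus>\<^bsub>?F\<^esub> y \<in> K" unfolding x y K_def using ha[of "const a" "const b"] by (metis const_closed const_add imageI rangeI)
  next
    fix x assume x: "x \<in> K - {\<zero>\<^bsub>?F\<^esub>}"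
    then obtain a where a: "x = ?h (const a)" unfolding K_def by auto
    have "a \<noteq> 0"
    proof
      assume "a = 0"
      then have "x = \<zero>\<^bsub>?F\<^esub>" unfolding a using h.hom_zero by (simp only: const_0 poly_ring_simps)
      then show False using x by blast
    qed
    have inv: "x \<otimes>\<^bsub>?F\<^esub> ?h (const (inverse a)) = \<one>\<^bsub>?F\<^esub>"
      unfolding a hm[OF const_closed const_closed, symmetric] const_inverse[OF \<open>a \<noteq> 0\<close>] by (rule h1)
    have "x \<in> carrier ?F" unfolding a by (rule hc)
    from F.comm_inv_char[OF this hc inv]
    have "inv\<^bsub>?F\<^esub> x = ?h (const (inverse a))" .
    then show "inv\<^bsub>?F\<^esub> x \<in> K" unfolding K_def by auto
  qed
  let ?xs = "map (\<lambda>i. ?h (indet i)) [0..<n]"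
  have xs: "set ?xs \<subseteq> carrier ?F" by auto
  have sub: "subring (F.finite_extension K ?xs) ?F"
    by (rule F.finite_extension_is_subring[OF subfieldE(1)[OF K] xs])
  have "F.finite_extension K ?xs = carrier ?F"
  proof
    show "F.finite_extension K ?xs \<subseteq> carrier ?F" using subringE(1)[OF sub] .
    have "?h p \<in> F.finite_extension K ?xs" if "p \<in> carrier ?D" for p
      using that
    proof (induct p rule: poly_ring_induct)
      case (const c)
      then show ?case using F.finite_extension_incl[OF subfieldE(3)[OF K] xs] unfolding K_def by auto
    next
      case (var j)
      then show ?case using F.finite_extension_mem[OF subfieldE(1)[OF K] xs] by auto
    qed (use ha hm subringE(6,7)[OF sub] in auto)
    then show "carrier ?F \<subseteq> F.finite_extension K ?xs" unfolding F by auto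
  qed
  then have fin: "F.finite_dimension K (carrier ?F)" by (rule F.zariski_lemma[OF K xs])
  have xi: "?h (indet i) \<in> carrier ?F" using i by auto
  have "(F.algebraic over K) (?h (indet i))"
    using F.finite_dimension_imp_algebraic[OF K F.carrier_is_subring fin xi] .
  then obtain q where q: "q \<in> carrier (K[X]\<^bsub>?F\<^esub>)" "q \<noteq> []" "F.eval q (?h (indet i)) = \<zero>\<^bsub>?F\<^esub>"
    using F.algebraicE[OF subfieldE(1)[OF K] xi] by blast
  have pol: "polynomial\<^bsub>?F\<^esub> K q" using q by (simp add: univ_poly_carrier)
  have hpow: "?h (indet i ^ e) = ?h (indet i) [^]\<^bsub>?F\<^esub> e" for e :: nat
    by (induct e) (use i in \<open>simp_all add: power_Suc2 h1 hm del: power_Suc\<close>)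
  \<comment> \<open>The leading coefficient, which is the head of the list, is tracked so that the
    lifted polynomial is seen to be nonzero. The vanishing of the coefficients from
    \<open>length q\<close> on ensures that adding a new leading monomial disturbs none of the
    others.\<close>
  have lift: "\<exists>g. F.eval q (?h (indet i)) = ?h (poly_in_var i g) \<and> (\<forall>j\<ge>length q. Polynomial.coeff g j = 0) \<and>
      (q \<noteq> [] \<longrightarrow> hd q = ?h (const (Polynomial.coeff g (length q - 1))))" if "set q \<subseteq> K" for q
    using that
  proof (induct q)
    case Nil
    show ?case by (rule exI[of _ 0]) (use h.hom_zero in simp)
  next
    case (Cons a q)
    then obtain g where g: "F.eval q (?h (indet i)) = ?h (poly_in_var i g)" "\<forall>j\<ge>length q. Polynomial.coeff g j = 0" by auto
    from Cons obtain c where c: "a = ?h (const c)" unfolding K_def by auto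
    show ?case
      by (rule exI[of _ "Polynomial.monom c (length q) + g"])
        (use g c i in \<open>auto simp: poly_in_var_add poly_in_var_monom ha hm hpow coeff_monom\<close>)
  qed
  have "set q \<subseteq> K" using pol F.polynomial_incl by blast
  from lift[OF this] obtain g where g: "F.eval q (?h (indet i)) = ?h (poly_in_var i g)"
    "hd q = ?h (const (Polynomial.coeff g (length q - 1)))" using q(2) by auto
  have "hd q \<noteq> \<zero>\<^bsub>?F\<^esub>" using pol q(2) unfolding polynomial_def by auto
  then have "g \<noteq> 0" using g(2) h.hom_zero by auto
  moreover have "poly_in_var i g \<in> P" using g(1) q(3) h0[of "poly_in_var i g"] i by (metis poly_in_var_closed)
  ultimately show ?thesis using that by blast
qed

lemma algebraic_if_krull_dim_0:
  assumes I: "ideal I (poly_ring n)" and dim: "krull_dim (poly_ring n Quot I) = 0" and i: "i < n"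
  obtains g where "g \<noteq> 0" "poly_in_var i (g :: 'k::field poly) \<in> I"
proof -
  let ?D = "poly_ring n :: ('k mpoly) ring"
  interpret D: cring ?D by (rule cring_poly_ring)
  have "\<exists>g::'k poly. g \<noteq> 0 \<and> poly_in_var i g \<in> I"
  proof (rule ccontr)
    assume *: "\<not> ?thesis"
    let ?S = "poly_in_var i ` (UNIV - {0::'k poly})"
    obtain P where P: "primeideal P ?D" "I \<subseteq> P" "P \<inter> ?S = {}"
    proof (rule D.primeideal_avoiding[OF I, of ?S])
      show "?S \<subseteq> carrier ?D" using i by auto
      show "\<one>\<^bsub>?D\<^esub> \<in> ?S" using poly_in_var_1[of i, symmetric] by (auto intro!: image_eqI[of _ _ 1])
      \<comment> \<open>A product of nonzero univariate polynomials is nonzero, so nothing is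
        required about injectivity of the substitution \<open>g\<close> to
        \<open>g(d_i)\<close>.\<close>
      show "x \<otimes>\<^bsub>?D\<^esub> y \<in> ?S" if "x \<in> ?S" "y \<in> ?S" for x y
        using that by (auto simp: poly_in_var_mult[symmetric])
      show "I \<inter> ?S = {}" using * by auto
    qed
    have "maximalideal P ?D" by (rule D.maximalideal_if_krull_dim_0[OF I P(1,2) dim])
    then obtain g :: "'k poly" where "g \<noteq> 0" "poly_in_var i g \<in> P" using residue_field_algebraic i by blast
    then show False using P(3) by auto
  qed
  then show ?thesis using that by blast
qed

section \<open>Modules over the polynomial ring as vector spaces over the constants\<close>

text \<open>The field \<open>k\<close> as a subring of \<open>D\<close>. With scalars of the same
  type as polynomials, the record \<open>M\<close> itself is a vector space under its own scalar
  multiplication.\<close>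

definition constants :: "'k::field mpoly ring" where
  "constants = \<lparr>carrier = range const, mult = (*), one = 1, zero = 0, add = (+)\<rparr>"

lemma constants_simps [simp]:
  "carrier constants = range const" "p \<otimes>\<^bsub>constants\<^esub> q = p * q" "\<one>\<^bsub>constants\<^esub> = 1"
  "p \<oplus>\<^bsub>constants\<^esub> q = p + q" "\<zero>\<^bsub>constants\<^esub> = 0"
  by (simp_all add: constants_def)

lemma cring_constants: "cring (constants :: 'k::field mpoly ring)"
proof (rule cringI)
  show "abelian_group (constants :: 'k mpoly ring)"
  proof (rule abelian_groupI)
    fix x :: "'k mpoly" assume "x \<in> carrier constants"
    then obtain a where "x = const a" by auto
    then show "\<exists>y\<in>carrier constants. y \<oplus>\<^bsub>constants\<^esub> x = \<zero>\<^bsub>constants\<^esub>"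
      by (intro bexI[of _ "const (- a)"]) (simp_all add: const_add[symmetric])
  qed (auto simp: const_add[symmetric] add_ac image_iff intro: exI[of _ 0])
  show "Group.comm_monoid (constants :: 'k mpoly ring)"
    by (rule comm_monoidI) (auto simp: const_mult[symmetric] mult_ac image_iff intro: exI[of _ 1])
qed (auto simp: algebra_simps)

lemma field_constants: "field (constants :: 'k::field mpoly ring)"
proof -
  interpret cring "constants :: 'k mpoly ring" by (rule cring_constants)
  show ?thesis
  proof (rule cring_fieldI)
    show "Units constants = carrier (constants :: 'k mpoly ring) - {\<zero>\<^bsub>constants\<^esub>}"
    proof
      show "Units constants \<subseteq> carrier constants - {\<zero>\<^bsub>constants\<^esub>}" unfolding Units_def by auto
      have unit: "const a \<in> Units constants" if "a \<noteq> (0::'k)" for a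
        using const_inverse[OF that] unfolding Units_def
        by (auto intro!: exI[of _ "inverse a"] simp: mult.commute)
      show "carrier (constants :: 'k mpoly ring) - {\<zero>\<^bsub>constants\<^esub>} \<subseteq> Units constants"
        by (auto intro!: unit)
    qed
  qed
qed

text \<open>The size of independent sets is bounded by the dimension, so one that is maximal within
  \<open>W\<close> exists; any vector of \<open>W\<close> outside its span could be added.\<close>

lemma (in vectorspace) subspace_finite_basis:
  assumes W: "submodule K W V" and fin: "fin_dim"
  obtains b where "finite b" "b \<subseteq> W" "lin_indpt b" "span b = W"
proof -
  interpret W: submodule K W V by (rule W)
  let ?P = "\<lambda>b. b \<subseteq> W \<and> lin_indpt b"
  have "lin_indpt {}" unfolding lin_dep_def by auto
  then obtain b where b: "finite b" "maximal b ?P"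
    using maximal_exists[of ?P dim "{}"] li_le_dim[OF fin] W.subset by blast
  have bW: "b \<subseteq> W" "lin_indpt b" using b unfolding maximal_def by auto
  have "w \<in> span b" if w: "w \<in> W" for w
  proof (rule ccontr)
    assume "w \<notin> span b"
    moreover have bV: "b \<subseteq> carrier V" using bW W.subset by auto
    ultimately have "w \<notin> b" "lin_indpt (b \<union> {w})"
      using lin_dep_iff_in_span[OF bV bW(2)] in_own_span[OF bV] w W.subset by blast+
    then show False using b(2) bW w unfolding maximal_def by blast
  qed
  then have "span b = W" using span_is_subset[OF bW(1) W] by auto
  then show ?thesis using that b bW by blast
qed

text \<open>A vector of \<open>span c\<close> outside \<open>W\<close> would extend \<open>b\<close>
  to an independent set in \<open>span c\<close> with more elements than \<open>c\<close>, against
  Steinitz exchange.\<close>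

lemma (in vectorspace) subspace_eq_if_card_le:
  assumes W: "submodule K W V" and "W \<subseteq> span c" "finite c" "c \<subseteq> carrier V"
    and b: "finite b" "lin_indpt b" "span b = W" "b \<subseteq> W" "card c \<le> card b"
  shows "span c = W"
proof -
  interpret W: submodule K W V by (rule W)
  have bV: "b \<subseteq> carrier V" using b W.subset by auto
  have "w \<in> W" if w: "w \<in> span c" for w
  proof (rule ccontr)
    assume nW: "w \<notin> W"
    have wV: "w \<in> carrier V" using w span_closed assms by blast
    have "w \<notin> b" "lin_indpt (b \<union> {w})"
      using nW lin_dep_iff_in_span[OF bV b(2) wV] b by blast+
    then have "card (b \<union> {w}) \<le> card c"
      using replacement[of "b \<union> {w}" c] b assms w by fastforce
    then show False using b \<open>w \<notin> b\<close> by simp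
  qed
  then show ?thesis using assms by auto
qed

locale mpoly_module = Module.module "poly_ring n" M
  for n :: nat and M :: "('k::field mpoly, 'm, 'd) module_scheme" (structure)
begin

abbreviation act (infixr "\<cdot>" 75) where "p \<cdot> x \<equiv> p \<odot> x"
abbreviation "D \<equiv> poly_ring n :: 'k mpoly ring"

lemma act_add: "p \<in> carrier D \<Longrightarrow> q \<in> carrier D \<Longrightarrow> x \<in> carrier M \<Longrightarrow> (p + q) \<cdot> x = p \<cdot> x \<oplus> q \<cdot> x"
  using smult_l_distr by simp

lemma act_mult: "p \<in> carrier D \<Longrightarrow> q \<in> carrier D \<Longrightarrow> x \<in> carrier M \<Longrightarrow> (p * q) \<cdot> x = p \<cdot> q \<cdot> x"
  using smult_assoc1 by simp

lemma act_commute: "p \<in> carrier D \<Longrightarrow> q \<in> carrier D \<Longrightarrow> x \<in> carrier M \<Longrightarrow> p \<cdot> q \<cdot> x = q \<cdot> p \<cdot> x"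
  by (simp add: act_mult[symmetric] mult.commute)

lemma act_1 [simp]: "x \<in> carrier M \<Longrightarrow> 1 \<cdot> x = x"
  using smult_one by simp

lemma act_0 [simp]: "x \<in> carrier M \<Longrightarrow> 0 \<cdot> x = \<zero>"
  using smult_l_null by simp

lemma act_uminus: "p \<in> carrier D \<Longrightarrow> x \<in> carrier M \<Longrightarrow> (- p) \<cdot> x = \<ominus> (p \<cdot> x)"
  using smult_l_minus by simp

lemma act_minus: "p \<in> carrier D \<Longrightarrow> q \<in> carrier D \<Longrightarrow> x \<in> carrier M \<Longrightarrow> (p - q) \<cdot> x = p \<cdot> x \<ominus> q \<cdot> x"
  using act_add[of p "- q" x] by (simp add: act_uminus a_minus_def)

lemma module_constants: "Module.module constants M"
  using cring_constants
  by (rule moduleI) (auto simp: act_add act_mult smult_r_distr is_abelian_group M.abelian_group_axioms)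

end

text \<open>From here on, names with prefix \<open>k\<close> refer to \<open>M\<close> as a vector
  space over the constants, while the bare \<open>span\<close> is the \<open>D\<close>-span.\<close>

sublocale mpoly_module \<subseteq> k: vectorspace constants M
  by (intro vectorspace.intro module_constants field_constants)

section \<open>Finite dimension over the constants\<close>

context mpoly_module
begin

text \<open>The preimage of a subspace under multiplication by \<open>p\<close> is a subspace,
  because \<open>p\<close> commutes with the constants.\<close>

lemma act_mem_if_act_generators_mem:
  assumes T: "T \<subseteq> carrier M" and W: "submodule constants W M" and p: "p \<in> carrier D"
    and pT: "\<And>t. t \<in> T \<Longrightarrow> p \<cdot> t \<in> W" and y: "y \<in> k.span T"
  shows "p \<cdot> y \<in> W"
proof -
  interpret W: submodule constants W M by (rule W)
  have "submodule constants {y \<in> carrier M. p \<cdot> y \<in> W} M"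
    unfolding submodule_def
  proof (intro conjI allI impI)
    show "Module.module constants M" by (rule module_constants)
    fix c :: "'k mpoly" and v assume c: "c \<in> carrier constants" and v: "v \<in> {y \<in> carrier M. p \<cdot> y \<in> W}"
    from c obtain a where a: "c = const a" by auto
    have "p \<cdot> c \<cdot> v = c \<cdot> p \<cdot> v" using v p by (simp add: a act_commute)
    then show "c \<cdot> v \<in> {y \<in> carrier M. p \<cdot> y \<in> W}" using v c W.smult_closed by auto
  qed (use p in \<open>auto simp: smult_r_distr\<close>)
  then show ?thesis using k.span_is_subset[of T "{y \<in> carrier M. p \<cdot> y \<in> W}"] T pT y by auto
qed

lemma poly_in_var_act_mem:
  assumes W: "submodule constants W M" and i: "i < n" and x: "x \<in> carrier M"
    and pow: "\<And>a. a < N \<Longrightarrow> indet i ^ a \<cdot> x \<in> W" and g: "\<And>j. j \<ge> N \<Longrightarrow> Polynomial.coeff g j = 0"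
  shows "poly_in_var i g \<cdot> x \<in> W"
  using pow g
proof (induct N arbitrary: g)
  case 0
  interpret W: submodule constants W M by (rule W)
  have "g = 0" using 0 by (simp add: poly_eq_iff)
  then show ?case using x by simp
next
  case (Suc N)
  interpret W: submodule constants W M by (rule W)
  let ?c = "Polynomial.coeff g N"
  let ?h = "g - Polynomial.monom ?c N"
  have h: "poly_in_var i ?h \<cdot> x \<in> W"
    by (rule Suc(1)) (use Suc(2,3) in \<open>auto simp: le_Suc_eq\<close>)
  have "g = ?h + Polynomial.monom ?c N" by simp
  then have "poly_in_var i g = poly_in_var i ?h + const ?c * indet i ^ N"
    by (metis poly_in_var_add poly_in_var_monom)
  then have "poly_in_var i g \<cdot> x = poly_in_var i ?h \<cdot> x \<oplus> const ?c \<cdot> indet i ^ N \<cdot> x"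
    using i x by (simp add: act_add act_mult)
  then show ?case using h Suc(2)[of N] by simp
qed

text \<open>To each \<open>x\<close> in \<open>S\<close> the powers of \<open>d_i\<close> applied to
  \<open>x\<close> are adjoined, up to the degree of a polynomial in \<open>d_i\<close> that kills
  \<open>x\<close>. The last clause lets the variables be treated one after the other: by
  commutativity, stability already achieved for other polynomials survives.\<close>

lemma finite_stable_extension:
  assumes S: "finite S" "S \<subseteq> carrier M" and i: "i < n"
    and alg: "\<And>x. x \<in> carrier M \<Longrightarrow> \<exists>g. g \<noteq> 0 \<and> poly_in_var i g \<cdot> x = \<zero>"
  obtains T where "finite T" "S \<subseteq> T" "T \<subseteq> carrier M" "\<And>y. y \<in> k.span T \<Longrightarrow> indet i \<cdot> y \<in> k.span T"
    "\<And>p y. p \<in> carrier D \<Longrightarrow> (\<And>z. z \<in> k.span S \<Longrightarrow> p \<cdot> z \<in> k.span S) \<Longrightarrow> y \<in> k.span T \<Longrightarrow> p \<cdot> y \<in> k.span T"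
proof -
  have d: "indet i \<in> carrier D" using i by simp
  \<comment> \<open>Multiplying by the variable makes the degree positive, so that power 0, and with
    it \<open>x\<close> itself, occurs among the adjoined elements.\<close>
  have "\<exists>g. g \<noteq> 0 \<and> Polynomial.degree g \<ge> 1 \<and> poly_in_var i g \<cdot> x = \<zero>" if x: "x \<in> carrier M" for x
  proof -
    obtain g where g: "g \<noteq> 0" "poly_in_var i g \<cdot> x = \<zero>" using alg[OF x] by blast
    then have "poly_in_var i (pCons 0 g) \<cdot> x = \<zero>" using i x by (simp add: act_mult)
    then show ?thesis using g by (intro exI[of _ "pCons 0 g"]) simp
  qed
  then obtain g where g: "\<And>x. x \<in> carrier M \<Longrightarrow> g x \<noteq> 0 \<and> Polynomial.degree (g x) \<ge> 1 \<and> poly_in_var i (g x) \<cdot> x = \<zero>"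
    by metis
  define T where "T = (\<Union>x\<in>S. (\<lambda>a. indet i ^ a \<cdot> x) ` {..<Polynomial.degree (g x)})"
  have T: "T \<subseteq> carrier M" unfolding T_def using S i by auto
  have ST: "S \<subseteq> T"
  proof
    fix x assume x: "x \<in> S"
    then have xM: "x \<in> carrier M" using S by auto
    have "indet i ^ 0 \<cdot> x \<in> (\<lambda>a. indet i ^ a \<cdot> x) ` {..<Polynomial.degree (g x)}"
      using g[OF xM] by (intro imageI) simp
    then show "x \<in> T" unfolding T_def using x xM by auto
  qed
  have spT: "submodule constants (k.span T) M" by (rule k.span_is_submodule[OF T])
  have Tsp: "T \<subseteq> k.span T" by (rule k.in_own_span[OF T])
  have stable: "indet i \<cdot> y \<in> k.span T" if y: "y \<in> k.span T" for y
  proof (rule act_mem_if_act_generators_mem[OF T spT d _ y])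
    fix t assume "t \<in> T"
    then obtain x a where x: "x \<in> S" "a < Polynomial.degree (g x)" "t = indet i ^ a \<cdot> x" unfolding T_def by auto
    have xM: "x \<in> carrier M" using x S by auto
    have t: "indet i \<cdot> t = indet i ^ Suc a \<cdot> x" using x xM i by (simp add: act_mult)
    show "indet i \<cdot> t \<in> k.span T"
    proof (cases "Suc a < Polynomial.degree (g x)")
      case True
      then have "indet i ^ Suc a \<cdot> x \<in> T" unfolding T_def using x(1) by blast
      then show ?thesis using Tsp t by auto
    next
      case False
      let ?N = "Polynomial.degree (g x)" and ?l = "Polynomial.coeff (g x) (Polynomial.degree (g x))"
      have N: "Suc a = ?N" using False x by simp
      have l: "?l \<noteq> 0" using g[OF xM] by simp
      \<comment> \<open>The leading terms cancel, so this polynomial has degree below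
        \<open>?N\<close>; since \<open>g x\<close> kills \<open>x\<close>, it acts on
        \<open>x\<close> exactly like the power \<open>?N\<close> of the variable.\<close>
      let ?h = "Polynomial.monom 1 ?N - Polynomial.smult (inverse ?l) (g x)"
      have hmem: "poly_in_var i ?h \<cdot> x \<in> k.span T"
      proof (rule poly_in_var_act_mem[OF spT i xM])
        show "indet i ^ a \<cdot> x \<in> k.span T" if "a < ?N" for a
          using that x(1) Tsp unfolding T_def by blast
        show "Polynomial.coeff ?h j = 0" if "j \<ge> ?N" for j
          using that l by (cases "j = ?N") (auto simp: coeff_eq_0)
      qed
      have "Polynomial.monom 1 ?N = ?h + Polynomial.smult (inverse ?l) (g x)" by simp
      then have "indet i ^ ?N = poly_in_var i ?h + const (inverse ?l) * poly_in_var i (g x)"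
        by (metis poly_in_var_add poly_in_var_monom poly_in_var_smult const_1 mult_1)
      then have "indet i ^ ?N \<cdot> x = poly_in_var i ?h \<cdot> x"
        using i xM g[OF xM] by (simp add: act_add act_mult)
      then show ?thesis using hmem t N by simp
    qed
  qed
  have stable_pow: "indet i ^ a \<cdot> y \<in> k.span T" if "y \<in> k.span T" for a y
  proof (induct a)
    case 0
    then show ?case using that k.span_is_subset2[OF T] by auto
  next
    case (Suc a)
    have "y \<in> carrier M" using that k.span_is_subset2[OF T] by auto
    then show ?case using stable[OF Suc] i by (simp add: act_mult)
  qed
  show ?thesis
  proof (rule that[OF _ ST T stable])
    show "finite T" unfolding T_def using S by auto
    fix p y assume p: "p \<in> carrier D" and st: "\<And>z. z \<in> k.span S \<Longrightarrow> p \<cdot> z \<in> k.span S" and y: "y \<in> k.span T"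
    show "p \<cdot> y \<in> k.span T"
    proof (rule act_mem_if_act_generators_mem[OF T spT p _ y])
      fix t assume "t \<in> T"
      then obtain x a where x: "x \<in> S" "t = indet i ^ a \<cdot> x" unfolding T_def by auto
      have xM: "x \<in> carrier M" using x S by auto
      have "p \<cdot> x \<in> k.span T"
        using st[of x] x k.in_own_span[OF S(2)] k.span_is_monotone[OF ST] by auto
      then have "indet i ^ a \<cdot> p \<cdot> x \<in> k.span T" by (rule stable_pow)
      then show "p \<cdot> t \<in> k.span T" using x xM p i by (simp add: act_commute)
    qed
  qed
qed

text \<open>A finite generating set is enlarged until its \<open>k\<close>-span is stable under
  every variable. That span is then a \<open>D\<close>-submodule containing the generators, hence
  all of \<open>M\<close>.\<close>

lemma fin_dim_if_algebraic:
  assumes fg: "finitely_generated D M"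
    and alg: "\<And>i x. i < n \<Longrightarrow> x \<in> carrier M \<Longrightarrow> \<exists>g. g \<noteq> 0 \<and> poly_in_var i g \<cdot> x = \<zero>"
  shows "k.fin_dim"
proof -
  obtain S where S: "finite S" "S \<subseteq> carrier M" "span S = carrier M"
    using fg unfolding finitely_generated_def by auto
  \<comment> \<open>Here \<open>l\<close> counts the variables whose stability has already been
    secured.\<close>
  have "\<exists>T. finite T \<and> S \<subseteq> T \<and> T \<subseteq> carrier M \<and> (\<forall>i<l. \<forall>y\<in>k.span T. indet i \<cdot> y \<in> k.span T)" if "l \<le> n" for l
    using that
  proof (induct l)
    case 0
    then show ?case using S by auto
  next
    case (Suc l)
    then obtain T where T: "finite T" "S \<subseteq> T" "T \<subseteq> carrier M" "\<forall>i<l. \<forall>y\<in>k.span T. indet i \<cdot> y \<in> k.span T"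
      by auto
    have l: "l < n" using Suc by simp
    obtain U where U: "finite U" "T \<subseteq> U" "U \<subseteq> carrier M" "\<And>y. y \<in> k.span U \<Longrightarrow> indet l \<cdot> y \<in> k.span U"
      "\<And>p y. p \<in> carrier D \<Longrightarrow> (\<And>z. z \<in> k.span T \<Longrightarrow> p \<cdot> z \<in> k.span T) \<Longrightarrow> y \<in> k.span U \<Longrightarrow> p \<cdot> y \<in> k.span U"
      using finite_stable_extension[OF T(1,3) l alg[OF l]] by metis
    have "indet i \<cdot> y \<in> k.span U" if "i < Suc l" "y \<in> k.span U" for i y
    proof (cases "i = l")
      case False
      show ?thesis by (rule U(5)) (use that T False l in auto)
    qed (use U that in auto)
    then show ?case using U T by (intro exI[of _ U]) auto
  qed
  from this[OF order_refl] obtain T where T: "finite T" "S \<subseteq> T" "T \<subseteq> carrier M"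
    "\<And>i y. i < n \<Longrightarrow> y \<in> k.span T \<Longrightarrow> indet i \<cdot> y \<in> k.span T" by blast
  interpret T: submodule constants "k.span T" M by (rule k.span_is_submodule[OF T(3)])
  have stable: "\<forall>y\<in>k.span T. p \<cdot> y \<in> k.span T" if "p \<in> carrier D" for p
    using that
  proof (induct p rule: poly_ring_induct)
    case (mult p q)
    have "(p * q) \<cdot> y = p \<cdot> q \<cdot> y" if "y \<in> k.span T" for y
      using mult that T.subset by (intro act_mult) auto
    then show ?case using mult by auto
  next
    case (add p q)
    have "(p + q) \<cdot> y = p \<cdot> y \<oplus> q \<cdot> y" if "y \<in> k.span T" for y
      using add that T.subset by (intro act_add) auto
    then show ?case using add by auto
  qed (use T in auto)
  have "submodule D (k.span T) M"
    unfolding submodule_def using T.subset stable by (auto simp: module_axioms)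
  then have "span S \<subseteq> k.span T"
    using T(2) k.in_own_span[OF T(3)] by (intro span_is_subset) auto
  then have "k.span T = carrier M" using S T.subset by auto
  then show ?thesis unfolding k.fin_dim_def using T by auto
qed

lemma ideal_annihilator:
  assumes x: "x \<in> carrier M"
  shows "ideal (annihilator D M {x}) D"
proof (rule idealI)
  show "ring D" by (rule cring.axioms(1)[OF cring_poly_ring])
  show "subgroup (annihilator D M {x}) (add_monoid D)"
    by (rule R.add.subgroupI) (use x in \<open>auto simp: annihilator_def act_add act_uminus\<close>)
next
  fix a y assume a: "a \<in> annihilator D M {x}" and y: "y \<in> carrier D"
  then have "(y * a) \<cdot> x = \<zero>" "a \<in> carrier D"
    using x by (auto simp: annihilator_def act_mult)
  then show "y \<otimes>\<^bsub>D\<^esub> a \<in> annihilator D M {x}" "a \<otimes>\<^bsub>D\<^esub> y \<in> annihilator D M {x}"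
    using y by (simp_all add: annihilator_def mult.commute)
qed

lemma annihilator_cyclic:
  assumes x: "x \<in> carrier M"
  shows "annihilator D M (cyclic_submodule D M x) = annihilator D M {x}"
proof -
  have "p \<cdot> q \<cdot> x = \<zero>" if "p \<in> carrier D" "q \<in> carrier D" "p \<cdot> x = \<zero>" for p q
    using that x act_commute[of p q x] by simp
  moreover have "x \<in> cyclic_submodule D M x"
    unfolding cyclic_submodule_def using x by (auto intro!: exI[of _ 1])
  ultimately show ?thesis unfolding annihilator_def cyclic_submodule_def by auto
qed

lemma fin_dim_if_n_pure:
  assumes fg: "finitely_generated D M" and pure: "n_pure n M"
  shows "k.fin_dim"
proof (rule fin_dim_if_algebraic[OF fg])
  fix i x assume i: "i < n" and x: "x \<in> carrier M"
  show "\<exists>g. g \<noteq> 0 \<and> poly_in_var i g \<cdot> x = \<zero>"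
  proof (cases "x = \<zero>")
    case True
    then show ?thesis using i by (intro exI[of _ 1]) simp
  next
    case False
    let ?d = "krull_dim (D Quot annihilator D M {x})"
    have "enat n - ?d = enat n"
      using pure x False unfolding n_pure_def cd_def by (auto simp: annihilator_cyclic)
    \<comment> \<open>Truncated subtraction gives this only for positive \<open>n\<close>, which
      \<open>i < n\<close> guarantees; with \<open>n = 0\<close> there is no variable and nothing to
      prove.\<close>
    then have "?d = 0" using i by (cases ?d) (auto simp: zero_enat_def)
    then obtain g where "g \<noteq> 0" "poly_in_var i (g :: 'k poly) \<in> annihilator D M {x}"
      using algebraic_if_krull_dim_0[OF ideal_annihilator[OF x] _ i] by blast
    then show ?thesis unfolding annihilator_def by auto
  qed
qed

end

section \<open>Linear forms\<close>

text \<open>Double orthogonality in coordinates: a vector satisfying every linear relation that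
  holds on \<open>B\<close> is the restriction of a member of \<open>B\<close>. The proof is
  Gaussian elimination. Members of \<open>B\<close> are functions on the whole index type, so that a
  coordinate is discarded by shrinking \<open>I\<close> while \<open>B\<close> keeps its
  type.\<close>

lemma mem_restriction_if_orthogonal:
  fixes B :: "('i \<Rightarrow> 'k::field) set"
  assumes "finite I" "B \<noteq> {}"
    and "\<And>u v. u \<in> B \<Longrightarrow> v \<in> B \<Longrightarrow> (\<lambda>i. u i + v i) \<in> B"
    and "\<And>u c. u \<in> B \<Longrightarrow> (\<lambda>i. c * u i) \<in> B"
    and "\<And>c. (\<And>u. u \<in> B \<Longrightarrow> (\<Sum>i\<in>I. c i * u i) = 0) \<Longrightarrow> (\<Sum>i\<in>I. c i * f i) = 0"
  shows "\<exists>u\<in>B. \<forall>i\<in>I. u i = f i"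
  using assms
proof (induct I arbitrary: B f)
  case empty
  then show ?case by auto
next
  case (insert a I)
  note ne = insert(4) and add = insert(5) and scale = insert(6) and orth = insert(7)
  show ?case
  proof (cases "\<forall>u\<in>B. u a = 0")
    case True
    have at_a: "(\<Sum>i\<in>insert a I. (if i = a then 1 else 0) * g i) = g a" for g :: "'i \<Rightarrow> 'k"
      using insert(1,2) by (subst sum.insert) (auto intro!: sum.neutral)
    \<comment> \<open>The relation that picks out coordinate \<open>a\<close> holds on
      \<open>B\<close>, hence also for \<open>f\<close>.\<close>
    have fa: "f a = 0"
      using orth[of "\<lambda>i. if i = a then 1 else 0"] True unfolding at_a by blast
    have "\<exists>u\<in>B. \<forall>i\<in>I. u i = f i"
    proof (rule insert(3)[OF ne add scale])
      fix c assume c: "\<And>u. u \<in> B \<Longrightarrow> (\<Sum>i\<in>I. c i * u i) = 0"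
      have "(\<Sum>i\<in>insert a I. c i * f i) = 0"
        by (rule orth) (use True insert(1,2) c in auto)
      then show "(\<Sum>i\<in>I. c i * f i) = 0" using fa insert(1,2) by simp
    qed
    then show ?thesis using True fa by auto
  next
    case False
    then obtain b where b: "b \<in> B" "b a \<noteq> 0" by auto
    \<comment> \<open>The pivot vector, normalised to 1 at \<open>a\<close>. It reduces the problem
      to the members of \<open>B\<close> that vanish at \<open>a\<close> and to the target
      \<open>f - f(a) e\<close>.\<close>
    define e where "e = (\<lambda>i. inverse (b a) * b i)"
    have e: "e \<in> B" "e a = 1" unfolding e_def using scale[OF b(1)] b(2) by auto
    have "\<exists>u\<in>{u\<in>B. u a = 0}. \<forall>i\<in>I. u i = f i - f a * e i"
    proof (rule insert(3))
      have "(\<lambda>i. 0 * e i) \<in> B" by (rule scale[OF e(1)])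
      then show "{u\<in>B. u a = 0} \<noteq> {}" by auto
    next
      fix c assume c: "\<And>u. u \<in> {u\<in>B. u a = 0} \<Longrightarrow> (\<Sum>i\<in>I. c i * u i) = 0"
      \<comment> \<open>The coefficient at \<open>a\<close> is chosen to make the relation vanish on
        \<open>e\<close>; a relation on the hyperplane \<open>u a = 0\<close> then becomes one on
        all of \<open>B\<close>.\<close>
      let ?c = "c(a := - (\<Sum>i\<in>I. c i * e i))"
      have c': "(\<Sum>i\<in>insert a I. ?c i * u i) = (\<Sum>i\<in>I. c i * (u i - u a * e i))" for u
      proof -
        have "(\<Sum>i\<in>I. ?c i * u i) = (\<Sum>i\<in>I. c i * u i)"
          by (rule sum.cong) (use insert(2) in auto)
        then show ?thesis using insert(1,2)
          by (simp add: sum_subtractf right_diff_distrib sum_distrib_left sum_distrib_right mult_ac)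
      qed
      have "(\<Sum>i\<in>insert a I. ?c i * f i) = 0"
      proof (rule orth)
        fix u assume u: "u \<in> B"
        have "(\<lambda>i. u i + (- u a) * e i) \<in> B" by (rule add[OF u scale[OF e(1)]])
        then have "(\<Sum>i\<in>I. c i * (u i + (- u a) * e i)) = 0" using e(2) by (intro c) auto
        then show "(\<Sum>i\<in>insert a I. ?c i * u i) = 0" unfolding c' by simp
      qed
      then show "(\<Sum>i\<in>I. c i * (f i - f a * e i)) = 0" unfolding c' .
    qed (use add scale in auto)
    then obtain u where u: "u \<in> B" "u a = 0" "\<forall>i\<in>I. u i = f i - f a * e i" by auto
    have "(\<lambda>i. u i + f a * e i) \<in> B" by (rule add[OF u(1) scale[OF e(1)]])
    then show ?thesis using u e by (intro bexI[of _ "\<lambda>i. u i + f a * e i"]) auto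
  qed
qed

section \<open>Separation, orthogonality and extension of linear forms\<close>

context mpoly_module
begin

abbreviation "dual \<equiv> inverse_system M"

lemma mpoly_module_dual: "mpoly_module n dual"
  by (intro mpoly_module.intro module_inverse_system module_axioms)

lemma functional_add: "f \<in> carrier dual \<Longrightarrow> x \<in> carrier M \<Longrightarrow> y \<in> carrier M \<Longrightarrow> f (x \<oplus> y) = f x + f y"
  by (simp add: inverse_system_def)

lemma functional_const: "f \<in> carrier dual \<Longrightarrow> x \<in> carrier M \<Longrightarrow> f (const c \<cdot> x) = c * f x"
  by (simp add: inverse_system_def)

lemma functional_zero [simp]: "f \<in> carrier dual \<Longrightarrow> f \<zero> = 0"
  using functional_const[of f "\<zero>" 0] by simp

lemma dual_act_apply [simp]: "x \<in> carrier M \<Longrightarrow> (p \<odot>\<^bsub>dual\<^esub> f) x = f (p \<cdot> x)"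
  by (simp add: inverse_system_def)

lemma dual_add_apply [simp]: "x \<in> carrier M \<Longrightarrow> (f \<oplus>\<^bsub>dual\<^esub> g) x = f x + g x"
  by (simp add: inverse_system_def)

lemma dual_zero_apply [simp]: "x \<in> carrier M \<Longrightarrow> \<zero>\<^bsub>dual\<^esub> x = 0"
  by (simp add: inverse_system_def)

lemma dual_eqI:
  "f \<in> carrier dual \<Longrightarrow> g \<in> carrier dual \<Longrightarrow> (\<And>x. x \<in> carrier M \<Longrightarrow> f x = g x) \<Longrightarrow> f = g"
  by (rule extensionalityI[of _ "carrier M"]) (auto simp: inverse_system_def)

text \<open>Linearity is required only on the span of \<open>A\<close>, so that the formula also
  covers forms defined merely on a subspace, such as those to be extended from the socle.\<close>

lemma functional_lincomb:
  assumes "finite A" "A \<subseteq> carrier M"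
    and add: "\<And>x y. x \<in> k.span A \<Longrightarrow> y \<in> k.span A \<Longrightarrow> f (x \<oplus> y) = f x + f y"
    and const: "\<And>c x. x \<in> k.span A \<Longrightarrow> f (const c \<cdot> x) = c * f x"
  shows "f (k.lincomb (\<lambda>v. const (c v)) A) = (\<Sum>v\<in>A. c v * f v)"
proof -
  have "f (k.lincomb (\<lambda>v. const (c v)) B) = (\<Sum>v\<in>B. c v * f v)" if "B \<subseteq> A" for B
    using finite_subset[OF that assms(1)] that
  proof (induct B)
    case empty
    have "f (const 0 \<cdot> \<zero>) = 0 * f \<zero>" by (rule const[OF k.span_zero])
    then show ?case by simp
  next
    case (insert v B)
    have B: "B \<subseteq> carrier M" "v \<in> carrier M" using insert assms by auto
    interpret S: submodule constants "k.span A" M by (rule k.span_is_submodule[OF assms(2)])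
    have v: "v \<in> k.span A" using k.in_own_span[OF assms(2)] insert by auto
    have "k.lincomb (\<lambda>v. const (c v)) (insert v B) = const (c v) \<cdot> v \<oplus> k.lincomb (\<lambda>v. const (c v)) B"
      using insert(1,2) B by (intro k.lincomb_insert2) auto
    moreover have "const (c v) \<cdot> v \<in> k.span A" using v by simp
    moreover have "k.lincomb (\<lambda>v. const (c v)) B \<in> k.span A"
      using insert unfolding k.span_def by (auto intro!: exI[of _ B])
    ultimately show ?case using insert v by (simp add: add const)
  qed
  then show ?thesis by auto
qed

lemma span_eq_lincombs:
  assumes "finite A" "A \<subseteq> carrier M" "x \<in> k.span A"
  obtains c where "x = k.lincomb (\<lambda>v. const (c v)) A"
proof -
  obtain a where a: "a \<in> A \<rightarrow> carrier constants" "k.lincomb a A = x"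
    using k.finite_in_span[OF assms] by auto
  then have "\<forall>v\<in>A. \<exists>c. a v = const c" by auto
  then obtain c where c: "\<forall>v\<in>A. a v = const (c v)" by metis
  then have "k.lincomb (\<lambda>v. const (c v)) A = x"
    using a k.lincomb_cong[OF refl assms(2), of "\<lambda>v. const (c v)" a] by simp
  then show ?thesis using that by blast
qed

text \<open>Some coordinate of \<open>x\<close> with respect to a finite \<open>k\<close>-basis is
  nonzero, and the corresponding coordinate function is the required form.\<close>

lemma functional_separates:
  assumes fin: "k.fin_dim" and x: "x \<in> carrier M" "x \<noteq> \<zero>"
  obtains f where "f \<in> carrier dual" "f x \<noteq> 0"
proof -
  obtain b where b: "finite b" "k.basis b" using k.finite_basis_exists[OF fin] by auto
  have bM: "b \<subseteq> carrier M" using b(2) unfolding k.basis_def by auto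
  have crit: "\<exists>!a. a \<in> b \<rightarrow>\<^sub>E carrier constants \<and> k.lincomb a b = v" if "v \<in> carrier M" for v
    using k.basis_criterion[OF b(1) bM] b(2) that by auto
  define c where "c v = (THE a. a \<in> b \<rightarrow>\<^sub>E carrier constants \<and> k.lincomb a b = v)" for v
  have c: "c v \<in> b \<rightarrow>\<^sub>E carrier constants" "k.lincomb (c v) b = v" if "v \<in> carrier M" for v
    using theI'[OF crit[OF that]] unfolding c_def by auto
  have cu: "a w = c v w" if "v \<in> carrier M" "a \<in> b \<rightarrow> carrier constants" "k.lincomb a b = v" "w \<in> b" for a v w
  proof -
    have "k.lincomb (restrict a b) b = v"
      using k.lincomb_cong[OF refl bM, of "restrict a b" a] that by simp
    then have "restrict a b = c v" using crit[OF that(1)] c[OF that(1)] that(2) by auto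
    then show ?thesis using that(4) by (metis restrict_apply')
  qed
  have "\<exists>w\<in>b. c x w \<noteq> 0"
  proof (rule ccontr)
    assume "\<not> ?thesis"
    then have "k.lincomb (c x) b = \<zero>" using bM by (intro k.lincomb_zero) auto
    then show False using c x by simp
  qed
  then obtain w where w: "w \<in> b" "c x w \<noteq> 0" by auto
  have cc: "c v w = const (Poly_Mapping.lookup (c v w) 0)" if "v \<in> carrier M" for v
  proof -
    obtain a where "c v w = const a" using c(1)[OF \<open>v \<in> carrier M\<close>] w by auto
    then show ?thesis by (simp add: const_def)
  qed
  \<comment> \<open>Coordinates are constant polynomials; the coefficient at exponent 0 recovers the
    element of \<open>k\<close>.\<close>
  define f where "f = (\<lambda>v\<in>carrier M. Poly_Mapping.lookup (c v w) 0)"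
  have "f \<in> carrier dual"
    unfolding inverse_system_def
  proof (simp, intro conjI ballI allI)
    show "f \<in> extensional (carrier M)" unfolding f_def by simp
  next
    fix u v assume uv: "u \<in> carrier M" "v \<in> carrier M"
    have cf: "c u \<in> b \<rightarrow> carrier constants" "c v \<in> b \<rightarrow> carrier constants" using c(1) uv by blast+
    have "(\<lambda>w. c u w \<oplus>\<^bsub>constants\<^esub> c v w) \<in> b \<rightarrow> carrier constants"
      by (intro funcsetI k.R.add.m_closed) (use cf in blast)+
    moreover have "k.lincomb (\<lambda>w. c u w \<oplus>\<^bsub>constants\<^esub> c v w) b = u \<oplus> v"
      unfolding k.lincomb_sum[OF b(1) bM cf] c(2)[OF uv(1)] c(2)[OF uv(2)] ..
    ultimately have "c u w \<oplus>\<^bsub>constants\<^esub> c v w = c (u \<oplus> v) w"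
      using cu[of "u \<oplus> v" "\<lambda>w. c u w \<oplus>\<^bsub>constants\<^esub> c v w", OF _ _ _ w(1)] uv by blast
    then have "c u w + c v w = c (u \<oplus> v) w" by simp
    then show "f (u \<oplus> v) = f u + f v" unfolding f_def using uv by (simp add: lookup_add[symmetric])
  next
    fix a :: 'k and v assume v: "v \<in> carrier M"
    have cf: "c v \<in> b \<rightarrow> carrier constants" using c(1) v by blast
    have a: "const a \<in> carrier constants" by simp
    have "(\<lambda>w. const a \<otimes>\<^bsub>constants\<^esub> c v w) \<in> b \<rightarrow> carrier constants"
      by (intro funcsetI k.R.m_closed a) (use cf in blast)
    moreover have "k.lincomb (\<lambda>w. const a \<otimes>\<^bsub>constants\<^esub> c v w) b = const a \<cdot> v"
      unfolding k.lincomb_smult[OF bM cf a] c(2)[OF v] ..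
    ultimately have "const a \<otimes>\<^bsub>constants\<^esub> c v w = c (const a \<cdot> v) w"
      using cu[of "const a \<cdot> v" "\<lambda>w. const a \<otimes>\<^bsub>constants\<^esub> c v w", OF _ _ _ w(1)] v
        smult_closed[OF const_closed v] by blast
    then have "const a * c v w = c (const a \<cdot> v) w" by simp
    then have "const (Poly_Mapping.lookup (c (const a \<cdot> v) w) 0) = const (a * Poly_Mapping.lookup (c v w) 0)"
      using cc[OF v] cc[of "const a \<cdot> v"] v by (simp add: const_mult)
    then show "f (const a \<cdot> v) = a * f v" unfolding f_def using v by simp
  qed
  moreover have "f x \<noteq> 0" using cc[OF x(1)] w(2) x(1) unfolding f_def by auto
  ultimately show ?thesis using that by blast
qed

text \<open>Evaluation at a finite spanning set turns \<open>N\<close> into a space of coordinate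
  vectors. A relation with coefficients \<open>c\<close> on that space says that all of
  \<open>N\<close> vanishes at one vector of \<open>M\<close>, the combination with coefficients
  \<open>c\<close>, so the coordinate version applies.\<close>

lemma dual_mem_if_orthogonal:
  assumes fin: "k.fin_dim" and N: "submodule D N dual" and f: "f \<in> carrier dual"
    and orth: "\<And>x. x \<in> carrier M \<Longrightarrow> (\<And>u. u \<in> N \<Longrightarrow> u x = 0) \<Longrightarrow> f x = 0"
  shows "f \<in> N"
proof -
  interpret N: submodule D N dual by (rule N)
  obtain b where b: "finite b" "b \<subseteq> carrier M" "k.span b = carrier M"
    using fin unfolding k.fin_dim_def by auto
  have lc: "u (k.lincomb (\<lambda>v. const (c v)) b) = (\<Sum>v\<in>b. c v * u v)" if "u \<in> carrier dual" for u c
    using that b by (intro functional_lincomb) (auto simp: functional_add functional_const)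
  \<comment> \<open>Forms are unspecified outside \<open>carrier M\<close>. Replacing those values
    by 0 makes the family closed under pointwise addition and scaling.\<close>
  let ?B = "(\<lambda>u v. if v \<in> carrier M then u v else 0) ` N"
  have "\<exists>u\<in>?B. \<forall>v\<in>b. u v = f v"
  proof (rule mem_restriction_if_orthogonal[OF b(1)])
    show "?B \<noteq> {}" using N.zero_closed by blast
  next
    fix u v assume "u \<in> ?B" "v \<in> ?B"
    then obtain u' v' where uv: "u' \<in> N" "v' \<in> N" "u = (\<lambda>v. if v \<in> carrier M then u' v else 0)"
      "v = (\<lambda>x. if x \<in> carrier M then v' x else 0)" by auto
    show "(\<lambda>i. u i + v i) \<in> ?B"
      by (rule image_eqI[of _ _ "u' \<oplus>\<^bsub>dual\<^esub> v'"]) (use uv in \<open>auto simp: fun_eq_iff\<close>)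
  next
    fix u c assume "u \<in> ?B"
    then obtain u' where u: "u' \<in> N" "u = (\<lambda>v. if v \<in> carrier M then u' v else 0)" by auto
    show "(\<lambda>i. c * u i) \<in> ?B"
      by (rule image_eqI[of _ _ "const c \<odot>\<^bsub>dual\<^esub> u'"])
        (use u N.subset in \<open>auto simp: fun_eq_iff functional_const\<close>)
  next
    fix c assume c: "\<And>u. u \<in> ?B \<Longrightarrow> (\<Sum>i\<in>b. c i * u i) = 0"
    let ?x = "k.lincomb (\<lambda>v. const (c v)) b"
    have "f ?x = 0"
    proof (rule orth)
      show "?x \<in> carrier M" using b(2) by (intro k.lincomb_closed) auto
      fix u assume u: "u \<in> N"
      have "(\<Sum>i\<in>b. c i * u i) = (\<Sum>i\<in>b. c i * (if i \<in> carrier M then u i else 0))"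
        using b(2) by (intro sum.cong) auto
      also have "\<dots> = 0" using u by (intro c) auto
      finally show "u ?x = 0" using u N.subset lc by auto
    qed
    then show "(\<Sum>i\<in>b. c i * f i) = 0" using lc[OF f] by simp
  qed
  then obtain u where u: "u \<in> N" "\<forall>v\<in>b. (if v \<in> carrier M then u v else 0) = f v" by auto
  have ub: "u v = f v" if "v \<in> b" for v using that u(2) b(2) by (auto simp: subset_iff)
  have "u = f"
  proof (rule dual_eqI[OF _ f])
    show ud: "u \<in> carrier dual" using u N.subset by auto
    fix x assume "x \<in> carrier M"
    then obtain c where "x = k.lincomb (\<lambda>v. const (c v)) b" using span_eq_lincombs[OF b(1,2)] b(3) by metis
    then show "u x = f x" using lc[OF ud] lc[OF f] ub by simp
  qed
  then show ?thesis using u by simp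
qed

text \<open>A relation on the spanning vectors of \<open>W\<close> that holds for all forms on
  \<open>M\<close> yields a vector at which every form vanishes. By separation it is zero, so
  \<open>\<phi>\<close> satisfies the same relation and agrees on \<open>W\<close> with a form on
  \<open>M\<close>.\<close>

lemma functional_extension:
  assumes fin: "k.fin_dim" and W: "submodule constants W M"
    and add: "\<And>x y. x \<in> W \<Longrightarrow> y \<in> W \<Longrightarrow> \<phi> (x \<oplus> y) = \<phi> x + \<phi> y"
    and const: "\<And>c x. x \<in> W \<Longrightarrow> \<phi> (const c \<cdot> x) = c * \<phi> x"
  obtains f where "f \<in> carrier dual" "\<And>x. x \<in> W \<Longrightarrow> f x = \<phi> x"
proof -
  interpret W: submodule constants W M by (rule W)
  interpret dual: mpoly_module n dual by (rule mpoly_module_dual)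
  obtain b where b: "finite b" "b \<subseteq> W" "k.span b = W" using k.subspace_finite_basis[OF W fin] by metis
  have bM: "b \<subseteq> carrier M" using b W.subset by auto
  have lc: "u (k.lincomb (\<lambda>v. const (c v)) b) = (\<Sum>v\<in>b. c v * u v)" if "u \<in> carrier dual" for u c
    using that b W.subset by (intro functional_lincomb[OF b(1) bM]) (auto simp: functional_add functional_const subset_iff)
  have lc\<phi>: "\<phi> (k.lincomb (\<lambda>v. const (c v)) b) = (\<Sum>v\<in>b. c v * \<phi> v)" for c
    using b by (intro functional_lincomb[OF b(1) bM]) (auto simp: add const)
  let ?B = "(\<lambda>u v. if v \<in> carrier M then u v else 0) ` carrier dual"
  have "\<exists>u\<in>?B. \<forall>v\<in>b. u v = \<phi> v"
  proof (rule mem_restriction_if_orthogonal[OF b(1)])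
    show "?B \<noteq> {}" using dual.M.zero_closed by blast
  next
    fix u v assume "u \<in> ?B" "v \<in> ?B"
    then obtain u' v' where uv: "u' \<in> carrier dual" "v' \<in> carrier dual" "u = (\<lambda>v. if v \<in> carrier M then u' v else 0)"
      "v = (\<lambda>x. if x \<in> carrier M then v' x else 0)" by auto
    show "(\<lambda>i. u i + v i) \<in> ?B"
      by (rule image_eqI[of _ _ "u' \<oplus>\<^bsub>dual\<^esub> v'"]) (use uv in \<open>auto simp: fun_eq_iff\<close>)
  next
    fix u c assume "u \<in> ?B"
    then obtain u' where u: "u' \<in> carrier dual" "u = (\<lambda>v. if v \<in> carrier M then u' v else 0)" by auto
    show "(\<lambda>i. c * u i) \<in> ?B"
      by (rule image_eqI[of _ _ "const c \<odot>\<^bsub>dual\<^esub> u'"])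
        (use u in \<open>auto simp: fun_eq_iff functional_const\<close>)
  next
    fix c assume c: "\<And>u. u \<in> ?B \<Longrightarrow> (\<Sum>i\<in>b. c i * u i) = 0"
    let ?x = "k.lincomb (\<lambda>v. const (c v)) b"
    have x: "?x \<in> carrier M" using bM by (intro k.lincomb_closed) auto
    have "u ?x = 0" if u: "u \<in> carrier dual" for u
    proof -
      have "(\<Sum>i\<in>b. c i * u i) = (\<Sum>i\<in>b. c i * (if i \<in> carrier M then u i else 0))"
        using bM by (intro sum.cong) auto
      also have "\<dots> = 0" using u by (intro c) auto
      finally show "u ?x = 0" using lc[OF u] by simp
    qed
    then have "?x = \<zero>" using functional_separates[OF fin x] by blast
    moreover have "\<phi> \<zero> = 0" using const[of "\<zero>" 0] by simp
    ultimately show "(\<Sum>i\<in>b. c i * \<phi> i) = 0" using lc\<phi>[of c] by simp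
  qed
  then obtain u where u: "u \<in> carrier dual" "\<forall>v\<in>b. (if v \<in> carrier M then u v else 0) = \<phi> v" by auto
  have ub: "u v = \<phi> v" if "v \<in> b" for v using that u(2) bM by (auto simp: subset_iff)
  show ?thesis
  proof (rule that[OF u(1)])
    fix x assume "x \<in> W"
    then obtain c where "x = k.lincomb (\<lambda>v. const (c v)) b" using span_eq_lincombs[OF b(1) bM] b(3) by metis
    then show "u x = \<phi> x" using lc[OF u(1)] lc\<phi> ub by simp
  qed
qed

end

section \<open>Associated primes\<close>

text \<open>The inverse of \<open>p\<close> in the residue field, expressed through representatives:
  \<open>P\<close> together with \<open>p\<close> generates the unit ideal.\<close>

lemma maximalideal_inverse:
  assumes P: "maximalideal P (poly_ring n)" and p: "p \<in> carrier (poly_ring n)" "p \<notin> P"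
  obtains q where "q \<in> carrier (poly_ring n)" "1 - q * p \<in> P"
proof -
  let ?D = "poly_ring n :: ('a mpoly) ring"
  interpret D: cring ?D by (rule cring_poly_ring)
  interpret P: maximalideal P ?D by fact
  have Pi: "ideal P ?D" ..
  let ?J = "P <+>\<^bsub>?D\<^esub> PIdl\<^bsub>?D\<^esub> p"
  have J: "ideal ?J ?D" by (rule D.add_ideals[OF Pi D.cgenideal_ideal[OF p(1)]])
  have Jmem: "u + q * p \<in> ?J" if "u \<in> P" "q \<in> carrier ?D" for u q
    using that unfolding set_add_def' cgenideal_def by auto
  have "P \<subseteq> ?J" using Jmem[of _ 0] by auto
  moreover have "p \<in> ?J" using Jmem[of 0 1] P.zero_closed by simp
  moreover have "?J \<subseteq> carrier ?D" using ideal.Icarr[OF J] by auto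
  ultimately have "?J = carrier ?D" using P.I_maximal[OF J] p(2) by auto
  then have "1 \<in> ?J" by simp
  then obtain u q where uq: "u \<in> P" "q \<in> carrier ?D" "1 = u + q * p"
    unfolding set_add_def' cgenideal_def by auto
  have "1 - q * p = u" unfolding uq(3) by simp
  then show ?thesis using that uq by metis
qed

text \<open>Chinese remainder theorem in idempotent form. Each \<open>P\<close> in \<open>A\<close>
  contains an element outside \<open>Q\<close>; the product of these stays outside the prime
  \<open>Q\<close>, and an inverse modulo \<open>Q\<close> normalises it to 1 there.\<close>

lemma maximalideal_separating:
  assumes "finite A" "\<And>P. P \<in> A \<Longrightarrow> maximalideal P (poly_ring n)" "maximalideal Q (poly_ring n)" "Q \<notin> A"
  obtains s where "s \<in> carrier (poly_ring n)" "1 - s \<in> Q" "\<And>P. P \<in> A \<Longrightarrow> s \<in> P"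
proof -
  let ?D = "poly_ring n :: ('a mpoly) ring"
  interpret D: cring ?D by (rule cring_poly_ring)
  interpret Q: primeideal Q ?D by (rule D.maximalideal_prime) fact
  have "\<exists>s\<in>carrier ?D. s \<notin> Q \<and> (\<forall>P\<in>A. s \<in> P)"
    using assms(1,2,4)
  proof (induct A)
    case empty
    have "1 \<notin> Q" using Q.one_imp_carrier Q.I_notcarr by auto
    then show ?case by (intro bexI[of _ 1]) auto
  next
    case (insert P A)
    then obtain s where s: "s \<in> carrier ?D" "s \<notin> Q" "\<forall>P\<in>A. s \<in> P" by auto
    interpret P: maximalideal P ?D using insert by auto
    have "\<not> P \<subseteq> Q"
      using P.I_maximal[OF Q.is_ideal] Q.I_notcarr Q.a_subset insert(5) by auto
    then obtain t where t: "t \<in> P" "t \<notin> Q" by auto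
    have tc: "t \<in> carrier ?D" using t P.Icarr by auto
    have "s * t \<notin> Q" using Q.I_prime[OF s(1) tc] s t by auto
    moreover have "s * t \<in> P" using P.I_l_closed[OF t(1) s(1)] by simp
    moreover have "s * t \<in> P'" if "P' \<in> A" for P'
      using ideal.I_r_closed[OF maximalideal.axioms(1)[OF insert(4)], of P' s t] s tc that by simp
    ultimately show ?case using s tc by (intro bexI[of _ "s * t"]) auto
  qed
  then obtain s where s: "s \<in> carrier ?D" "s \<notin> Q" "\<forall>P\<in>A. s \<in> P" by auto
  obtain q where q: "q \<in> carrier ?D" "1 - q * s \<in> Q" using maximalideal_inverse[OF assms(3) s(1,2)] by auto
  have "q * s \<in> P" if "P \<in> A" for P
    using ideal.I_l_closed[OF maximalideal.axioms(1)[OF assms(2)], of P s q] q s that by simp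
  then show ?thesis using that[of "q * s"] q s by simp
qed

section \<open>Elements with maximal annihilator\<close>

context mpoly_module
begin

lemma submodule_cyclic:
  assumes x: "x \<in> carrier M"
  shows "submodule D (cyclic_submodule D M x) M"
  unfolding submodule_def
proof (intro conjI allI impI)
  show "\<zero> \<in> cyclic_submodule D M x" unfolding cyclic_submodule_def using x by (auto intro!: exI[of _ 0])
  fix c v assume c: "c \<in> carrier D" and v: "v \<in> cyclic_submodule D M x"
  then obtain p where "p \<in> carrier D" "v = p \<cdot> x" unfolding cyclic_submodule_def by auto
  then show "c \<cdot> v \<in> cyclic_submodule D M x" 
    unfolding cyclic_submodule_def using c x by (auto intro!: exI[of _ "c * p"] simp: act_mult)
next
  fix v w assume v: "v \<in> cyclic_submodule D M x" and w: "w \<in> cyclic_submodule D M x"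
  then obtain p q where "p \<in> carrier D" "v = p \<cdot> x" "q \<in> carrier D" "w = q \<cdot> x" unfolding cyclic_submodule_def by auto
  then show "v \<oplus> w \<in> cyclic_submodule D M x" 
    unfolding cyclic_submodule_def using x by (auto intro!: exI[of _ "p + q"] simp: act_add)
qed (use x in \<open>auto simp: cyclic_submodule_def module_axioms\<close>)

lemma submodule_constants_if_submodule:
  assumes "submodule D W M"
  shows "submodule constants W M"
  using assms unfolding submodule_def by (auto simp: module_constants)

lemma mem_cyclic: "x \<in> carrier M \<Longrightarrow> x \<in> cyclic_submodule D M x"
  unfolding cyclic_submodule_def by (auto intro!: exI[of _ 1])

text \<open>A nonzero element generating a cyclic submodule of least dimension has maximal annihilator.\<close>

lemma exists_maximal_annihilator:
  assumes fin: "k.fin_dim" and U: "submodule D U M" and x: "x \<in> U" "x \<noteq> \<zero>"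
  obtains y where "y \<in> U" "y \<noteq> \<zero>" "maximalideal (annihilator D M {y}) D"
proof -
  interpret U: submodule D U M by (rule U)
  let ?Q = "\<lambda>m y b. y \<in> U \<and> y \<noteq> \<zero> \<and> finite b \<and> b \<subseteq> cyclic_submodule D M y \<and> k.lin_indpt b \<and>
    k.span b = cyclic_submodule D M y \<and> card b = m"
  have basis: "\<exists>b. finite b \<and> b \<subseteq> cyclic_submodule D M y \<and> k.lin_indpt b \<and> k.span b = cyclic_submodule D M y"
    if "y \<in> U" for y
  proof -
    have "y \<in> carrier M" using that U.subset by auto
    then obtain b where "finite b" "b \<subseteq> cyclic_submodule D M y" "k.lin_indpt b" "k.span b = cyclic_submodule D M y"
      by (rule k.subspace_finite_basis[OF submodule_constants_if_submodule[OF submodule_cyclic] fin])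
    then show ?thesis by blast
  qed
  obtain b where "?Q (card b) x b" using basis[OF x(1)] x by metis
  then have "\<exists>m y b. ?Q m y b" by blast
  define m where "m = (LEAST m. \<exists>y b. ?Q m y b)"
  have "\<exists>y b. ?Q m y b" unfolding m_def by (rule LeastI_ex) fact
  then obtain y b where y: "y \<in> U" "y \<noteq> \<zero>" and b: "finite b" "b \<subseteq> cyclic_submodule D M y"
    "k.span b = cyclic_submodule D M y" "card b = m" by blast
  have least: "m \<le> m'" if "?Q m' y' b'" for m' y' b' unfolding m_def by (rule Least_le) (use that in blast)
  have yM: "y \<in> carrier M" using y U.subset by auto
  have bM: "b \<subseteq> carrier M" using b(2) yM unfolding cyclic_submodule_def by auto
  \<comment> \<open>If \<open>p y\<close> is nonzero, minimality makes the submodule it generates at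
    least as large in dimension as that of \<open>y\<close>. Being contained in the latter, it
    equals it, so \<open>y\<close> is a multiple of \<open>p y\<close>.\<close>
  have inv: "\<exists>q\<in>carrier D. y = (q * p) \<cdot> y" if p: "p \<in> carrier D" and py: "p \<cdot> y \<noteq> \<zero>" for p
  proof -
    have pyU: "p \<cdot> y \<in> U" using y p by simp
    obtain b' where b': "finite b'" "b' \<subseteq> cyclic_submodule D M (p \<cdot> y)" "k.lin_indpt b'"
      "k.span b' = cyclic_submodule D M (p \<cdot> y)" using basis[OF pyU] by auto
    have "m \<le> card b'" using least[of "p \<cdot> y" b' "card b'"] pyU py b' by blast
    moreover have "cyclic_submodule D M (p \<cdot> y) \<subseteq> k.span b"
      unfolding b(3) using p yM by (auto simp: cyclic_submodule_def act_mult[symmetric])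
    ultimately have "k.span b = cyclic_submodule D M (p \<cdot> y)"
      using k.subspace_eq_if_card_le[OF submodule_constants_if_submodule[OF submodule_cyclic] _ b(1) bM b'(1,3,4,2)]
        b(4) p yM by simp
    then have "y \<in> cyclic_submodule D M (p \<cdot> y)" using b(3) mem_cyclic[OF yM] by simp
    then show ?thesis using p yM by (auto simp: cyclic_submodule_def act_mult)
  qed
  have I: "ideal (annihilator D M {y}) D" by (rule ideal_annihilator[OF yM])
  have "maximalideal (annihilator D M {y}) D"
  proof (rule maximalidealI[OF I])
    show "carrier D \<noteq> annihilator D M {y}"
      using y yM poly_ring_closed_0_1(2)[of n] by (auto simp: annihilator_def set_eq_iff intro!: exI[of _ 1])
    fix J assume J: "ideal J D" "annihilator D M {y} \<subseteq> J" "J \<subseteq> carrier D"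
    interpret J: ideal J D by (rule J(1))
    show "J = annihilator D M {y} \<or> J = carrier D"
    proof (rule disjCI)
      assume "J \<noteq> carrier D"
      then have J1: "1 \<notin> J" using J.one_imp_carrier by auto
      have "p \<cdot> y = \<zero>" if p: "p \<in> J" for p
      proof (rule ccontr)
        assume py: "p \<cdot> y \<noteq> \<zero>"
        have pD: "p \<in> carrier D" using p J(3) by auto
        then obtain q where q: "q \<in> carrier D" "y = (q * p) \<cdot> y" using inv[OF _ py] by auto
        have "(1 - q * p) \<cdot> y = y \<ominus> (q * p) \<cdot> y" using q pD yM by (simp add: act_minus)
        also have "\<dots> = \<zero>" using q(2) yM by (metis M.r_neg a_minus_def)
        finally have "1 - q * p \<in> J" using J(2) q pD unfolding annihilator_def by auto
        moreover have "q * p \<in> J" using J.I_l_closed[OF p q(1)] by simp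
        ultimately have "(1 - q * p) + q * p \<in> J" using J.a_closed by fastforce
        then show False using J1 by simp
      qed
      then show "J = annihilator D M {y}" using J unfolding annihilator_def by auto
    qed
  qed
  then show ?thesis using that y by blast
qed

lemma maximal_annihilator_in_ass:
  "x \<in> carrier M \<Longrightarrow> maximalideal (annihilator D M {x}) D \<Longrightarrow> annihilator D M {x} \<in> ass D M"
  unfolding ass_def using cring.maximalideal_prime[OF cring_poly_ring] by auto

text \<open>Let the prime \<open>P\<close> be the annihilator of \<open>x\<close>. Some nonzero
  multiple \<open>p x\<close> has a maximal annihilator; since \<open>p\<close> is not in
  \<open>P\<close>, primality shows that this annihilator is \<open>P\<close> again.\<close>

lemma ass_maximal:
  assumes fin: "k.fin_dim" and P: "P \<in> ass D M"
  obtains x where "x \<in> carrier M" "x \<noteq> \<zero>" "P = annihilator D M {x}" "maximalideal P D"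
proof -
  obtain x where prime: "primeideal P D" and x: "x \<in> carrier M" "P = annihilator D M {x}"
    using P unfolding ass_def by auto
  interpret P: primeideal P D by (rule prime)
  have x0: "x \<noteq> \<zero>"
  proof
    assume "x = \<zero>"
    then have "P = carrier D" unfolding x(2) annihilator_def by auto
    then show False using P.I_notcarr by simp
  qed
  obtain y where y: "y \<in> cyclic_submodule D M x" "y \<noteq> \<zero>" "maximalideal (annihilator D M {y}) D"
    using exists_maximal_annihilator[OF fin submodule_cyclic[OF x(1)] mem_cyclic[OF x(1)] x0] by blast
  obtain p where p: "p \<in> carrier D" "y = p \<cdot> x" using y unfolding cyclic_submodule_def by auto
  have pP: "p \<notin> P" using p y(2) unfolding x(2) annihilator_def by auto
  have "annihilator D M {y} = P"
  proof
    show "P \<subseteq> annihilator D M {y}"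
      unfolding x(2) using p x(1) act_commute[of _ p x] by (auto simp: annihilator_def)
    show "annihilator D M {y} \<subseteq> P"
    proof
      fix q assume q: "q \<in> annihilator D M {y}"
      then have "q * p \<in> P" unfolding x(2) using p x(1) by (auto simp: annihilator_def act_mult)
      then show "q \<in> P" using P.I_prime[of q p] pP p q by (auto simp: annihilator_def)
    qed
  qed
  then show ?thesis using that x x0 y by metis
qed

lemma ass_nonempty:
  assumes fin: "k.fin_dim" and nz: "carrier M \<noteq> {\<zero>}"
  shows "ass D M \<noteq> {}"
proof -
  obtain x where x: "x \<in> carrier M" "x \<noteq> \<zero>" using nz M.zero_closed by blast
  interpret U: submodule D "cyclic_submodule D M x" M by (rule submodule_cyclic[OF x(1)])
  obtain y where "y \<in> cyclic_submodule D M x" "maximalideal (annihilator D M {y}) D"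
    using exists_maximal_annihilator[OF fin submodule_cyclic[OF x(1)] mem_cyclic[OF x(1)] x(2)] by blast
  then show ?thesis using maximal_annihilator_in_ass U.subset by blast
qed

text \<open>Choose one element for each associated prime. Elements with distinct maximal
  annihilators are linearly independent over \<open>k\<close>, so there are at most as many as the
  dimension.\<close>

lemma finite_ass:
  assumes fin: "k.fin_dim"
  shows "finite (ass D M)"
proof -
  have "\<forall>P\<in>ass D M. \<exists>x. x \<in> carrier M \<and> P = annihilator D M {x} \<and> maximalideal P D"
    using ass_maximal[OF fin] by metis
  then obtain x where x: "\<And>P. P \<in> ass D M \<Longrightarrow> x P \<in> carrier M \<and> P = annihilator D M {x P} \<and> maximalideal P D"
    by metis
  then have inj: "inj_on x (ass D M)" by (metis inj_onI)
  let ?T = "x ` ass D M"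
  have TM: "?T \<subseteq> carrier M" using x by auto
  have "k.lin_indpt ?T"
  proof
    assume "k.lin_dep ?T"
    then obtain A a v where A: "finite A" "A \<subseteq> ?T" "a \<in> A \<rightarrow> carrier constants" "k.lincomb a A = \<zero>"
      "v \<in> A" "a v \<noteq> \<zero>\<^bsub>constants\<^esub>" unfolding k.lin_dep_def by auto
    obtain B where B: "B \<subseteq> ass D M" "A = x ` B" using A(2) by (auto simp: subset_image_iff)
    have "finite B" using A(1) B inj inj_on_subset finite_image_iff by metis
    obtain Q where Q: "Q \<in> B" "v = x Q" using A B by auto
    obtain c where c: "a v = const c" "c \<noteq> 0" using A by fastforce
    have Qm: "maximalideal Q D" and vM: "v \<in> carrier M" and Qv: "Q = annihilator D M {v}" using x Q B by auto
    \<comment> \<open>Acting by \<open>s\<close> kills every term of the dependence except the one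
      at \<open>v\<close>. The result puts \<open>s\<close> into \<open>Q\<close>, which already
      contains \<open>1 - s\<close>.\<close>
    obtain s where s: "s \<in> carrier D" "1 - s \<in> Q" "\<And>P. P \<in> B - {Q} \<Longrightarrow> s \<in> P"
      by (rule maximalideal_separating[of "B - {Q}" n Q]) (use \<open>finite B\<close> x B Qm in auto)
    have AM: "A \<subseteq> carrier M" using A TM by auto
    have av: "a v \<in> carrier D" using c by simp
    have rest: "s \<cdot> k.lincomb a (A - {v}) = \<zero>"
    proof -
      have "s \<cdot> k.lincomb a (A - {v}) \<in> {\<zero>}"
      proof (rule act_mem_if_act_generators_mem[of "A - {v}"])
        show "submodule constants {\<zero>} M"
          unfolding submodule_def by (auto simp: module_constants)
        show "k.lincomb a (A - {v}) \<in> k.span (A - {v})"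
          unfolding k.span_def using A by (auto intro!: exI[of _ "A - {v}"] exI[of _ a])
        fix t assume t: "t \<in> A - {v}"
        then obtain P where P: "P \<in> B" "t = x P" "P \<noteq> Q" using B Q by auto
        then have "s \<in> annihilator D M {t}" using s(3)[of P] x[of P] B by auto
        then show "s \<cdot> t \<in> {\<zero>}" unfolding annihilator_def by auto
      qed (use AM s in auto)
      then show ?thesis by simp
    qed
    have "k.lincomb a A = a v \<cdot> v \<oplus> k.lincomb a (A - {v})"
      by (rule k.lincomb_del2) (use A AM in auto)
    then have "s \<cdot> (a v \<cdot> v \<oplus> k.lincomb a (A - {v})) = \<zero>"
      using A(4) s(1) smult_r_null[of s] by metis
    moreover have "k.lincomb a (A - {v}) \<in> carrier M" using A AM by (intro k.lincomb_closed) auto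
    ultimately have "s \<cdot> a v \<cdot> v = \<zero>" using rest s av vM by (simp add: smult_r_distr)
    then have "const (inverse c) \<cdot> s \<cdot> a v \<cdot> v = \<zero>" by simp
    moreover have "const (inverse c) \<cdot> s \<cdot> a v \<cdot> v = (s * (const c * const (inverse c))) \<cdot> v"
      using s vM unfolding c(1) by (simp add: act_mult[symmetric] mult_ac)
    ultimately have "s \<in> Q" unfolding Qv annihilator_def using s c by (simp add: const_inverse)
    interpret Q: maximalideal Q D by (rule Qm)
    have "(1 - s) + s \<in> Q" using Q.a_closed[OF s(2) \<open>s \<in> Q\<close>] by simp
    then show False using Q.one_imp_carrier Q.I_notcarr by simp
  qed
  then have "finite ?T" using k.li_le_dim(1)[OF fin TM] by simp
  then show ?thesis using inj finite_imageD by blast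
qed

end

section \<open>Vector spaces over a residue field\<close>

locale residue_field =
  fixes n :: nat and \<mm> :: "'k::field mpoly set"
  assumes maximal: "maximalideal \<mm> (poly_ring n)"
begin

abbreviation "A \<equiv> poly_ring n :: 'k mpoly ring"
abbreviation "F \<equiv> A Quot \<mm>"
abbreviation cls where "cls p \<equiv> \<mm> +>\<^bsub>A\<^esub> p"

lemma field_F: "field F"
  by (rule maximalideal.quotient_is_field[OF maximal cring_poly_ring])

sublocale F: field F by (rule field_F)

lemma ideal_mm: "ideal \<mm> A" by (rule maximalideal.axioms(1)[OF maximal])

lemma carrier_F: "carrier F = cls ` carrier A"
  unfolding FactRing_simps by auto

lemma cls_closed [simp]: "p \<in> carrier A \<Longrightarrow> cls p \<in> carrier F"
  unfolding carrier_F by auto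

lemma carrier_FE:
  assumes "x \<in> carrier F" obtains p where "p \<in> carrier A" "x = cls p"
  using assms unfolding carrier_F by auto

lemma cls_eq_iff: "p \<in> carrier A \<Longrightarrow> q \<in> carrier A \<Longrightarrow> cls p = cls q \<longleftrightarrow> p - q \<in> \<mm>"
  using ring.quotient_eq_iff_same_a_r_cos[OF cring.axioms(1)[OF cring_poly_ring] ideal_mm] by simp

lemma cls_add: "p \<in> carrier A \<Longrightarrow> q \<in> carrier A \<Longrightarrow> cls p \<oplus>\<^bsub>F\<^esub> cls q = cls (p + q)"
  unfolding FactRing_def using ideal.a_rcos_sum[OF ideal_mm] by simp

lemma cls_mult: "p \<in> carrier A \<Longrightarrow> q \<in> carrier A \<Longrightarrow> cls p \<otimes>\<^bsub>F\<^esub> cls q = cls (p * q)"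
  unfolding FactRing_def using ideal.rcoset_mult_add[OF ideal_mm] by simp

lemma cls_1: "\<one>\<^bsub>F\<^esub> = cls 1"
  unfolding FactRing_def by simp

lemma mm_closed: "p \<in> \<mm> \<Longrightarrow> p \<in> carrier A"
  by (rule ideal.Icarr[OF ideal_mm])

lemma zero_in_mm: "0 \<in> \<mm>"
  using additive_subgroup.zero_closed[OF ideal.axioms(1)[OF ideal_mm]] by simp

lemma cls_0: "\<zero>\<^bsub>F\<^esub> = cls 0"
proof -
  have "cls 0 \<oplus>\<^bsub>F\<^esub> cls 0 = cls 0" by (simp add: cls_add)
  then show ?thesis using F.add.l_cancel_one[of "cls 0" "cls 0"] by simp
qed

lemma cls_eq_zero_iff: "p \<in> carrier A \<Longrightarrow> cls p = \<zero>\<^bsub>F\<^esub> \<longleftrightarrow> p \<in> \<mm>"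
  unfolding cls_0 by (subst cls_eq_iff) auto

lemma mem_clsD: "q \<in> cls p \<Longrightarrow> p \<in> carrier A \<Longrightarrow> q \<in> carrier A \<and> q - p \<in> \<mm>"
  unfolding a_r_coset_def' using mm_closed by auto

lemma some_mem_cls: "p \<in> carrier A \<Longrightarrow> (SOME q. q \<in> cls p) \<in> cls p"
  by (rule someI_ex) (use zero_in_mm in \<open>auto simp: a_r_coset_def'\<close>)

lemma some_cls:
  assumes "p \<in> carrier A"
  shows "(SOME q. q \<in> cls p) \<in> carrier A" "(SOME q. q \<in> cls p) - p \<in> \<mm>"
  using mem_clsD[OF some_mem_cls[OF assms] assms] by auto

abbreviation "P r \<equiv> direct_power (residue_module A \<mm>) r"

lemma carrier_residue_module: "carrier (residue_module A \<mm>) = carrier F"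
  by (simp add: quotient_module_def FactRing_def A_RCOSETS_def' regular_module_def a_r_coset_def')

lemma add_residue_module: "x \<oplus>\<^bsub>residue_module A \<mm>\<^esub> y = x \<oplus>\<^bsub>F\<^esub> y"
  by (simp add: quotient_module_def FactRing_def set_add_def' regular_module_def)

lemma zero_residue_module: "\<zero>\<^bsub>residue_module A \<mm>\<^esub> = \<zero>\<^bsub>F\<^esub>"
  by (simp add: quotient_module_def FactRing_def)

text \<open>The quotient action is a union over all representatives of a class. The cosets in the
  union coincide because \<open>\<mm>\<close> is an ideal, and \<open>D\<close> therefore acts by
  multiplication in the residue field.\<close>

lemma smult_residue_module:
  assumes p: "p \<in> carrier A" and x: "x \<in> carrier F"
  shows "p \<odot>\<^bsub>residue_module A \<mm>\<^esub> x = cls p \<otimes>\<^bsub>F\<^esub> x"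
proof -
  obtain q where q: "q \<in> carrier A" "x = cls q" using x by (rule carrier_FE)
  have reg: "\<mm> +>\<^bsub>regular_module A\<^esub> a = cls a" for a
    by (simp add: a_r_coset_def' regular_module_def)
  have "p \<odot>\<^bsub>residue_module A \<mm>\<^esub> x = (\<Union>a\<in>x. cls (p * a))"
    by (simp add: quotient_module_def reg) (simp add: regular_module_def)
  also have "\<dots> = (\<Union>a\<in>x. cls (p * q))"
  proof (rule SUP_cong[OF refl])
    fix a assume "a \<in> x"
    then have a: "a \<in> carrier A" "a - q \<in> \<mm>" using mem_clsD q by auto
    have "p * a - p * q = p * (a - q)" by (simp add: algebra_simps)
    also have "\<dots> \<in> \<mm>" using ideal.I_l_closed[OF ideal_mm a(2) p] by simp
    finally show "cls (p * a) = cls (p * q)" using a q p by (subst cls_eq_iff) auto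
  qed
  also have "\<dots> = cls (p * q)" using some_mem_cls[OF q(1)] q(2) by auto
  finally show ?thesis using q p by (simp add: cls_mult)
qed

lemma power_simps:
  "carrier (P r) = {..<r} \<rightarrow>\<^sub>E carrier F"
  "u \<oplus>\<^bsub>P r\<^esub> v = (\<lambda>i\<in>{..<r}. u i \<oplus>\<^bsub>F\<^esub> v i)"
  "\<zero>\<^bsub>P r\<^esub> = (\<lambda>i\<in>{..<r}. \<zero>\<^bsub>F\<^esub>)"
  by (simp_all add: direct_power_def carrier_residue_module add_residue_module zero_residue_module)

lemma power_nth: "u \<in> carrier (P r) \<Longrightarrow> i < r \<Longrightarrow> u i \<in> carrier F"
  by (auto simp: power_simps)

lemma power_smult:
  assumes "p \<in> carrier A" "u \<in> carrier (P r)"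
  shows "p \<odot>\<^bsub>P r\<^esub> u = (\<lambda>i\<in>{..<r}. cls p \<otimes>\<^bsub>F\<^esub> u i)"
proof -
  have "p \<odot>\<^bsub>P r\<^esub> u = (\<lambda>i\<in>{..<r}. p \<odot>\<^bsub>residue_module A \<mm>\<^esub> u i)" by (simp add: direct_power_def)
  also have "\<dots> = (\<lambda>i\<in>{..<r}. cls p \<otimes>\<^bsub>F\<^esub> u i)"
    by (rule restrict_ext) (use assms power_nth in \<open>simp add: smult_residue_module\<close>)
  finally show ?thesis .
qed

lemma mpoly_module_power: "mpoly_module n (P r)"
proof (rule mpoly_module.intro, rule moduleI)
  show "cring A" by (rule cring_poly_ring)
  show "abelian_group (P r)"
  proof (rule abelian_groupI)
    fix u assume u: "u \<in> carrier (P r)"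
    have "(\<lambda>i\<in>{..<r}. \<ominus>\<^bsub>F\<^esub> u i) \<oplus>\<^bsub>P r\<^esub> u = \<zero>\<^bsub>P r\<^esub>"
      unfolding power_simps by (rule restrict_ext) (use power_nth[OF u] in \<open>simp add: F.l_neg\<close>)
    moreover have "(\<lambda>i\<in>{..<r}. \<ominus>\<^bsub>F\<^esub> u i) \<in> carrier (P r)" using u by (auto simp: power_simps)
    ultimately show "\<exists>v\<in>carrier (P r). v \<oplus>\<^bsub>P r\<^esub> u = \<zero>\<^bsub>P r\<^esub>" by blast
  qed (auto simp: power_simps fun_eq_iff F.a_ac PiE_iff extensional_def)
next
  fix p q u v assume *: "p \<in> carrier A" "q \<in> carrier A" "u \<in> carrier (P r)"
  then show "p \<odot>\<^bsub>P r\<^esub> u \<in> carrier (P r)"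
    by (auto simp: power_smult power_simps)
  show "(p \<oplus>\<^bsub>A\<^esub> q) \<odot>\<^bsub>P r\<^esub> u = p \<odot>\<^bsub>P r\<^esub> u \<oplus>\<^bsub>P r\<^esub> q \<odot>\<^bsub>P r\<^esub> u"
    using * power_nth[OF *(3)]
    by (simp add: power_smult power_simps(2) cls_add[symmetric] F.l_distr cong: restrict_cong)
  have "cls (p * q) \<otimes>\<^bsub>F\<^esub> u i = cls p \<otimes>\<^bsub>F\<^esub> (cls q \<otimes>\<^bsub>F\<^esub> u i)" if "i < r" for i
    using * power_nth[OF *(3) that] by (simp add: cls_mult[symmetric] F.m_assoc)
  moreover have "q \<odot>\<^bsub>P r\<^esub> u \<in> carrier (P r)" using * by (auto simp: power_smult power_simps)
  ultimately show "(p \<otimes>\<^bsub>A\<^esub> q) \<odot>\<^bsub>P r\<^esub> u = p \<odot>\<^bsub>P r\<^esub> (q \<odot>\<^bsub>P r\<^esub> u)"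
    using * by (simp add: power_smult cong: restrict_cong)
next
  fix p u v assume *: "p \<in> carrier A" "u \<in> carrier (P r)" "v \<in> carrier (P r)"
  then have "u \<oplus>\<^bsub>P r\<^esub> v \<in> carrier (P r)" by (auto simp: power_simps)
  then show "p \<odot>\<^bsub>P r\<^esub> (u \<oplus>\<^bsub>P r\<^esub> v) = p \<odot>\<^bsub>P r\<^esub> u \<oplus>\<^bsub>P r\<^esub> p \<odot>\<^bsub>P r\<^esub> v"
    using * power_nth[OF *(2)] power_nth[OF *(3)]
    by (simp add: power_smult power_simps(2) F.r_distr cong: restrict_cong)
next
  fix u assume "u \<in> carrier (P r)"
  then show "\<one>\<^bsub>A\<^esub> \<odot>\<^bsub>P r\<^esub> u = u"
    by (auto simp: power_smult fun_eq_iff cls_1[symmetric]) (auto simp: power_simps PiE_iff extensional_def)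
qed

end

locale killed_module = residue_field n \<mm> + mpoly_module n M
  for n and \<mm> :: "'k::field mpoly set" and M :: "('k::field mpoly, 'm, 'd) module_scheme" (structure) +
  assumes killed: "p \<in> \<mm> \<Longrightarrow> x \<in> carrier M \<Longrightarrow> p \<odot> x = \<zero>"
begin

abbreviation "V \<equiv> over_residue_field M"

lemma V_simps [simp]:
  "carrier V = carrier M" "x \<oplus>\<^bsub>V\<^esub> y = x \<oplus> y" "\<zero>\<^bsub>V\<^esub> = \<zero>"
  by (simp_all add: over_residue_field_def)

text \<open>Independence of the representative: the arbitrary choice made in
  \<open>over_residue_field\<close> is harmless on a module killed by \<open>\<mm>\<close>.\<close>

lemma act_eq_if_diff_mem:
  assumes "p \<in> carrier A" "q \<in> carrier A" "p - q \<in> \<mm>" "x \<in> carrier M"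
  shows "p \<cdot> x = q \<cdot> x"
proof -
  have "p = (p - q) + q" by simp
  then have "p \<cdot> x = (p - q) \<cdot> x \<oplus> q \<cdot> x" using assms act_add[of "p - q" q x] by simp
  then show ?thesis using killed[OF assms(3,4)] assms by simp
qed

lemma V_smult: "p \<in> carrier A \<Longrightarrow> x \<in> carrier M \<Longrightarrow> cls p \<odot>\<^bsub>V\<^esub> x = p \<cdot> x"
  using some_cls[of p] act_eq_if_diff_mem by (simp add: over_residue_field_def)

lemma vectorspace_V: "vectorspace F V"
proof (rule vectorspace.intro[OF _ field_F], rule moduleI)
  show "cring F" by (rule F.is_cring)
  show "abelian_group V"
  proof (rule abelian_groupI)
    fix x assume "x \<in> carrier V"
    then show "\<exists>y\<in>carrier V. y \<oplus>\<^bsub>V\<^esub> x = \<zero>\<^bsub>V\<^esub>" by (auto intro!: bexI[of _ "\<ominus> x"] simp: M.l_neg)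
  qed (auto simp: M.a_ac)
next
  fix a b x y assume a: "a \<in> carrier F" and x: "x \<in> carrier V"
  obtain p where p: "p \<in> carrier A" "a = cls p" using a by (rule carrier_FE)
  show "a \<odot>\<^bsub>V\<^esub> x \<in> carrier V" using p x by (simp add: V_smult)
  show "a \<odot>\<^bsub>V\<^esub> (x \<oplus>\<^bsub>V\<^esub> y) = a \<odot>\<^bsub>V\<^esub> x \<oplus>\<^bsub>V\<^esub> a \<odot>\<^bsub>V\<^esub> y" if "y \<in> carrier V"
    using p x that by (simp add: V_smult smult_r_distr)
  assume b: "b \<in> carrier F"
  obtain q where q: "q \<in> carrier A" "b = cls q" using b by (rule carrier_FE)
  show "(a \<oplus>\<^bsub>F\<^esub> b) \<odot>\<^bsub>V\<^esub> x = a \<odot>\<^bsub>V\<^esub> x \<oplus>\<^bsub>V\<^esub> b \<odot>\<^bsub>V\<^esub> x"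
    using p q x by (simp add: V_smult cls_add act_add)
  show "(a \<otimes>\<^bsub>F\<^esub> b) \<odot>\<^bsub>V\<^esub> x = a \<odot>\<^bsub>V\<^esub> (b \<odot>\<^bsub>V\<^esub> x)"
    using p q x by (simp add: V_smult cls_mult act_mult)
next
  fix x assume "x \<in> carrier V"
  then show "\<one>\<^bsub>F\<^esub> \<odot>\<^bsub>V\<^esub> x = x" by (simp add: cls_1 V_smult)
qed

end

sublocale killed_module \<subseteq> V: vectorspace "poly_ring n Quot \<mm>" "over_residue_field M"
  by (rule vectorspace_V)

context residue_field
begin

lemma killed_module_power: "killed_module n \<mm> (P r)"
proof (intro killed_module.intro residue_field_axioms mpoly_module_power killed_module_axioms.intro)
  fix p u assume p: "p \<in> \<mm>" and u: "u \<in> carrier (P r)"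
  then have "cls p = \<zero>\<^bsub>F\<^esub>" "p \<in> carrier A" using cls_eq_zero_iff mm_closed by auto
  then show "p \<odot>\<^bsub>P r\<^esub> u = \<zero>\<^bsub>P r\<^esub>" using u power_nth[OF u] by (simp add: power_smult power_simps(3) cong: restrict_cong)
qed

text \<open>For \<open>i \<ge> r\<close> this is the zero vector. A single index range thus serves
  powers with different exponents.\<close>

definition unit_vector :: "nat \<Rightarrow> nat \<Rightarrow> nat \<Rightarrow> 'k mpoly set" where
  "unit_vector r i = (\<lambda>j\<in>{..<r}. if i = j then \<one>\<^bsub>F\<^esub> else \<zero>\<^bsub>F\<^esub>)"

lemma unit_vector_closed: "unit_vector r i \<in> carrier (P r)"
  by (auto simp: unit_vector_def power_simps)

lemma basis_unit_vectors:
  "vectorspace.basis F (over_residue_field (P r)) (unit_vector r ` {..<r})" "inj_on (unit_vector r) {..<r}"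
proof -
  interpret killed_module n \<mm> "P r" by (rule killed_module_power)
  let ?B = "unit_vector r ` {..<r}"
  note std = unit_vector_closed[of r] and std_def = unit_vector_def
  show inj: "inj_on (unit_vector r) {..<r}"
  proof (rule inj_onI)
    fix i j assume "i \<in> {..<r}" "j \<in> {..<r}" "unit_vector r i = unit_vector r j"
    then have "unit_vector r i i = unit_vector r j i" "i < r" by auto
    then show "i = j" by (auto simp: std_def split: if_splits)
  qed
  have BP: "?B \<subseteq> carrier V" using std by auto
  have smult: "(a \<odot>\<^bsub>V\<^esub> u) j = a \<otimes>\<^bsub>F\<^esub> u j" if "a \<in> carrier F" "u \<in> carrier (P r)" "j < r" for a u j
    using that by (auto elim!: carrier_FE simp: V_smult power_smult)
  \<comment> \<open>Stated for subsets of the unit vectors so that the combination can be built up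
    by induction. Coordinate \<open>j\<close> sees only the coefficient at the \<open>j\<close>-th
    unit vector.\<close>
  have coord: "V.lincomb a B j = (if unit_vector r j \<in> B then a (unit_vector r j) else \<zero>\<^bsub>F\<^esub>)"
    if "B \<subseteq> ?B" "a \<in> ?B \<rightarrow> carrier F" "j < r" for a B j
    using finite_subset[OF that(1) finite_imageI[OF finite_lessThan]] that(1)
  proof (induct B)
    case empty
    then show ?case using that by (simp add: power_simps)
  next
    case (insert w B)
    then obtain i where i: "i < r" "w = unit_vector r i" by auto
    have stdj: "unit_vector r i j = (if i = j then \<one>\<^bsub>F\<^esub> else \<zero>\<^bsub>F\<^esub>)" using that(3) by (simp add: std_def)
    have aw: "a w \<in> carrier F" and a: "a \<in> B \<rightarrow> carrier F" using insert that by auto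
    have "V.lincomb a (insert w B) = a w \<odot>\<^bsub>V\<^esub> w \<oplus>\<^bsub>V\<^esub> V.lincomb a B"
      using insert(1,2,4) a aw BP by (intro V.lincomb_insert2) auto
    moreover have "V.lincomb a B \<in> carrier V" using insert a BP by (intro V.lincomb_closed) auto
    moreover have "a w \<odot>\<^bsub>V\<^esub> w \<in> carrier V" using aw i std by (intro V.smult_closed) auto
    ultimately have "V.lincomb a (insert w B) j = a w \<otimes>\<^bsub>F\<^esub> unit_vector r i j \<oplus>\<^bsub>F\<^esub> V.lincomb a B j"
      using smult[OF aw, of w j] std i that(3) by (simp add: power_simps)
    also have "\<dots> = a w \<otimes>\<^bsub>F\<^esub> (if i = j then \<one>\<^bsub>F\<^esub> else \<zero>\<^bsub>F\<^esub>) \<oplus>\<^bsub>F\<^esub> (if unit_vector r j \<in> B then a (unit_vector r j) else \<zero>\<^bsub>F\<^esub>)"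
      using insert(3,4) stdj by simp
    also have "\<dots> = (if unit_vector r j \<in> insert w B then a (unit_vector r j) else \<zero>\<^bsub>F\<^esub>)"
    proof (cases "i = j")
      case True
      then have "unit_vector r j = w" "unit_vector r j \<notin> B" using i insert(2) by auto
      then show ?thesis using aw True by simp
    next
      case False
      then have "unit_vector r j \<noteq> w" using inj_onD[OF inj, of j i] i that(3) by auto
      moreover have "a (unit_vector r j) \<in> carrier F" using that by auto
      ultimately show ?thesis using aw False by simp
    qed
    finally show ?case .
  qed
  have "V.lin_indpt ?B"
  proof (rule V.finite_lin_indpt2)
    fix a assume a: "a \<in> ?B \<rightarrow> carrier F" and 0: "V.lincomb a ?B = \<zero>\<^bsub>V\<^esub>"
    show "\<forall>v\<in>?B. a v = \<zero>\<^bsub>F\<^esub>"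
    proof
      fix v assume "v \<in> ?B"
      then obtain j where j: "j < r" "v = unit_vector r j" by auto
      then show "a v = \<zero>\<^bsub>F\<^esub>" using coord[OF order_refl a j(1)] 0 by (simp add: power_simps)
    qed
  qed (use BP in auto)
  moreover have "V.span ?B = carrier V"
  proof
    show "V.span ?B \<subseteq> carrier V" using V.span_is_subset2[OF BP] .
    show "carrier V \<subseteq> V.span ?B"
    proof
      fix u assume u: "u \<in> carrier V"
      define a where "a w = u (inv_into {..<r} (unit_vector r) w)" for w
      have a: "a (unit_vector r j) = u j" if "j < r" for j using inj that unfolding a_def by simp
      have aB: "a \<in> ?B \<rightarrow> carrier F" using a u by (auto simp: power_simps)
      have "V.lincomb a ?B \<in> carrier (P r)" using V.lincomb_closed[OF BP aB] by simp
      then have "u = V.lincomb a ?B"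
        using u coord[OF order_refl aB] a unfolding V_simps power_simps
        by (intro PiE_ext[of u "{..<r}" "\<lambda>_. carrier F"]) auto
      then show "u \<in> V.span ?B" using V.finite_span[OF _ BP] aB by auto
    qed
  qed
  ultimately show "V.basis ?B" using BP unfolding V.basis_def by auto
qed

lemma dim_power:
  "vectorspace.fin_dim F (over_residue_field (P r))" "vectorspace.dim F (over_residue_field (P r)) = r"
proof -
  interpret killed_module n \<mm> "P r" by (rule killed_module_power)
  note basis = basis_unit_vectors[of r]
  show "V.fin_dim" unfolding V.fin_dim_def using basis(1) unfolding V.basis_def by auto
  show "V.dim = r" using V.dim_basis[OF _ basis(1)] basis(2) by (simp add: card_image)
qed

text \<open>A \<open>D\<close>-submodule of \<open>F^r\<close> is also an \<open>F\<close>-subspace,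
  because a residue class acts through any polynomial that represents it.\<close>

lemma submodule_power_eq_if_unit_vectors:
  assumes H: "submodule A H (P r)" and std: "\<And>i. i < r \<Longrightarrow> unit_vector r i \<in> H"
  shows "H = carrier (P r)"
proof -
  interpret killed_module n \<mm> "P r" by (rule killed_module_power)
  interpret H: submodule A H "P r" by (rule H)
  have "submodule F H V"
    unfolding submodule_def
  proof (intro conjI allI impI)
    fix a v assume "a \<in> carrier F" and v: "v \<in> H"
    then obtain p where "p \<in> carrier A" "a = cls p" by (auto elim: carrier_FE)
    moreover have "v \<in> carrier (P r)" using v H.subset by blast
    ultimately have "a \<odot>\<^bsub>V\<^esub> v = p \<odot>\<^bsub>P r\<^esub> v" by (simp only: V_smult)
    then show "a \<odot>\<^bsub>V\<^esub> v \<in> H" using H.smult_closed[OF \<open>p \<in> carrier A\<close> v] by simp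
  qed (use H.subset V.module_axioms in auto)
  then have "V.span (unit_vector r ` {..<r}) \<subseteq> H" using std by (intro V.span_is_subset) auto
  then show ?thesis using basis_unit_vectors(1)[of r] H.subset unfolding V.basis_def by auto
qed

end

lemma module_hom_inv_into:
  assumes f: "f \<in> module_hom R M N" "bij_betw f (carrier M) (carrier N)" and M: "Module.module R M"
  shows "inv_into (carrier M) f \<in> module_hom R N M" "bij_betw (inv_into (carrier M) f) (carrier N) (carrier M)"
proof -
  interpret M: Module.module R M by (rule M)
  let ?g = "inv_into (carrier M) f"
  show "bij_betw ?g (carrier N) (carrier M)" by (rule bij_betw_inv_into[OF f(2)])
  have g: "?g y \<in> carrier M" "f (?g y) = y" if "y \<in> carrier N" for y
    using that f(2) by (auto simp: bij_betw_def inv_into_into f_inv_into_f)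
  have gI: "?g y = x" if "x \<in> carrier M" "f x = y" for x y
    using that f(2) by (auto simp: bij_betw_def)
  show "?g \<in> module_hom R N M"
    unfolding module_hom_def
  proof (intro CollectI conjI allI impI funcsetI)
    fix y z assume "y \<in> carrier N \<and> z \<in> carrier N"
    then show "?g (y \<oplus>\<^bsub>N\<^esub> z) = ?g y \<oplus>\<^bsub>M\<^esub> ?g z"
      using g[of y] g[of z] module_hom_add[OF f(1)] by (intro gI) auto
  next
    fix a y assume "a \<in> carrier R \<and> y \<in> carrier N"
    then show "?g (a \<odot>\<^bsub>N\<^esub> y) = a \<odot>\<^bsub>M\<^esub> ?g y"
      using g[of y] module_hom_smult[OF f(1)] by (intro gI) auto
  qed (use g in auto)
qed

section \<open>Modules killed by a maximal ideal as direct powers\<close>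

context killed_module
begin

lemma iso_power_if_fin_dim:
  assumes fin: "V.fin_dim"
  obtains T where "T \<in> module_hom D (P V.dim) M" "bij_betw T (carrier (P V.dim)) (carrier M)"
proof -
  let ?r = V.dim
  obtain b where b: "finite b" "V.basis b" using V.finite_basis_exists[OF fin] by auto
  have bV: "b \<subseteq> carrier V" using b(2) unfolding V.basis_def by auto
  have r: "card b = ?r" using V.dim_basis[OF b] by simp
  have crit: "\<exists>!a. a \<in> b \<rightarrow>\<^sub>E carrier F \<and> V.lincomb a b = v" if "v \<in> carrier M" for v
    using V.basis_criterion[OF b(1) bV] b(2) that by auto
  obtain h where h: "bij_betw h b {..<?r}"
    using ex_bij_betw_finite_nat[OF b(1)] r by (auto simp: atLeast0LessThan)
  \<comment> \<open>A coordinate vector is sent to the combination of basis elements;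
    \<open>h\<close> numbers the basis.\<close>
  define T where "T u = V.lincomb (\<lambda>w. u (h w)) b" for u
  have hb: "h w < ?r" if "w \<in> b" for w using h that by (auto simp: bij_betw_def)
  have coef: "(\<lambda>w. u (h w)) \<in> b \<rightarrow> carrier F" if "u \<in> carrier (P ?r)" for u
    using that hb by (auto simp: power_simps)
  have T: "T u \<in> carrier M" if "u \<in> carrier (P ?r)" for u
    unfolding T_def using V.lincomb_closed[OF bV coef[OF that]] by simp
  have "T \<in> module_hom D (P ?r) M"
    unfolding module_hom_def
  proof (intro CollectI conjI allI impI funcsetI)
    fix u v assume uv: "u \<in> carrier (P ?r) \<and> v \<in> carrier (P ?r)"
    have "T (u \<oplus>\<^bsub>P ?r\<^esub> v) = V.lincomb (\<lambda>w. u (h w) \<oplus>\<^bsub>F\<^esub> v (h w)) b"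
      unfolding T_def using uv coef[of u] coef[of v] hb
      by (intro V.lincomb_cong[OF refl bV]) (auto simp: power_simps)
    then show "T (u \<oplus>\<^bsub>P ?r\<^esub> v) = T u \<oplus> T v"
      unfolding T_def using V.lincomb_sum[OF b(1) bV coef coef] uv by simp
  next
    fix p u assume pu: "p \<in> carrier D \<and> u \<in> carrier (P ?r)"
    have "T (p \<odot>\<^bsub>P ?r\<^esub> u) = V.lincomb (\<lambda>w. cls p \<otimes>\<^bsub>F\<^esub> u (h w)) b"
      unfolding T_def using pu coef[of u] hb
      by (intro V.lincomb_cong[OF refl bV]) (auto simp: power_smult)
    also have "\<dots> = cls p \<odot>\<^bsub>V\<^esub> T u"
      unfolding T_def using V.lincomb_smult[OF bV coef, of u "cls p"] pu by simp
    finally show "T (p \<odot>\<^bsub>P ?r\<^esub> u) = p \<cdot> T u" using pu T V_smult by simp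
  qed (use T in auto)
  moreover have "bij_betw T (carrier (P ?r)) (carrier M)"
  proof (rule bij_betw_imageI)
    show "inj_on T (carrier (P ?r))"
    proof (rule inj_onI)
      fix u v assume u: "u \<in> carrier (P ?r)" and v: "v \<in> carrier (P ?r)" and eq: "T u = T v"
      have res: "V.lincomb (\<lambda>w\<in>b. x (h w)) b = T x" if "x \<in> carrier (P ?r)" for x
        unfolding T_def using coef[OF that] by (intro V.lincomb_cong[OF refl bV]) auto
      have "(\<lambda>w\<in>b. u (h w)) = (\<lambda>w\<in>b. v (h w))"
        using crit[OF T[OF u]] res[OF u] res[OF v] eq coef[OF u] coef[OF v] by auto
      then have "u (h w) = v (h w)" if "w \<in> b" for w using that by (metis restrict_apply')
      then have "u i = v i" if "i < ?r" for i
        using that h unfolding bij_betw_def by (metis imageE lessThan_iff)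
      then show "u = v" using u v unfolding power_simps by (intro PiE_ext[of u "{..<?r}" "\<lambda>_. carrier F"]) auto
    qed
    show "T ` carrier (P ?r) = carrier M"
    proof
      show "T ` carrier (P ?r) \<subseteq> carrier M" using T by auto
      show "carrier M \<subseteq> T ` carrier (P ?r)"
      proof
        fix x assume "x \<in> carrier M"
        then obtain a where a: "a \<in> b \<rightarrow>\<^sub>E carrier F" "V.lincomb a b = x" using crit by blast
        let ?u = "\<lambda>i\<in>{..<?r}. a (inv_into b h i)"
        have ih: "inv_into b h i \<in> b" if "i < ?r" for i using h that by (auto simp: bij_betw_def intro!: inv_into_into)
        have u: "?u \<in> carrier (P ?r)" using a ih by (auto simp: power_simps)
        have "T ?u = x" unfolding T_def a(2)[symmetric]
          using a hb bij_betw_inv_into_left[OF h] by (intro V.lincomb_cong[OF refl bV]) auto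
        then show "x \<in> T ` carrier (P ?r)" using u by blast
      qed
    qed
  qed
  ultimately show ?thesis using that by blast
qed

text \<open>Residue classes act through polynomials, so an isomorphism of \<open>D\<close>-modules
  is automatically \<open>F\<close>-linear and preserves dimension.\<close>

lemma dim_if_iso_power:
  assumes T: "T \<in> module_hom D (P r) M" "bij_betw T (carrier (P r)) (carrier M)"
  shows "V.fin_dim" "V.dim = r"
proof -
  interpret Pr: killed_module n \<mm> "P r" by (rule killed_module_power)
  have "T \<in> module_hom F Pr.V V"
    unfolding module_hom_def
  proof (intro CollectI conjI allI impI)
    show "T \<in> carrier Pr.V \<rightarrow> carrier V" using module_hom_closed[OF T(1)] by simp
    fix a u assume "a \<in> carrier F \<and> u \<in> carrier Pr.V"
    then obtain p where p: "p \<in> carrier A" "a = cls p" and u: "u \<in> carrier (P r)" by (auto elim: carrier_FE)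
    have "T u \<in> carrier M" using module_hom_closed[OF T(1)] u by auto
    then show "T (a \<odot>\<^bsub>Pr.V\<^esub> u) = a \<odot>\<^bsub>V\<^esub> T u"
      using p u module_hom_smult[OF T(1)] by (simp add: V_smult Pr.V_smult)
  qed (use module_hom_add[OF T(1)] in auto)
  then interpret T: linear_map F Pr.V V T
    by (intro linear_map.intro mod_hom.intro mod_hom_axioms.intro V.module_axioms Pr.V.module_axioms
        vectorspace_V Pr.vectorspace_V)
  have surj: "T ` carrier Pr.V = carrier V" and inj: "inj_on T (carrier Pr.V)" using T(2) by (auto simp: bij_betw_def)
  show "V.fin_dim" by (rule T.surj_fin_dim[OF dim_power(1) surj])
  show "V.dim = r" using T.dim_eq[OF dim_power(1) inj surj] dim_power(2) by simp
qed

end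

section \<open>Socle and top\<close>

text \<open>Two surjections from one module with the same fibres induce a bijection of their targets
  that respects both operations. As nothing is demanded of \<open>N\<close> and \<open>N'\<close>
  beyond receiving such maps, the lemma applies directly to \<open>quotient_module\<close>
  records.\<close>

lemma module_isomorphic_if_same_kernel:
  assumes R: "Module.module A R"
    and f: "f \<in> module_hom A R N" "f ` carrier R = carrier N"
    and g: "g \<in> module_hom A R N'" "g ` carrier R = carrier N'"
    and eq: "\<And>x y. x \<in> carrier R \<Longrightarrow> y \<in> carrier R \<Longrightarrow> f x = f y \<longleftrightarrow> g x = g y"
  shows "module_isomorphic A N N'"
proof -
  interpret R: Module.module A R by (rule R)
  define h where "h u = g (SOME x. x \<in> carrier R \<and> f x = u)" for u
  have h: "h (f x) = g x" if "x \<in> carrier R" for x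
  proof -
    have "(SOME y. y \<in> carrier R \<and> f y = f x) \<in> carrier R \<and> f (SOME y. y \<in> carrier R \<and> f y = f x) = f x"
      by (rule someI[of _ x]) (use that in simp)
    then show ?thesis unfolding h_def using eq that by blast
  qed
  have "h \<in> module_hom A N N'"
    unfolding module_hom_def
  proof (intro CollectI conjI allI impI funcsetI)
    fix u assume "u \<in> carrier N"
    then obtain x where "x \<in> carrier R" "u = f x" using f(2) by blast
    then show "h u \<in> carrier N'" using h g(2) by auto
  next
    fix u v assume "u \<in> carrier N \<and> v \<in> carrier N"
    then obtain x y where xy: "x \<in> carrier R" "u = f x" "y \<in> carrier R" "v = f y" using f(2) by blast
    then have "u \<oplus>\<^bsub>N\<^esub> v = f (x \<oplus>\<^bsub>R\<^esub> y)" using module_hom_add[OF f(1)] by simp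
    then show "h (u \<oplus>\<^bsub>N\<^esub> v) = h u \<oplus>\<^bsub>N'\<^esub> h v" using xy h module_hom_add[OF g(1)] by simp
  next
    fix a u assume "a \<in> carrier A \<and> u \<in> carrier N"
    then obtain x where x: "a \<in> carrier A" "x \<in> carrier R" "u = f x" using f(2) by blast
    then have "a \<odot>\<^bsub>N\<^esub> u = f (a \<odot>\<^bsub>R\<^esub> x)" using module_hom_smult[OF f(1)] by simp
    then show "h (a \<odot>\<^bsub>N\<^esub> u) = a \<odot>\<^bsub>N'\<^esub> h u" using x h module_hom_smult[OF g(1)] by simp
  qed
  moreover have "bij_betw h (carrier N) (carrier N')"
    unfolding bij_betw_def f(2)[symmetric] g(2)[symmetric]
    using h eq by (auto simp: inj_on_def image_iff)
  ultimately show ?thesis unfolding module_isomorphic_def by blast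
qed

lemma module_isomorphicE:
  assumes "module_isomorphic A M N"
  obtains f where "f \<in> module_hom A M N" "f ` carrier M = carrier N" "inj_on f (carrier M)"
  using assms unfolding module_isomorphic_def bij_betw_def by blast

lemma (in residue_field) isomorphic_powers_eq:
  assumes "module_isomorphic A (P r) (P s)"
  shows "r = s"
proof -
  interpret Pr: killed_module n \<mm> "P r" by (rule killed_module_power)
  interpret Ps: killed_module n \<mm> "P s" by (rule killed_module_power)
  obtain f where f: "f \<in> module_hom A (P r) (P s)" "bij_betw f (carrier (P r)) (carrier (P s))"
    using assms unfolding module_isomorphic_def by auto
  show ?thesis using Ps.dim_if_iso_power(2)[OF f] dim_power(2)[of s] by simp
qed

text \<open>The exponents over which the infimum ranges form the singleton consisting of the
  dimension.\<close>

lemma (in killed_module) num_isotypical_eq_dim: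
  assumes fin: "V.fin_dim"
  shows "num_isotypical D \<mm> M = enat V.dim"
proof -
  obtain T where T: "T \<in> module_hom D (P V.dim) M" "bij_betw T (carrier (P V.dim)) (carrier M)"
    using iso_power_if_fin_dim[OF fin] by blast
  interpret Pd: mpoly_module n "P V.dim" by (rule mpoly_module_power)
  have "module_isomorphic D M (P r) \<longleftrightarrow> r = V.dim" for r
  proof
    assume "module_isomorphic D M (P r)"
    then obtain f where f: "f \<in> module_hom D M (P r)" "bij_betw f (carrier M) (carrier (P r))"
      unfolding module_isomorphic_def by auto
    show "r = V.dim" using dim_if_iso_power(2)[OF module_hom_inv_into[OF f module_axioms]] by simp
  next
    assume "r = V.dim"
    then show "module_isomorphic D M (P r)"
      unfolding module_isomorphic_def using module_hom_inv_into[OF T Pd.module_axioms] by blast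
  qed
  then show ?thesis unfolding num_isotypical_def by simp
qed

lemma (in killed_module) residue_dim_eq_dim:
  "V.fin_dim \<Longrightarrow> residue_dim D \<mm> M = enat V.dim"
  by (simp add: residue_dim_def)

section \<open>The socle component as the elements killed by the ideal\<close>

context mpoly_module
begin

lemma maximalideal_subset: "maximalideal \<mm> D \<Longrightarrow> \<mm> \<subseteq> carrier D"
  by (rule subsetI, erule ideal.Icarr[OF maximalideal.axioms(1)])

text \<open>The elementwise description of the socle component. For a maximal ideal it agrees with
  the sum of simple submodules in \<open>soc_component\<close>, by
  \<open>soc_component_eq\<close>.\<close>

definition soc :: "'k mpoly set \<Rightarrow> 'm set" where
  "soc \<mm> = {x \<in> carrier M. \<forall>p\<in>\<mm>. p \<cdot> x = \<zero>}"

abbreviation "Soc \<mm> \<equiv> M\<lparr>carrier := soc \<mm>\<rparr>"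
abbreviation "copies \<mm> r \<equiv> direct_power (residue_module D \<mm>) r"

lemma submodule_soc:
  assumes "\<mm> \<subseteq> carrier D" shows "submodule D (soc \<mm>) M"
  unfolding submodule_def
proof (intro conjI allI impI)
  fix c v assume c: "c \<in> carrier D" and v: "v \<in> soc \<mm>"
  have "p \<cdot> c \<cdot> v = c \<cdot> p \<cdot> v" if "p \<in> \<mm>" for p
    using that c v assms by (intro act_commute) (auto simp: soc_def)
  then show "c \<cdot> v \<in> soc \<mm>" using c v by (auto simp: soc_def)
qed (use assms in \<open>auto simp: soc_def module_axioms smult_r_distr subset_iff\<close>)

lemma killed_module_soc:
  assumes \<mm>: "maximalideal \<mm> D" shows "killed_module n \<mm> (Soc \<mm>)"
proof -
  note sub = maximalideal_subset[OF \<mm>]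
  show ?thesis
    using submodule_is_module[OF submodule_soc[OF sub]] \<mm>
    by (auto intro!: killed_module.intro residue_field.intro mpoly_module.intro killed_module_axioms.intro simp: soc_def)
qed

lemma annihilator_eq_if_mem_soc:
  assumes \<mm>: "maximalideal \<mm> D" and x: "x \<in> soc \<mm>" "x \<noteq> \<zero>"
  shows "annihilator D M {x} = \<mm>"
proof -
  interpret \<mm>: maximalideal \<mm> D by (rule \<mm>)
  have xM: "x \<in> carrier M" using x by (simp add: soc_def)
  have "\<mm> \<subseteq> annihilator D M {x}" using x \<mm>.Icarr by (auto simp: soc_def annihilator_def)
  moreover have "1 \<notin> annihilator D M {x}" using x xM by (simp add: annihilator_def)
  then have "annihilator D M {x} \<noteq> carrier D" using poly_ring_closed_0_1(2)[of n] by metis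
  moreover have "annihilator D M {x} \<subseteq> carrier D" by (auto simp: annihilator_def)
  ultimately show ?thesis using \<mm>.I_maximal[OF ideal_annihilator[OF xM]] by auto
qed

lemma soc_if_isomorphic_residue_module:
  assumes \<mm>: "maximalideal \<mm> D" and N: "submodule D N M"
    and iso: "module_isomorphic D (M\<lparr>carrier := N\<rparr>) (residue_module D \<mm>)"
  shows "N \<subseteq> soc \<mm>"
proof
  interpret residue_field n \<mm> by (rule residue_field.intro[OF \<mm>])
  interpret N: submodule D N M by (rule N)
  obtain f where f: "f \<in> module_hom D (M\<lparr>carrier := N\<rparr>) (residue_module D \<mm>)" "inj_on f N"
    using iso by (auto elim: module_isomorphicE)
  fix x assume x: "x \<in> N"
  have fx: "f x \<in> carrier F" using module_hom_closed[OF f(1)] x by (auto simp: carrier_residue_module)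
  have fpx: "f (p \<cdot> x) = cls p \<otimes>\<^bsub>F\<^esub> f x" if "p \<in> carrier D" for p
    using module_hom_smult[OF f(1), of p x] x that fx by (simp add: smult_residue_module)
  have "p \<cdot> x = \<zero>" if p: "p \<in> \<mm>" for p
  proof -
    have pD: "p \<in> carrier D" using p by (rule mm_closed)
    then have "cls p = cls 0" using p cls_eq_zero_iff cls_0 by simp
    then have "f (p \<cdot> x) = f (0 \<cdot> x)" using fpx[OF pD] fpx[of 0] by simp
    then have "p \<cdot> x = 0 \<cdot> x" using inj_onD[OF f(2)] x pD by simp
    then show ?thesis using x N.subset by auto
  qed
  then show "x \<in> soc \<mm>" using x N.subset by (auto simp: soc_def)
qed

text \<open>Both \<open>p \<cdot> x\<close> and \<open>cls p\<close>, as functions of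
  \<open>p\<close>, are surjections from the regular module. Their fibres coincide because
  \<open>x\<close> has annihilator exactly \<open>\<mm>\<close>.\<close>

lemma cyclic_isomorphic_residue_module:
  assumes \<mm>: "maximalideal \<mm> D" and x: "x \<in> soc \<mm>" "x \<noteq> \<zero>"
  shows "module_isomorphic D (M\<lparr>carrier := cyclic_submodule D M x\<rparr>) (residue_module D \<mm>)"
proof (rule module_isomorphic_if_same_kernel)
  interpret residue_field n \<mm> by (rule residue_field.intro[OF \<mm>])
  have xM: "x \<in> carrier M" using x by (simp add: soc_def)
  let ?reg = "regular_module D"
  have [simp]: "carrier ?reg = carrier D" "add ?reg = (+)" "\<zero>\<^bsub>?reg\<^esub> = 0" "module.smult ?reg = (*)"
    by (auto simp: regular_module_def fun_eq_iff)
  show "Module.module D ?reg"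
  proof (rule moduleI)
    show "abelian_group ?reg"
    proof (rule abelian_groupI)
      fix p assume "p \<in> carrier ?reg"
      then show "\<exists>q\<in>carrier ?reg. q \<oplus>\<^bsub>?reg\<^esub> p = \<zero>\<^bsub>?reg\<^esub>" by (intro bexI[of _ "- p"]) auto
    qed (auto simp: add_ac)
  qed (auto simp: cring_poly_ring algebra_simps)
  show "(\<lambda>p. p \<cdot> x) \<in> module_hom D ?reg (M\<lparr>carrier := cyclic_submodule D M x\<rparr>)"
    using xM by (auto simp: module_hom_def cyclic_submodule_def act_add act_mult)
  show "(\<lambda>p. p \<cdot> x) ` carrier ?reg = carrier (M\<lparr>carrier := cyclic_submodule D M x\<rparr>)"
    by (auto simp: cyclic_submodule_def)
  show "cls \<in> module_hom D ?reg (residue_module D \<mm>)"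
    by (simp add: module_hom_def carrier_residue_module add_residue_module smult_residue_module cls_add cls_mult)
  show "cls ` carrier ?reg = carrier (residue_module D \<mm>)"
    by (simp add: carrier_residue_module carrier_F)
  fix p q assume pq: "p \<in> carrier ?reg" "q \<in> carrier ?reg"
  have "p \<cdot> x = q \<cdot> x \<longleftrightarrow> (p - q) \<cdot> x = \<zero>"
    using pq xM by (simp add: act_minus)
  also have "\<dots> \<longleftrightarrow> p - q \<in> \<mm>"
    using annihilator_eq_if_mem_soc[OF \<mm> x] pq by (auto simp: annihilator_def)
  finally show "p \<cdot> x = q \<cdot> x \<longleftrightarrow> cls p = cls q" using pq by (simp add: cls_eq_iff)
qed

text \<open>A nonzero multiple \<open>p x\<close> has \<open>p\<close> outside \<open>\<mm>\<close>.
  Multiplying by an inverse of \<open>p\<close> modulo \<open>\<mm>\<close> gives back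
  \<open>x\<close>, so any nonzero submodule is everything.\<close>

lemma simple_cyclic:
  assumes \<mm>: "maximalideal \<mm> D" and x: "x \<in> soc \<mm>" "x \<noteq> \<zero>"
  shows "simple_module D (M\<lparr>carrier := cyclic_submodule D M x\<rparr>)"
  unfolding simple_module_def
proof (intro conjI allI impI)
  have xM: "x \<in> carrier M" using x by (simp add: soc_def)
  let ?N = "cyclic_submodule D M x"
  show "Module.module D (M\<lparr>carrier := ?N\<rparr>)" by (rule submodule_is_module[OF submodule_cyclic[OF xM]])
  show "carrier (M\<lparr>carrier := ?N\<rparr>) \<noteq> {\<zero>\<^bsub>M\<lparr>carrier := ?N\<rparr>\<^esub>}" using mem_cyclic[OF xM] x by auto
  fix H assume H: "submodule D H (M\<lparr>carrier := ?N\<rparr>)"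
  interpret H: submodule D H "M\<lparr>carrier := ?N\<rparr>" by (rule H)
  show "H = {\<zero>\<^bsub>M\<lparr>carrier := ?N\<rparr>\<^esub>} \<or> H = carrier (M\<lparr>carrier := ?N\<rparr>)"
  proof (rule disjCI)
    assume "H \<noteq> carrier (M\<lparr>carrier := ?N\<rparr>)"
    then have neq: "H \<noteq> ?N" by simp
    have zero: "y = \<zero>" if y: "y \<in> H" for y
    proof (rule ccontr)
      assume y0: "y \<noteq> \<zero>"
      obtain p where p: "p \<in> carrier D" "y = p \<cdot> x" using y H.subset by (auto simp: cyclic_submodule_def)
      have "p \<notin> \<mm>" using y0 p(2) x(1) by (auto simp: soc_def)
      then obtain q where q: "q \<in> carrier D" "1 - q * p \<in> \<mm>" using maximalideal_inverse[OF \<mm> p(1)] by auto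
      have "(1 - q * p) \<cdot> x = \<zero>" using q x by (simp add: soc_def)
      then have xq: "x = q \<cdot> y" using p q xM by (simp add: act_minus act_mult)
      have "r \<cdot> x \<in> H" if "r \<in> carrier D" for r
        using H.smult_closed[OF that H.smult_closed[OF q(1) y]] xq by simp
      then have "?N \<subseteq> H" by (auto simp: cyclic_submodule_def)
      then show False using neq H.subset by auto
    qed
    have "\<zero> \<in> H" using H.zero_closed by simp
    then have "H = {\<zero>}" using zero by blast
    then show "H = {\<zero>\<^bsub>M\<lparr>carrier := ?N\<rparr>\<^esub>}" by simp
  qed
qed

text \<open>Each nonzero element killed by \<open>\<mm>\<close> generates a simple submodule
  isomorphic to the residue module, and every such submodule is killed by
  \<open>\<mm>\<close>.\<close>

lemma soc_component_eq:
  assumes \<mm>: "maximalideal \<mm> D"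
  shows "soc_component D \<mm> M = Soc \<mm>"
proof -
  let ?U = "\<Union>{N. submodule D N M \<and> simple_module D (M\<lparr>carrier := N\<rparr>) \<and>
        module_isomorphic D (M\<lparr>carrier := N\<rparr>) (residue_module D \<mm>)}"
  note sub = maximalideal_subset[OF \<mm>]
  have U: "?U \<subseteq> soc \<mm>" using soc_if_isomorphic_residue_module[OF \<mm>] by blast
  have UM: "?U \<subseteq> carrier M" using U by (auto simp: soc_def)
  have "span ?U = soc \<mm>"
  proof
    show "span ?U \<subseteq> soc \<mm>" by (rule span_is_subset[OF U submodule_soc[OF sub]])
    show "soc \<mm> \<subseteq> span ?U"
    proof
      fix x assume x: "x \<in> soc \<mm>"
      then have xM: "x \<in> carrier M" by (simp add: soc_def)
      interpret sp: submodule D "span ?U" M by (rule span_is_submodule[OF UM])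
      show "x \<in> span ?U"
      proof (cases "x = \<zero>")
        case True
        then show ?thesis using sp.zero_closed by simp
      next
        case False
        have "x \<in> ?U"
          using submodule_cyclic[OF xM] simple_cyclic[OF \<mm> x False]
            cyclic_isomorphic_residue_module[OF \<mm> x False] mem_cyclic[OF xM] by blast
        then show ?thesis using in_own_span[OF UM] by blast
      qed
    qed
  qed
  then show ?thesis unfolding soc_component_def by simp
qed

text \<open>Constants act through their residue classes, so an \<open>F\<close>-span is also a
  \<open>k\<close>-subspace and a finite \<open>k\<close>-basis spans over \<open>F\<close>.\<close>

lemma fin_dim_soc:
  assumes fin: "k.fin_dim" and \<mm>: "maximalideal \<mm> D"
  shows "vectorspace.fin_dim (D Quot \<mm>) (over_residue_field (Soc \<mm>))"
proof -
  note sub = maximalideal_subset[OF \<mm>]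
  interpret S: killed_module n \<mm> "Soc \<mm>" by (rule killed_module_soc[OF \<mm>])
  obtain b where b: "finite b" "b \<subseteq> soc \<mm>" "k.span b = soc \<mm>"
    using k.subspace_finite_basis[OF submodule_constants_if_submodule[OF submodule_soc[OF sub]] fin] by metis
  have bV: "b \<subseteq> carrier S.V" using b by simp
  interpret sp: submodule S.F "S.V.span b" S.V by (rule S.V.span_is_submodule[OF bV])
  have spS: "S.V.span b \<subseteq> soc \<mm>" using sp.subset by simp
  have "submodule constants (S.V.span b) M"
    unfolding submodule_def
  proof (intro conjI allI impI)
    show "S.V.span b \<subseteq> carrier M" using spS by (auto simp: soc_def)
    fix c :: "'k mpoly" and v assume c: "c \<in> carrier constants" and v: "v \<in> S.V.span b"
    then have cD: "c \<in> carrier D" by auto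
    have "c \<cdot> v = S.cls c \<odot>\<^bsub>S.V\<^esub> v" using S.V_smult[OF cD, of v] v spS by auto
    then show "c \<cdot> v \<in> S.V.span b" using sp.smult_closed[OF S.cls_closed[OF cD] v] by simp
  qed (use sp.m_closed sp.zero_closed module_constants in auto)
  then have "k.span b \<subseteq> S.V.span b" using S.V.in_own_span[OF bV] by (intro k.span_is_subset)
  then have "S.V.span b = carrier S.V" using b(3) spS by auto
  then show ?thesis unfolding S.V.fin_dim_def using b(1) bV by blast
qed

end

text \<open>
  When \<open>\<theta>\<close> is a nonzero linear form on the residue field \<open>F\<close>, \<open>(u, v) \<mapsto> \<Sum>\<^sub>i \<theta>(u\<^sub>i v\<^sub>i)\<close>
  is a perfect pairing on \<open>F\<^sup>r\<close>.
\<close>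

lemma (in residue_field) perfect_pairing:
  fixes \<theta> :: "'k mpoly set \<Rightarrow> 'k"
  assumes add: "\<And>a b. a \<in> carrier F \<Longrightarrow> b \<in> carrier F \<Longrightarrow> \<theta> (a \<oplus>\<^bsub>F\<^esub> b) = \<theta> a + \<theta> b"
    and const: "\<And>c a. a \<in> carrier F \<Longrightarrow> \<theta> (cls (const c) \<otimes>\<^bsub>F\<^esub> a) = c * \<theta> a"
    and one: "\<theta> \<one>\<^bsub>F\<^esub> \<noteq> 0"
  obtains \<beta> where "\<And>u v. u \<in> carrier (P r) \<Longrightarrow> v \<in> carrier (P r) \<Longrightarrow> \<beta> u v = \<beta> v u"
    "\<And>u v w. u \<in> carrier (P r) \<Longrightarrow> v \<in> carrier (P r) \<Longrightarrow> w \<in> carrier (P r) \<Longrightarrow> \<beta> u (v \<oplus>\<^bsub>P r\<^esub> w) = \<beta> u v + \<beta> u w"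
    "\<And>p u v. p \<in> carrier A \<Longrightarrow> u \<in> carrier (P r) \<Longrightarrow> v \<in> carrier (P r) \<Longrightarrow> \<beta> (p \<odot>\<^bsub>P r\<^esub> u) v = \<beta> u (p \<odot>\<^bsub>P r\<^esub> v)"
    "\<And>c u v. u \<in> carrier (P r) \<Longrightarrow> v \<in> carrier (P r) \<Longrightarrow> \<beta> u (const c \<odot>\<^bsub>P r\<^esub> v) = c * \<beta> u v"
    "\<And>u v. u \<in> carrier (P r) \<Longrightarrow> v \<in> carrier (P r) \<Longrightarrow> (\<And>w. w \<in> carrier (P r) \<Longrightarrow> \<beta> w u = \<beta> w v) \<Longrightarrow> u = v"
proof
  define \<beta> where "\<beta> u v = (\<Sum>i<r. \<theta> (u i \<otimes>\<^bsub>F\<^esub> v i))" for u v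
  fix u v assume u: "u \<in> carrier (P r)" and v: "v \<in> carrier (P r)"
  note nth = power_nth[OF u] power_nth[OF v]
  show "\<beta> u v = \<beta> v u"
    unfolding \<beta>_def using nth by (intro sum.cong refl) (simp add: F.m_comm)
  show "\<beta> u (v \<oplus>\<^bsub>P r\<^esub> w) = \<beta> u v + \<beta> u w" if w: "w \<in> carrier (P r)" for w
    unfolding \<beta>_def sum.distrib[symmetric] using nth power_nth[OF w]
    by (intro sum.cong refl) (simp add: power_simps(2) F.r_distr add)
  show "\<beta> (p \<odot>\<^bsub>P r\<^esub> u) v = \<beta> u (p \<odot>\<^bsub>P r\<^esub> v)" if "p \<in> carrier A" for p
    unfolding \<beta>_def using nth that u v by (intro sum.cong refl) (simp add: power_smult F.m_ac)
  show "\<beta> u (const c \<odot>\<^bsub>P r\<^esub> v) = c * \<beta> u v" for c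
    unfolding \<beta>_def sum_distrib_left
  proof (rule sum.cong[OF refl])
    fix i assume "i \<in> {..<r}"
    then have i: "i < r" "u i \<in> carrier F" "v i \<in> carrier F" using nth by auto
    have "u i \<otimes>\<^bsub>F\<^esub> (cls (const c) \<otimes>\<^bsub>F\<^esub> v i) = cls (const c) \<otimes>\<^bsub>F\<^esub> (u i \<otimes>\<^bsub>F\<^esub> v i)"
      using i by (intro F.m_lcomm) auto
    then show "\<theta> (u i \<otimes>\<^bsub>F\<^esub> (const c \<odot>\<^bsub>P r\<^esub> v) i) = c * \<theta> (u i \<otimes>\<^bsub>F\<^esub> v i)"
      using i v by (simp add: power_smult const)
  qed
  assume eq: "\<beta> w u = \<beta> w v" if "w \<in> carrier (P r)" for w
  have "u j = v j" if j: "j < r" for j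
  proof (rule ccontr)
    let ?d = "u j \<ominus>\<^bsub>F\<^esub> v j"
    \<comment> \<open>A test vector supported at \<open>j\<close>, where it inverts the difference
      of \<open>u\<close> and \<open>v\<close>. Pairing it with \<open>u\<close> and with
      \<open>v\<close> gives values that differ by \<open>\<theta>(1)\<close>, which is
      nonzero.\<close>
    let ?w = "\<lambda>i\<in>{..<r}. if i = j then inv\<^bsub>F\<^esub> ?d else \<zero>\<^bsub>F\<^esub>"
    assume "u j \<noteq> v j"
    then have d: "?d \<in> Units F" using nth j F.field_Units by simp
    have w: "\<beta> ?w x = \<theta> (inv\<^bsub>F\<^esub> ?d \<otimes>\<^bsub>F\<^esub> x j)" if x: "x \<in> carrier (P r)" for x
    proof -
      have "\<theta> \<zero>\<^bsub>F\<^esub> = 0" using const[OF F.zero_closed, of 0] by simp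
      then have "\<beta> ?w x = (\<Sum>i<r. if i = j then \<theta> (inv\<^bsub>F\<^esub> ?d \<otimes>\<^bsub>F\<^esub> x j) else 0)"
        unfolding \<beta>_def using power_nth[OF x] by (intro sum.cong refl) auto
      then show ?thesis using j by simp
    qed
    have "?w \<in> carrier (P r)" using d by (auto simp: power_simps)
    then have "\<theta> (inv\<^bsub>F\<^esub> ?d \<otimes>\<^bsub>F\<^esub> u j) = \<theta> (inv\<^bsub>F\<^esub> ?d \<otimes>\<^bsub>F\<^esub> v j)" using eq w u v by metis
    moreover have "inv\<^bsub>F\<^esub> ?d \<otimes>\<^bsub>F\<^esub> u j = inv\<^bsub>F\<^esub> ?d \<otimes>\<^bsub>F\<^esub> (?d \<oplus>\<^bsub>F\<^esub> v j)"
      using nth j by (simp add: F.minus_eq F.a_assoc F.l_neg)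
    ultimately show False using d nth j one by (simp add: F.r_distr add)
  qed
  then show "u = v" using u v unfolding power_simps by (intro PiE_ext[of u "{..<r}"]) auto
qed

section \<open>Restriction of linear forms to the socle\<close>

context mpoly_module
begin

text \<open>The properties of the restriction map needed later: \<open>D\<close>-linear, onto, and
  with fibres determined by the values on the socle. The pairing by which it is built does not
  appear.\<close>

definition socle_restriction where
  "socle_restriction \<mm> r \<Phi> \<longleftrightarrow> \<Phi> \<in> module_hom D dual (copies \<mm> r) \<and>
    \<Phi> ` carrier dual = carrier (copies \<mm> r) \<and>
    (\<forall>f\<in>carrier dual. \<forall>g\<in>carrier dual. \<Phi> f = \<Phi> g \<longleftrightarrow> (\<forall>x\<in>soc \<mm>. f x = g x))"

lemma socle_restrictionD:
  assumes "socle_restriction \<mm> r \<Phi>"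
  shows "\<Phi> \<in> module_hom D dual (copies \<mm> r)" "\<Phi> ` carrier dual = carrier (copies \<mm> r)"
    "f \<in> carrier dual \<Longrightarrow> g \<in> carrier dual \<Longrightarrow> \<Phi> f = \<Phi> g \<longleftrightarrow> (\<forall>x\<in>soc \<mm>. f x = g x)"
  using assms unfolding socle_restriction_def by auto

lemma exists_socle_restriction:
  assumes fin: "k.fin_dim" and \<mm>: "maximalideal \<mm> D" and e: "e \<in> soc \<mm>" "e \<noteq> \<zero>"
    and r: "r = vectorspace.dim (D Quot \<mm>) (over_residue_field (Soc \<mm>))"
  shows "\<exists>\<Phi>. socle_restriction \<mm> r \<Phi>"
proof -
  let ?P = "carrier (copies \<mm> r)"
  note sub = maximalideal_subset[OF \<mm>]
  interpret dual: mpoly_module n dual by (rule mpoly_module_dual)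
  interpret S: killed_module n \<mm> "Soc \<mm>" by (rule killed_module_soc[OF \<mm>])
  interpret P: mpoly_module n "S.P r" by (rule S.mpoly_module_power)
  interpret soc: submodule D "soc \<mm>" M by (rule submodule_soc[OF sub])
  obtain T where T: "T \<in> module_hom D (S.P r) (Soc \<mm>)" "bij_betw T (?P) (carrier (Soc \<mm>))"
    using S.iso_power_if_fin_dim[OF fin_dim_soc[OF fin \<mm>]] unfolding r by blast
  define \<tau> where "\<tau> = inv_into (?P) T"
  have \<tau>: "\<tau> \<in> module_hom D (Soc \<mm>) (S.P r)" "bij_betw \<tau> (soc \<mm>) (?P)"
    unfolding \<tau>_def using module_hom_inv_into[OF T P.module_axioms] by simp_all
  have \<tau>c: "\<tau> x \<in> ?P" if "x \<in> soc \<mm>" for x using module_hom_closed[OF \<tau>(1)] that by auto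
  have \<tau>_add: "\<tau> (x \<oplus> y) = \<tau> x \<oplus>\<^bsub>S.P r\<^esub> \<tau> y" if "x \<in> soc \<mm>" "y \<in> soc \<mm>" for x y
    using module_hom_add[OF \<tau>(1), of x y] that by simp
  have \<tau>_smult: "\<tau> (p \<cdot> x) = p \<odot>\<^bsub>S.P r\<^esub> \<tau> x" if "p \<in> carrier D" "x \<in> soc \<mm>" for p x
    using module_hom_smult[OF \<tau>(1), of p x] that by simp
  have eM: "e \<in> carrier M" using e by (simp add: soc_def)
  \<comment> \<open>The form on \<open>F\<close> is \<open>l(p e)\<close> on the class of
    \<open>p\<close>. It is well defined because \<open>e\<close> is killed by \<open>\<mm>\<close>,
    and it is nonzero at 1 because \<open>l\<close> does not vanish at \<open>e\<close>.\<close>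
  obtain l where l: "l \<in> carrier dual" "l e \<noteq> 0" using functional_separates[OF fin eM e(2)] by blast
  define \<theta> where "\<theta> a = l ((SOME p. p \<in> a) \<cdot> e)" for a
  have \<theta>: "\<theta> (S.cls p) = l (p \<cdot> e)" if "p \<in> carrier D" for p
    unfolding \<theta>_def using S.act_eq_if_diff_mem[OF S.some_cls(1)[OF that] that S.some_cls(2)[OF that], of e] e by simp
  have \<theta>_add: "\<theta> (a \<oplus>\<^bsub>S.F\<^esub> b) = \<theta> a + \<theta> b" if a: "a \<in> carrier S.F" and b: "b \<in> carrier S.F" for a b
  proof -
    obtain p where p: "p \<in> carrier D" "a = S.cls p" using a by (rule S.carrier_FE)
    obtain q where q: "q \<in> carrier D" "b = S.cls q" using b by (rule S.carrier_FE)
    show ?thesis using p q eM l(1) by (simp add: S.cls_add \<theta> act_add functional_add)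
  qed
  have \<theta>_const: "\<theta> (S.cls (const c) \<otimes>\<^bsub>S.F\<^esub> a) = c * \<theta> a" if a: "a \<in> carrier S.F" for a c
  proof -
    obtain p where p: "p \<in> carrier D" "a = S.cls p" using a by (rule S.carrier_FE)
    show ?thesis using p eM l(1) by (simp add: S.cls_mult \<theta> act_mult functional_const)
  qed
  have "\<theta> \<one>\<^bsub>S.F\<^esub> \<noteq> 0" using \<theta>[of 1] eM l by (simp add: S.cls_1)
  then obtain \<beta> where \<beta>_commute: "\<And>u v. u \<in> ?P \<Longrightarrow> v \<in> ?P \<Longrightarrow> \<beta> u v = \<beta> v u"
    and \<beta>_add: "\<And>u v w. u \<in> ?P \<Longrightarrow> v \<in> ?P \<Longrightarrow> w \<in> ?P \<Longrightarrow> \<beta> u (v \<oplus>\<^bsub>S.P r\<^esub> w) = \<beta> u v + \<beta> u w"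
    and \<beta>_smult: "\<And>p u v. p \<in> carrier D \<Longrightarrow> u \<in> ?P \<Longrightarrow> v \<in> ?P \<Longrightarrow> \<beta> (p \<odot>\<^bsub>S.P r\<^esub> u) v = \<beta> u (p \<odot>\<^bsub>S.P r\<^esub> v)"
    and \<beta>_const: "\<And>a u v. u \<in> ?P \<Longrightarrow> v \<in> ?P \<Longrightarrow> \<beta> u (const a \<odot>\<^bsub>S.P r\<^esub> v) = a * \<beta> u v"
    and \<beta>_eqI: "\<And>u v. u \<in> ?P \<Longrightarrow> v \<in> ?P \<Longrightarrow> (\<And>w. w \<in> ?P \<Longrightarrow> \<beta> w u = \<beta> w v) \<Longrightarrow> u = v"
    using S.perfect_pairing[OF \<theta>_add \<theta>_const, where r = r] by blast
  obtain c where c: "finite c" "c \<subseteq> soc \<mm>" "k.span c = soc \<mm>"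
    using k.subspace_finite_basis[OF submodule_constants_if_submodule[OF submodule_soc[OF sub]] fin] by metis
  have cM: "c \<subseteq> carrier M" using c(2) soc.subset by auto
  have lc: "\<phi> (k.lincomb (\<lambda>v. const (a v)) c) = (\<Sum>v\<in>c. a v * \<phi> v)"
    if "\<And>x y. x \<in> soc \<mm> \<Longrightarrow> y \<in> soc \<mm> \<Longrightarrow> \<phi> (x \<oplus> y) = \<phi> x + \<phi> y"
      "\<And>a x. x \<in> soc \<mm> \<Longrightarrow> \<phi> (const a \<cdot> x) = a * \<phi> x" for \<phi> :: "'m \<Rightarrow> 'k" and a
    by (rule functional_lincomb[OF c(1) cM]) (use that c(3) in auto)
  have lcf: "f (k.lincomb (\<lambda>v. const (a v)) c) = (\<Sum>v\<in>c. a v * f v)" if "f \<in> carrier dual" for f a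
    using that soc.subset by (intro lc) (auto simp: functional_add functional_const subset_iff)
  have lc\<beta>: "\<beta> u (\<tau> (k.lincomb (\<lambda>v. const (a v)) c)) = (\<Sum>v\<in>c. a v * \<beta> u (\<tau> v))" if "u \<in> ?P" for u a
    using that \<tau>c by (intro lc[of "\<lambda>x. \<beta> u (\<tau> x)"]) (auto simp: \<tau>_add \<tau>_smult \<beta>_add \<beta>_const)
  have lc_mem: "k.lincomb (\<lambda>v. const (a v)) c \<in> soc \<mm>" for a
    using c(3) c(1) unfolding k.span_def by (auto intro!: exI[of _ c] exI[of _ "\<lambda>v. const (a v)"])
  have lc_ex: "\<exists>a. x = k.lincomb (\<lambda>v. const (a v)) c" if "x \<in> soc \<mm>" for x
    using span_eq_lincombs[OF c(1) cM] c(3) that by metis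
  \<comment> \<open>Every form restricted to the socle is pairing with some vector \<open>u\<close>.
    By the orthogonality criterion it suffices to test vectors of the socle whose image under
    \<open>\<tau>\<close> pairs to zero with everything; by nondegeneracy these are zero.\<close>
  have ex: "\<exists>u\<in>?P. \<forall>x\<in>soc \<mm>. f x = \<beta> u (\<tau> x)" if f: "f \<in> carrier dual" for f
  proof -
    let ?B = "(\<lambda>u x. \<beta> (\<tau> x) u) ` ?P"
    let ?b = "\<lambda>u x. if x \<in> soc \<mm> then \<beta> u (\<tau> x) else 0"
    let ?B = "?b ` ?P"
    have "\<exists>b\<in>?B. \<forall>x\<in>c. b x = f x"
    proof (rule mem_restriction_if_orthogonal[OF c(1)])
      show "?B \<noteq> {}" using P.M.zero_closed by blast
    next
      fix b b' assume "b \<in> ?B" "b' \<in> ?B"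
      then obtain u v where u: "u \<in> ?P" "b = ?b u"
        and v: "v \<in> ?P" "b' = ?b v" by auto
      have "\<beta> (u \<oplus>\<^bsub>S.P r\<^esub> v) (\<tau> x) = \<beta> u (\<tau> x) + \<beta> v (\<tau> x)" if "x \<in> soc \<mm>" for x
        using \<beta>_add[OF \<tau>c[OF that] u(1) v(1)] \<beta>_commute[OF \<tau>c[OF that]] u(1) v(1) by simp
      then show "(\<lambda>x. b x + b' x) \<in> ?B"
        using u v by (intro image_eqI[of _ _ "u \<oplus>\<^bsub>S.P r\<^esub> v"]) (auto simp: fun_eq_iff)
    next
      fix b a assume "b \<in> ?B"
      then obtain u where u: "u \<in> ?P" "b = ?b u" by auto
      have "\<beta> (const a \<odot>\<^bsub>S.P r\<^esub> u) (\<tau> x) = a * \<beta> u (\<tau> x)" if "x \<in> soc \<mm>" for x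
        using \<beta>_smult[OF const_closed u(1) \<tau>c[OF that]] \<beta>_const[OF u(1) \<tau>c[OF that]] by simp
      then show "(\<lambda>x. a * b x) \<in> ?B"
        using u by (intro image_eqI[of _ _ "const a \<odot>\<^bsub>S.P r\<^esub> u"]) (auto simp: fun_eq_iff)
    next
      fix a assume a: "\<And>b. b \<in> ?B \<Longrightarrow> (\<Sum>x\<in>c. a x * b x) = 0"
      let ?x = "k.lincomb (\<lambda>v. const (a v)) c"
      have "\<beta> u (\<tau> ?x) = 0" if u: "u \<in> ?P" for u
      proof -
        have "(\<Sum>x\<in>c. a x * \<beta> u (\<tau> x)) = (\<Sum>x\<in>c. a x * ?b u x)"
          using c(2) by (intro sum.cong) auto
        also have "\<dots> = 0" using u by (intro a) auto
        finally show ?thesis using lc\<beta>[OF u] by simp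
      qed
      then have "\<tau> ?x = \<zero>\<^bsub>S.P r\<^esub>"
        using \<beta>_const[OF _ P.M.zero_closed, of _ 0] by (intro \<beta>_eqI \<tau>c lc_mem) auto
      moreover have "\<tau> \<zero> = \<zero>\<^bsub>S.P r\<^esub>"
        using \<tau>_smult[OF poly_ring_closed_0_1(1) soc.zero_closed] \<tau>c[OF soc.zero_closed] by simp
      ultimately have "?x = \<zero>"
        using \<tau>(2) lc_mem[of a] soc.zero_closed unfolding bij_betw_def by (metis inj_onD)
      then show "(\<Sum>x\<in>c. a x * f x) = 0" using lcf[OF f, of a] f by simp
    qed
    then obtain u where u: "u \<in> ?P" "\<forall>x\<in>c. ?b u x = f x" by auto
    have "f x = \<beta> u (\<tau> x)" if x: "x \<in> soc \<mm>" for x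
    proof -
      obtain a where a: "x = k.lincomb (\<lambda>v. const (a v)) c" using lc_ex[OF x] by auto
      have "(\<Sum>v\<in>c. a v * f v) = (\<Sum>v\<in>c. a v * \<beta> u (\<tau> v))"
        using u(2) c(2) by (intro sum.cong refl) (auto simp: subset_iff)
      then show ?thesis unfolding a lcf[OF f] lc\<beta>[OF u(1)] .
    qed
    then show ?thesis using u(1) by blast
  qed
  define \<Phi> where "\<Phi> f = (SOME u. u \<in> ?P \<and> (\<forall>x\<in>soc \<mm>. f x = \<beta> u (\<tau> x)))" for f
  have \<Phi>: "\<Phi> f \<in> ?P" "\<And>x. x \<in> soc \<mm> \<Longrightarrow> f x = \<beta> (\<Phi> f) (\<tau> x)" if "f \<in> carrier dual" for f
    using someI_ex[of "\<lambda>u. u \<in> ?P \<and> (\<forall>x\<in>soc \<mm>. f x = \<beta> u (\<tau> x))"] ex[OF that]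
    unfolding \<Phi>_def by blast+
  \<comment> \<open>Nondegeneracy makes the representing vector unique; linearity of
    \<open>\<Phi>\<close> then follows by verifying a candidate value.\<close>
  have unique: "u = v" if u: "u \<in> ?P" and v: "v \<in> ?P" and eq: "\<And>x. x \<in> soc \<mm> \<Longrightarrow> \<beta> u (\<tau> x) = \<beta> v (\<tau> x)" for u v
  proof (rule \<beta>_eqI[OF u v])
    fix w assume w: "w \<in> ?P"
    then obtain x where "x \<in> soc \<mm>" "w = \<tau> x" using \<tau>(2) unfolding bij_betw_def by blast
    then show "\<beta> w u = \<beta> w v" using eq \<beta>_commute u v w by metis
  qed
  have \<Phi>I: "\<Phi> f = u" if "f \<in> carrier dual" "u \<in> ?P" "\<And>x. x \<in> soc \<mm> \<Longrightarrow> f x = \<beta> u (\<tau> x)" for f u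
    using \<Phi>[OF that(1)] that by (intro unique) auto
  show ?thesis
    unfolding socle_restriction_def
  proof (intro exI[of _ \<Phi>] conjI ballI)
    show "\<Phi> \<in> module_hom D dual (S.P r)"
      unfolding module_hom_def
    proof (intro CollectI conjI allI impI funcsetI)
      fix f g assume fg: "f \<in> carrier dual \<and> g \<in> carrier dual"
      have "(f \<oplus>\<^bsub>dual\<^esub> g) x = \<beta> (\<Phi> f \<oplus>\<^bsub>S.P r\<^esub> \<Phi> g) (\<tau> x)" if x: "x \<in> soc \<mm>" for x
      proof -
        have "\<beta> (\<Phi> f \<oplus>\<^bsub>S.P r\<^esub> \<Phi> g) (\<tau> x) = \<beta> (\<tau> x) (\<Phi> f) + \<beta> (\<tau> x) (\<Phi> g)"
          using \<beta>_commute[of "\<Phi> f \<oplus>\<^bsub>S.P r\<^esub> \<Phi> g" "\<tau> x"] \<beta>_add[of "\<tau> x" "\<Phi> f" "\<Phi> g"] \<Phi>(1) fg \<tau>c[OF x] by simp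
        also have "\<dots> = f x + g x"
          using \<Phi>[of f] \<Phi>[of g] fg x \<tau>c[OF x] \<beta>_commute[of "\<tau> x"] by simp
        finally show ?thesis using x soc.subset by auto
      qed
      then show "\<Phi> (f \<oplus>\<^bsub>dual\<^esub> g) = \<Phi> f \<oplus>\<^bsub>S.P r\<^esub> \<Phi> g" using fg \<Phi>(1) by (intro \<Phi>I) auto
    next
      fix p f assume pf: "p \<in> carrier D \<and> f \<in> carrier dual"
      have "(p \<odot>\<^bsub>dual\<^esub> f) x = \<beta> (p \<odot>\<^bsub>S.P r\<^esub> \<Phi> f) (\<tau> x)" if x: "x \<in> soc \<mm>" for x
      proof -
        have px: "p \<cdot> x \<in> soc \<mm>" using pf x by simp
        have "(p \<odot>\<^bsub>dual\<^esub> f) x = f (p \<cdot> x)" using x soc.subset by auto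
        also have "\<dots> = \<beta> (\<Phi> f) (p \<odot>\<^bsub>S.P r\<^esub> \<tau> x)" using \<Phi>(2)[of f, OF _ px] pf x by (simp add: \<tau>_smult)
        also have "\<dots> = \<beta> (p \<odot>\<^bsub>S.P r\<^esub> \<Phi> f) (\<tau> x)" using \<beta>_smult[of p "\<Phi> f" "\<tau> x"] pf \<Phi>(1) \<tau>c[OF x] by simp
        finally show ?thesis .
      qed
      then show "\<Phi> (p \<odot>\<^bsub>dual\<^esub> f) = p \<odot>\<^bsub>S.P r\<^esub> \<Phi> f" using pf \<Phi>(1) by (intro \<Phi>I) auto
    qed (use \<Phi>(1) in auto)
    show "\<Phi> ` carrier dual = ?P"
    proof
      show "\<Phi> ` carrier dual \<subseteq> ?P" using \<Phi>(1) by auto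
      show "?P \<subseteq> \<Phi> ` carrier dual"
      proof
        fix u assume u: "u \<in> ?P"
        obtain f where f: "f \<in> carrier dual" "\<And>x. x \<in> soc \<mm> \<Longrightarrow> f x = \<beta> u (\<tau> x)"
          by (rule functional_extension[OF fin submodule_constants_if_submodule[OF submodule_soc[OF sub]], of "\<lambda>x. \<beta> u (\<tau> x)"])
            (use u \<tau>c in \<open>auto simp: \<tau>_add \<tau>_smult \<beta>_add \<beta>_const\<close>)
        then show "u \<in> \<Phi> ` carrier dual" using \<Phi>I[OF f(1) u f(2)] by auto
      qed
    qed
    fix f g assume fg: "f \<in> carrier dual" "g \<in> carrier dual"
    show "\<Phi> f = \<Phi> g \<longleftrightarrow> (\<forall>x\<in>soc \<mm>. f x = g x)"
    proof
      assume "\<Phi> f = \<Phi> g"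
      then show "\<forall>x\<in>soc \<mm>. f x = g x" using \<Phi>(2)[OF fg(1)] \<Phi>(2)[OF fg(2)] by simp
    next
      assume "\<forall>x\<in>soc \<mm>. f x = g x"
      then show "\<Phi> f = \<Phi> g" using \<Phi>[OF fg(2)] by (intro \<Phi>I[OF fg(1)]) auto
    qed
  qed
qed

end

section \<open>Generators of the inverse system\<close>

lemma (in Module.module) quotient_module_hom:
  assumes Z: "submodule R Z M"
  shows "(\<lambda>x. Z +>\<^bsub>M\<^esub> x) \<in> module_hom R M (quotient_module M Z)"
    "(\<lambda>x. Z +>\<^bsub>M\<^esub> x) ` carrier M = carrier (quotient_module M Z)"
    "x \<in> carrier M \<Longrightarrow> y \<in> carrier M \<Longrightarrow> Z +>\<^bsub>M\<^esub> x = Z +>\<^bsub>M\<^esub> y \<longleftrightarrow> x \<ominus>\<^bsub>M\<^esub> y \<in> Z"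
proof -
  interpret Z: submodule R Z M by (rule Z)
  have neg: "\<ominus>\<^bsub>M\<^esub> z \<in> Z" if "z \<in> Z" for z
  proof -
    have z: "z \<in> carrier M" using that Z.subset by auto
    have "(\<ominus>\<^bsub>R\<^esub> \<one>\<^bsub>R\<^esub>) \<odot>\<^bsub>M\<^esub> z = \<ominus>\<^bsub>M\<^esub> z" using smult_l_minus[OF R.one_closed z] z by simp
    then show ?thesis using Z.smult_closed[OF R.a_inv_closed[OF R.one_closed] that] by simp
  qed
  have "abelian_subgroup Z M"
  proof (rule abelian_subgroupI3)
    show "additive_subgroup Z M"
      unfolding additive_subgroup_def
    proof (rule M.add.subgroupI)
      show "Z \<noteq> {}" using Z.zero_closed by blast
    qed (use Z.subset neg in auto)
    show "abelian_group M" by (rule M.abelian_group_axioms)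
  qed
  then interpret Zs: abelian_subgroup Z M .
  have eq: "Z +>\<^bsub>M\<^esub> x = Z +>\<^bsub>M\<^esub> y \<longleftrightarrow> x \<ominus>\<^bsub>M\<^esub> y \<in> Z"
    if "x \<in> carrier M" "y \<in> carrier M" for x y
  proof
    assume "Z +>\<^bsub>M\<^esub> x = Z +>\<^bsub>M\<^esub> y"
    then have "x \<in> Z +>\<^bsub>M\<^esub> y" using Zs.a_rcos_self[OF that(1)] by simp
    then obtain z where "z \<in> Z" "x = z \<oplus>\<^bsub>M\<^esub> y" unfolding a_r_coset_def' by auto
    then show "x \<ominus>\<^bsub>M\<^esub> y \<in> Z" using that Z.subset by (auto simp: a_minus_def M.a_assoc M.r_neg)
  next
    assume z: "x \<ominus>\<^bsub>M\<^esub> y \<in> Z"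
    have "x = (x \<ominus>\<^bsub>M\<^esub> y) \<oplus>\<^bsub>M\<^esub> y" using that by (simp add: a_minus_def M.a_assoc M.l_neg)
    then have "x \<in> Z +>\<^bsub>M\<^esub> y" using z unfolding a_r_coset_def' by blast
    then show "Z +>\<^bsub>M\<^esub> x = Z +>\<^bsub>M\<^esub> y" using that Zs.a_repr_independence' by metis
  qed
  then show "x \<in> carrier M \<Longrightarrow> y \<in> carrier M \<Longrightarrow> Z +>\<^bsub>M\<^esub> x = Z +>\<^bsub>M\<^esub> y \<longleftrightarrow> x \<ominus>\<^bsub>M\<^esub> y \<in> Z" .
  show img: "(\<lambda>x. Z +>\<^bsub>M\<^esub> x) ` carrier M = carrier (quotient_module M Z)"
    by (auto simp: quotient_module_def A_RCOSETS_def' )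
  show "(\<lambda>x. Z +>\<^bsub>M\<^esub> x) \<in> module_hom R M (quotient_module M Z)"
    unfolding module_hom_def
  proof (intro CollectI conjI allI impI)
    show "(\<lambda>x. Z +>\<^bsub>M\<^esub> x) \<in> carrier M \<rightarrow> carrier (quotient_module M Z)" using img by auto
    fix x y assume "x \<in> carrier M \<and> y \<in> carrier M"
    then show "Z +>\<^bsub>M\<^esub> (x \<oplus>\<^bsub>M\<^esub> y) = (Z +>\<^bsub>M\<^esub> x) \<oplus>\<^bsub>quotient_module M Z\<^esub> (Z +>\<^bsub>M\<^esub> y)"
      by (simp add: quotient_module_def Zs.a_rcos_sum)
  next
    fix p x assume px: "p \<in> carrier R \<and> x \<in> carrier M"
    have "Z +>\<^bsub>M\<^esub> (p \<odot>\<^bsub>M\<^esub> y) = Z +>\<^bsub>M\<^esub> (p \<odot>\<^bsub>M\<^esub> x)" if y: "y \<in> Z +>\<^bsub>M\<^esub> x" for y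
    proof -
      obtain z where z: "z \<in> Z" "y = z \<oplus>\<^bsub>M\<^esub> x" using y unfolding a_r_coset_def' by auto
      have zM: "z \<in> carrier M" using z Z.subset by auto
      have "p \<odot>\<^bsub>M\<^esub> y \<ominus>\<^bsub>M\<^esub> p \<odot>\<^bsub>M\<^esub> x = p \<odot>\<^bsub>M\<^esub> z"
        using z zM px by (simp add: smult_r_distr a_minus_def M.a_assoc M.r_neg)
      then show ?thesis using z zM px eq by simp
    qed
    moreover have "x \<in> Z +>\<^bsub>M\<^esub> x" using px Zs.a_rcos_self by blast
    ultimately have "(\<Union>y\<in>Z +>\<^bsub>M\<^esub> x. Z +>\<^bsub>M\<^esub> (p \<odot>\<^bsub>M\<^esub> y)) = Z +>\<^bsub>M\<^esub> (p \<odot>\<^bsub>M\<^esub> x)" by blast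
    then show "Z +>\<^bsub>M\<^esub> (p \<odot>\<^bsub>M\<^esub> x) = p \<odot>\<^bsub>quotient_module M Z\<^esub> (Z +>\<^bsub>M\<^esub> x)"
      by (simp add: quotient_module_def)
  qed
qed

lemma module_hom_comp:
  "f \<in> module_hom A M N \<Longrightarrow> g \<in> module_hom A N N' \<Longrightarrow> g \<circ> f \<in> module_hom A M N'"
  unfolding module_hom_def by (auto simp: Pi_iff)

section \<open>The top, and bounds for the number of generators\<close>

context mpoly_module
begin

lemma ideal_smult_dual:
  assumes fin: "k.fin_dim" and \<mm>: "maximalideal \<mm> D"
  shows "ideal_smult D \<mm> dual = {f \<in> carrier dual. \<forall>x\<in>soc \<mm>. f x = 0}"
proof -
  interpret dual: mpoly_module n dual by (rule mpoly_module_dual)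
  note sub = maximalideal_subset[OF \<mm>]
  interpret soc: submodule D "soc \<mm>" M by (rule submodule_soc[OF sub])
  let ?G = "{p \<odot>\<^bsub>dual\<^esub> f | p f. p \<in> \<mm> \<and> f \<in> carrier dual}"
  let ?Z = "{f \<in> carrier dual. \<forall>x\<in>soc \<mm>. f x = 0}"
  have G: "?G \<subseteq> carrier dual" using sub by auto
  have socM: "x \<in> carrier M" if "x \<in> soc \<mm>" for x using that soc.subset by auto
  have Z: "submodule D ?Z dual"
    unfolding submodule_def by (auto simp: dual.module_axioms socM)
  have "dual.span ?G \<subseteq> ?Z"
  proof (rule dual.span_is_subset[OF _ Z])
    show "?G \<subseteq> ?Z"
    proof
      fix h assume "h \<in> ?G"
      then obtain p f where h: "h = p \<odot>\<^bsub>dual\<^esub> f" "p \<in> \<mm>" "f \<in> carrier dual" by auto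
      have "h x = 0" if x: "x \<in> soc \<mm>" for x using h x socM[OF x] by (simp add: soc_def)
      then show "h \<in> ?Z" using h sub by auto
    qed
  qed
  moreover have "f \<in> dual.span ?G" if f: "f \<in> ?Z" for f
  proof (rule dual_mem_if_orthogonal[OF fin])
    show "submodule D (dual.span ?G) dual" by (rule dual.span_is_submodule[OF G])
    show "f \<in> carrier dual" using f by auto
    \<comment> \<open>Let \<open>x\<close> be orthogonal to all products \<open>p h\<close>. Then
      \<open>h(p x) = 0\<close> for every form \<open>h\<close>, so \<open>p x = 0\<close> by
      separation, and \<open>x\<close> lies in the socle component where \<open>f\<close>
      vanishes.\<close>
    fix x assume x: "x \<in> carrier M" and orth: "\<And>u. u \<in> dual.span ?G \<Longrightarrow> u x = 0"
    have "p \<cdot> x = \<zero>" if p: "p \<in> \<mm>" for p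
    proof (rule ccontr)
      assume nz: "p \<cdot> x \<noteq> \<zero>"
      have "p \<cdot> x \<in> carrier M" using p sub x by auto
      then obtain h where h: "h \<in> carrier dual" "h (p \<cdot> x) \<noteq> 0" using functional_separates[OF fin _ nz] by metis
      have "p \<odot>\<^bsub>dual\<^esub> h \<in> dual.span ?G" using dual.in_own_span[OF G] p h(1) by blast
      then show False using orth[of "p \<odot>\<^bsub>dual\<^esub> h"] h(2) x by simp
    qed
    then show "f x = 0" using x f by (simp add: soc_def)
  qed
  ultimately show ?thesis unfolding ideal_smult_def by blast
qed

text \<open>The projection onto the top and the restriction map \<open>\<Phi>\<close> have the same
  fibres, since both identify forms that agree on the socle component. The exponent is unique
  because powers of \<open>F\<close> are distinguished by dimension.\<close>

lemma num_isotypical_top: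
  assumes fin: "k.fin_dim" and \<mm>: "maximalideal \<mm> D"
    and \<Phi>: "socle_restriction \<mm> r \<Phi>"
  shows "num_isotypical D \<mm> (top_component D \<mm> dual) = enat r"
proof -
  note \<Phi> = socle_restrictionD[OF \<Phi>]
  interpret dual: mpoly_module n dual by (rule mpoly_module_dual)
  interpret residue_field n \<mm> by (rule residue_field.intro[OF \<mm>])
  have sub: "\<mm> \<subseteq> carrier D" using mm_closed by auto
  interpret soc: submodule D "soc \<mm>" M by (rule submodule_soc[OF sub])
  have socM: "x \<in> carrier M" if "x \<in> soc \<mm>" for x using that soc.subset by auto
  let ?Z = "ideal_smult D \<mm> dual"
  note Z_eq = ideal_smult_dual[OF fin \<mm>]
  have Z: "submodule D ?Z dual"
    unfolding Z_eq submodule_def by (auto simp: dual.module_axioms socM)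
  have top: "top_component D \<mm> dual = quotient_module dual ?Z" by (simp add: top_component_def)
  let ?c = "\<lambda>f. ?Z +>\<^bsub>dual\<^esub> f"
  note c = dual.quotient_module_hom[OF Z, folded top]
  have c_eq: "?c f = ?c g \<longleftrightarrow> \<Phi> f = \<Phi> g" if fg: "f \<in> carrier dual" "g \<in> carrier dual" for f g
  proof -
    have "(f \<ominus>\<^bsub>dual\<^esub> g) x = f x - g x" if "x \<in> carrier M" for x
    proof -
      have "f = (f \<ominus>\<^bsub>dual\<^esub> g) \<oplus>\<^bsub>dual\<^esub> g" using fg by (simp add: a_minus_def dual.M.a_assoc dual.M.l_neg)
      then have "f x = (f \<ominus>\<^bsub>dual\<^esub> g) x + g x" using dual_add_apply[OF that] by metis
      then show ?thesis by simp
    qed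
    then have "f \<ominus>\<^bsub>dual\<^esub> g \<in> ?Z \<longleftrightarrow> (\<forall>x\<in>soc \<mm>. f x = g x)" unfolding Z_eq using fg socM by auto
    then show ?thesis using c(3)[OF fg] \<Phi>(3)[OF fg] by blast
  qed
  have "module_isomorphic D (top_component D \<mm> dual) (P s) \<longleftrightarrow> s = r" for s
  proof
    assume "module_isomorphic D (top_component D \<mm> dual) (P s)"
    then obtain h where h: "h \<in> module_hom D (top_component D \<mm> dual) (P s)"
      "h ` carrier (top_component D \<mm> dual) = carrier (P s)" "inj_on h (carrier (top_component D \<mm> dual))"
      by (rule module_isomorphicE)
    have "module_isomorphic D (P s) (P r)"
    proof (rule module_isomorphic_if_same_kernel[OF dual.module_axioms module_hom_comp[OF c(1) h(1)] _ \<Phi>(1,2)])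
      show "(h \<circ> ?c) ` carrier dual = carrier (P s)" unfolding image_comp[symmetric] c(2) h(2) ..
      fix f g assume fg: "f \<in> carrier dual" "g \<in> carrier dual"
      then have "?c f \<in> carrier (top_component D \<mm> dual)" "?c g \<in> carrier (top_component D \<mm> dual)"
        using c(2) by blast+
      then show "(h \<circ> ?c) f = (h \<circ> ?c) g \<longleftrightarrow> \<Phi> f = \<Phi> g"
        using inj_on_eq_iff[OF h(3)] c_eq[OF fg] by simp
    qed
    then show "s = r" by (rule isomorphic_powers_eq)
  next
    assume "s = r"
    then show "module_isomorphic D (top_component D \<mm> dual) (P s)"
      using module_isomorphic_if_same_kernel[OF dual.module_axioms c(1,2) \<Phi>(1,2) c_eq] by blast
  qed
  then show ?thesis unfolding num_isotypical_def by simp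
qed

text \<open>The targets are killed by distinct maximal ideals, so prescribed values can be attained
  independently of one another. This is stated for an arbitrary \<open>M\<close> and applied to the
  inverse system.\<close>

lemma exists_simultaneous_preimage:
  assumes "finite \<A>" "\<And>\<mm>. \<mm> \<in> \<A> \<Longrightarrow> maximalideal \<mm> D"
    and "\<And>\<mm>. \<mm> \<in> \<A> \<Longrightarrow> \<Phi> \<mm> \<in> module_hom D M (copies \<mm> (r \<mm>))"
    and "\<And>\<mm>. \<mm> \<in> \<A> \<Longrightarrow> y \<mm> \<in> \<Phi> \<mm> ` carrier M"
  shows "\<exists>u\<in>carrier M. \<forall>\<mm>\<in>\<A>. \<Phi> \<mm> u = y \<mm>"
  using assms
proof (induct \<A>)
  case empty
  then show ?case using M.zero_closed by blast
next
  case (insert \<mm> \<A>)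
  then obtain u where u: "u \<in> carrier M" "\<And>\<nn>. \<nn> \<in> \<A> \<Longrightarrow> \<Phi> \<nn> u = y \<nn>" by auto
  obtain w where w: "w \<in> carrier M" "\<Phi> \<mm> w = y \<mm>" using insert(6)[of \<mm>] by auto
  obtain s where s: "s \<in> carrier D" "1 - s \<in> \<mm>" "\<And>\<nn>. \<nn> \<in> \<A> \<Longrightarrow> s \<in> \<nn>"
    by (rule maximalideal_separating[of \<A> n \<mm>]) (use insert in auto)
  \<comment> \<open>Modulo the new ideal \<open>\<mm>\<close>, \<open>s\<close> is 1 and only
    \<open>w\<close> is seen; modulo the earlier ideals \<open>s\<close> is 0 and only
    \<open>u\<close> is seen.\<close>
  let ?u = "(1 - s) \<cdot> u \<oplus> s \<cdot> w"
  have hom: "\<Phi> \<nn> ?u = (1 - s) \<odot>\<^bsub>copies \<nn> (r \<nn>)\<^esub> \<Phi> \<nn> u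
      \<oplus>\<^bsub>copies \<nn> (r \<nn>)\<^esub> s \<odot>\<^bsub>copies \<nn> (r \<nn>)\<^esub> \<Phi> \<nn> w"
    and mem: "\<Phi> \<nn> u \<in> carrier (copies \<nn> (r \<nn>))"
      "\<Phi> \<nn> w \<in> carrier (copies \<nn> (r \<nn>))" if "\<nn> \<in> insert \<mm> \<A>" for \<nn>
    using insert(5)[OF that] u(1) w(1) s(1) by (auto simp: module_hom_add module_hom_smult dest: module_hom_closed)
  have "\<Phi> \<nn> ?u = y \<nn>" if n: "\<nn> \<in> insert \<mm> \<A>" for \<nn>
  proof -
    interpret R: residue_field n \<nn> by (rule residue_field.intro[OF insert(4)[OF n]])
    interpret N: killed_module n \<nn> "R.P (r \<nn>)" by (rule R.killed_module_power)
    show ?thesis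
    proof (cases "\<nn> = \<mm>")
      case True
      have "(1 - s) \<odot>\<^bsub>R.P (r \<nn>)\<^esub> \<Phi> \<nn> u = \<zero>\<^bsub>R.P (r \<nn>)\<^esub>" using N.killed mem[OF n] s True by simp
      moreover have "s \<odot>\<^bsub>R.P (r \<nn>)\<^esub> \<Phi> \<nn> w = 1 \<odot>\<^bsub>R.P (r \<nn>)\<^esub> \<Phi> \<nn> w"
        using N.act_eq_if_diff_mem[of 1 s "\<Phi> \<nn> w"] mem[OF n] s True by simp
      ultimately have "\<Phi> \<nn> ?u = \<Phi> \<nn> w" unfolding hom[OF n] using mem[OF n] by simp
      then show ?thesis using w(2) True by simp
    next
      case False
      then have nA: "\<nn> \<in> \<A>" using n by auto
      have "s \<odot>\<^bsub>R.P (r \<nn>)\<^esub> \<Phi> \<nn> w = \<zero>\<^bsub>R.P (r \<nn>)\<^esub>" using N.killed mem[OF n] s(3)[OF nA] by simp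
      moreover have "(1 - s) \<odot>\<^bsub>R.P (r \<nn>)\<^esub> \<Phi> \<nn> u = 1 \<odot>\<^bsub>R.P (r \<nn>)\<^esub> \<Phi> \<nn> u"
      proof (rule N.act_eq_if_diff_mem)
        have "- s = (- 1) * s" by simp
        also have "\<dots> \<in> \<nn>" using ideal.I_l_closed[OF R.ideal_mm s(3)[OF nA], of "- 1"] by simp
        finally show "1 - s - 1 \<in> \<nn>" by simp
      qed (use s mem[OF n] in auto)
      ultimately show ?thesis unfolding hom[OF n] using mem[OF n] u(2)[OF nA] by simp
    qed
  qed
  then show ?case using u w s by (intro bexI[of _ ?u]) auto
qed

lemma card_generators_ge:
  assumes \<mm>: "maximalideal \<mm> D"
    and \<Phi>: "\<Phi> \<in> module_hom D M (copies \<mm> r)"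
      "\<Phi> ` carrier M = carrier (copies \<mm> r)"
    and S: "finite S" "S \<subseteq> carrier M" "span S = carrier M"
  shows "r \<le> card S"
proof -
  interpret residue_field n \<mm> by (rule residue_field.intro[OF \<mm>])
  interpret N: killed_module n \<mm> "P r" by (rule killed_module_power)
  have \<Phi>S: "\<Phi> ` S \<subseteq> carrier N.V" using \<Phi>(2) S(2) by auto
  interpret sp: submodule F "N.V.span (\<Phi> ` S)" N.V by (rule N.V.span_is_submodule[OF \<Phi>S])
  let ?H = "{x \<in> carrier M. \<Phi> x \<in> N.V.span (\<Phi> ` S)}"
  have \<Phi>c: "\<Phi> x \<in> carrier (P r)" if "x \<in> carrier M" for x using module_hom_closed[OF \<Phi>(1)] that by auto
  have sm: "\<Phi> (p \<cdot> x) = cls p \<odot>\<^bsub>N.V\<^esub> \<Phi> x" if "p \<in> carrier D" "x \<in> carrier M" for p x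
    using module_hom_smult[OF \<Phi>(1)] that \<Phi>c by (simp add: N.V_smult)
  have "submodule D ?H M"
    unfolding submodule_def
  proof (intro conjI allI impI)
    show "Module.module D M" by (rule module_axioms)
    fix v w assume "v \<in> ?H" "w \<in> ?H"
    then show "v \<oplus> w \<in> ?H" using module_hom_add[OF \<Phi>(1), of v w] sp.m_closed[of "\<Phi> v" "\<Phi> w"] by simp
  next
    have "\<Phi> \<zero> = \<Phi> (0 \<cdot> \<zero>)" by simp
    also have "\<dots> = \<zero>\<^bsub>N.V\<^esub>"
      using module_hom_smult[OF \<Phi>(1) poly_ring_closed_0_1(1) M.zero_closed] \<Phi>c[OF M.zero_closed] by simp
    finally show "\<zero> \<in> ?H" using sp.zero_closed by simp
  next
    fix p v assume "p \<in> carrier D" "v \<in> ?H"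
    then show "p \<cdot> v \<in> ?H" using sm[of p v] sp.smult_closed[of "cls p" "\<Phi> v"] by simp
  qed auto
  then have "span S \<subseteq> ?H"
    using S(2) N.V.in_own_span[OF \<Phi>S] by (intro span_is_subset) auto
  then have "carrier (P r) \<subseteq> N.V.span (\<Phi> ` S)" unfolding \<Phi>(2)[symmetric] S(3) by blast
  then have "N.V.span (\<Phi> ` S) = carrier N.V" using sp.subset by auto
  then have "N.V.dim \<le> card (\<Phi> ` S)" using N.V.gen_ge_dim[OF _ \<Phi>S] S(1) by simp
  then show ?thesis using card_image_le[OF S(1), of \<Phi>] dim_power(2)[of r] by simp
qed

lemma dual_generated:
  assumes fin: "k.fin_dim"
    and \<Phi>: "\<And>\<mm>. \<mm> \<in> ass D M \<Longrightarrow> socle_restriction \<mm> (r \<mm>) (\<Phi> \<mm>)"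
    and g: "\<And>\<mm>. \<mm> \<in> ass D M \<Longrightarrow> r \<mm> \<le> g"
  shows "\<exists>S. finite S \<and> S \<subseteq> carrier dual \<and> module.span D dual S = carrier dual \<and> card S \<le> g"
proof -
  note \<Phi> = socle_restrictionD[OF \<Phi>]
  interpret dual: mpoly_module n dual by (rule mpoly_module_dual)
  have max: "maximalideal \<mm> D" if "\<mm> \<in> ass D M" for \<mm> using ass_maximal[OF fin that] by metis
  \<comment> \<open>The \<open>j\<close>-th generator goes to the \<open>j\<close>-th unit vector
    for all associated primes at once, and to zero for those with
    \<open>r \<mm> \<le> j\<close>.\<close>
  have "\<exists>u\<in>carrier dual. \<forall>\<mm>\<in>ass D M. \<Phi> \<mm> u = residue_field.unit_vector n \<mm> (r \<mm>) j" for j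
  proof (rule dual.exists_simultaneous_preimage[OF finite_ass[OF fin] max \<Phi>(1)])
    fix \<mm> assume m: "\<mm> \<in> ass D M"
    interpret residue_field n \<mm> by (rule residue_field.intro[OF max[OF m]])
    show "unit_vector (r \<mm>) j \<in> \<Phi> \<mm> ` carrier dual" unfolding \<Phi>(2)[OF m] by (rule unit_vector_closed)
  qed
  then obtain u where u: "\<And>j. u j \<in> carrier dual"
    "\<And>j \<mm>. \<mm> \<in> ass D M \<Longrightarrow> \<Phi> \<mm> (u j) = residue_field.unit_vector n \<mm> (r \<mm>) j" by metis
  let ?S = "u ` {..<g}"
  let ?N = "dual.span ?S"
  have S: "?S \<subseteq> carrier dual" using u by auto
  have N: "submodule D ?N dual" by (rule dual.span_is_submodule[OF S])
  interpret N: submodule D ?N dual by (rule N)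
  \<comment> \<open>On each socle component, every form agrees with a member of the submodule
    generated so far: \<open>j < r \<mm>\<close> implies \<open>j < g\<close>, so all unit vectors
    are reached.\<close>
  have cover: "\<exists>\<nu>\<in>?N. \<Phi> \<mm> \<nu> = \<Phi> \<mm> f" if m: "\<mm> \<in> ass D M" and f: "f \<in> carrier dual" for \<mm> f
  proof -
    interpret residue_field n \<mm> by (rule residue_field.intro[OF max[OF m]])
    interpret P: mpoly_module n "P (r \<mm>)" by (rule mpoly_module_power)
    have "mod_hom D dual (P (r \<mm>)) (\<Phi> \<mm>)"
      by (intro mod_hom.intro mod_hom_axioms.intro \<Phi>(1)[OF m] dual.module_axioms P.module_axioms)
    then interpret \<Phi>: mod_hom D dual "P (r \<mm>)" "\<Phi> \<mm>" .
    have "\<Phi> \<mm> ` ?N = carrier (P (r \<mm>))"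
    proof (rule submodule_power_eq_if_unit_vectors)
      show "submodule D (\<Phi> \<mm> ` ?N) (P (r \<mm>))"
        unfolding submodule_def
      proof (intro conjI allI impI)
        show "Module.module D (P (r \<mm>))" by (rule P.module_axioms)
        show "\<Phi> \<mm> ` ?N \<subseteq> carrier (P (r \<mm>))" using N.subset by auto
        show "\<zero>\<^bsub>P (r \<mm>)\<^esub> \<in> \<Phi> \<mm> ` ?N" using \<Phi>.f0_is_0 N.zero_closed by (metis imageI)
      next
        fix v w assume "v \<in> \<Phi> \<mm> ` ?N" "w \<in> \<Phi> \<mm> ` ?N"
        then obtain v' w' where "v' \<in> ?N" "v = \<Phi> \<mm> v'" "w' \<in> ?N" "w = \<Phi> \<mm> w'" by blast
        moreover have "v' \<in> carrier dual" "w' \<in> carrier dual" using calculation N.subset by blast+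
        ultimately have "v \<oplus>\<^bsub>P (r \<mm>)\<^esub> w = \<Phi> \<mm> (v' \<oplus>\<^bsub>dual\<^esub> w')" "v' \<oplus>\<^bsub>dual\<^esub> w' \<in> ?N" by simp_all
        then show "v \<oplus>\<^bsub>P (r \<mm>)\<^esub> w \<in> \<Phi> \<mm> ` ?N" by blast
      next
        fix p v assume p: "p \<in> carrier D" and "v \<in> \<Phi> \<mm> ` ?N"
        then obtain v' where "v' \<in> ?N" "v = \<Phi> \<mm> v'" by blast
        moreover have "v' \<in> carrier dual" using calculation N.subset by blast
        ultimately have "p \<odot>\<^bsub>P (r \<mm>)\<^esub> v = \<Phi> \<mm> (p \<odot>\<^bsub>dual\<^esub> v')" "p \<odot>\<^bsub>dual\<^esub> v' \<in> ?N" using p by simp_all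
        then show "p \<odot>\<^bsub>P (r \<mm>)\<^esub> v \<in> \<Phi> \<mm> ` ?N" by blast
      qed
      fix j assume "j < r \<mm>"
      then have "u j \<in> ?N" using g[OF m] dual.in_own_span[OF S] by auto
      then show "unit_vector (r \<mm>) j \<in> \<Phi> \<mm> ` ?N" using u(2)[OF m, of j] by (metis imageI)
    qed
    then have "\<Phi> \<mm> f \<in> \<Phi> \<mm> ` ?N" using f \<Phi>(2)[OF m] by blast
    then show ?thesis by (metis imageE)
  qed
  \<comment> \<open>A nonzero \<open>x\<close> has a nonzero multiple \<open>y = p x\<close> in some
    socle component. A form with \<open>f(y)\<close> nonzero can be replaced there by a member
    \<open>\<nu>\<close> of \<open>?N\<close>; but \<open>\<nu>(y)\<close> is the value at
    \<open>x\<close> of \<open>p \<nu>\<close>, again in \<open>?N\<close>, hence 0.\<close>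
  have zero: "x = \<zero>" if x: "x \<in> carrier M" and orth: "\<And>\<nu>. \<nu> \<in> ?N \<Longrightarrow> \<nu> x = 0" for x
  proof (rule ccontr)
    assume x0: "x \<noteq> \<zero>"
    obtain y where y: "y \<in> cyclic_submodule D M x" "y \<noteq> \<zero>" "maximalideal (annihilator D M {y}) D"
      using exists_maximal_annihilator[OF fin submodule_cyclic[OF x] mem_cyclic[OF x] x0] by blast
    obtain p where p: "p \<in> carrier D" "y = p \<cdot> x" using y(1) unfolding cyclic_submodule_def by auto
    have yM: "y \<in> carrier M" using p x by simp
    let ?m = "annihilator D M {y}"
    have m: "?m \<in> ass D M" by (rule maximal_annihilator_in_ass[OF yM y(3)])
    have ys: "y \<in> soc ?m" using yM by (simp add: soc_def annihilator_def)
    obtain f where f: "f \<in> carrier dual" "f y \<noteq> 0" using functional_separates[OF fin yM y(2)] by blast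
    obtain \<nu> where \<nu>: "\<nu> \<in> ?N" "\<Phi> ?m \<nu> = \<Phi> ?m f" using cover[OF m f(1)] by blast
    have "\<nu> \<in> carrier dual" using \<nu>(1) N.subset by blast
    then have "\<nu> y = f y" using \<Phi>(3)[OF m _ f(1)] \<nu>(2) ys by blast
    moreover have "p \<odot>\<^bsub>dual\<^esub> \<nu> \<in> ?N" using p \<nu>(1) by simp
    then have "\<nu> y = 0" using orth[of "p \<odot>\<^bsub>dual\<^esub> \<nu>"] x p(2) by simp
    ultimately show False using f(2) by simp
  qed
  have "f \<in> ?N" if f: "f \<in> carrier dual" for f
  proof (rule dual_mem_if_orthogonal[OF fin N f])
    fix x assume "x \<in> carrier M" "\<And>u. u \<in> ?N \<Longrightarrow> u x = 0"
    then have "x = \<zero>" by (rule zero)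
    then show "f x = 0" using f by simp
  qed
  then have "?N = carrier dual" using N.subset by auto
  moreover have "card ?S \<le> g" using card_image_le[of "{..<g}" u] by simp
  ultimately show ?thesis using S by (intro exI[of _ ?S]) simp
qed

text \<open>The lower bound comes from each associated prime separately, the upper bound from
  generating all the tops simultaneously. Natural numbers \<open>r\<close> carry the counts, so that
  every quantity is visibly finite before the \<open>enat\<close>-valued maximum is taken.\<close>

theorem min_generators_dual:
  assumes fin: "k.fin_dim" and nz: "carrier M \<noteq> {\<zero>}"
  obtains r where
    "\<And>\<mm>. \<mm> \<in> ass D M \<Longrightarrow> num_isotypical D \<mm> (soc_component D \<mm> M) = enat (r \<mm>)"
    "\<And>\<mm>. \<mm> \<in> ass D M \<Longrightarrow> residue_dim D \<mm> (soc_component D \<mm> M) = enat (r \<mm>)"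
    "\<And>\<mm>. \<mm> \<in> ass D M \<Longrightarrow> num_isotypical D \<mm> (top_component D \<mm> dual) = enat (r \<mm>)"
    "min_generators D dual = (MAX \<mm>\<in>ass D M. enat (r \<mm>))"
proof -
  interpret dual: mpoly_module n dual by (rule mpoly_module_dual)
  define r where "r \<mm> = vectorspace.dim (D Quot \<mm>) (over_residue_field (Soc \<mm>))" for \<mm>
  have max: "maximalideal \<mm> D" if "\<mm> \<in> ass D M" for \<mm> using ass_maximal[OF fin that] by metis
  have "\<exists>\<Phi>. socle_restriction \<mm> (r \<mm>) \<Phi>" if m: "\<mm> \<in> ass D M" for \<mm>
  proof -
    obtain e where e: "e \<in> carrier M" "e \<noteq> \<zero>" "\<mm> = annihilator D M {e}" using ass_maximal[OF fin m] by metis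
    have "e \<in> soc \<mm>" using e(1) unfolding e(3) by (simp add: soc_def annihilator_def)
    then show ?thesis by (rule exists_socle_restriction[OF fin max[OF m] _ e(2) r_def])
  qed
  then obtain \<Phi> where \<Phi>: "\<And>\<mm>. \<mm> \<in> ass D M \<Longrightarrow> socle_restriction \<mm> (r \<mm>) (\<Phi> \<mm>)" by metis
  have fa: "finite (ass D M)" and ne: "ass D M \<noteq> {}" using finite_ass[OF fin] ass_nonempty[OF fin nz] by auto
  show ?thesis
  proof (rule that)
    fix \<mm> assume m: "\<mm> \<in> ass D M"
    interpret S: killed_module n \<mm> "Soc \<mm>" by (rule killed_module_soc[OF max[OF m]])
    have fd: "S.V.fin_dim" by (rule fin_dim_soc[OF fin max[OF m]])
    show "num_isotypical D \<mm> (soc_component D \<mm> M) = enat (r \<mm>)"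
      unfolding soc_component_eq[OF max[OF m]] r_def by (rule S.num_isotypical_eq_dim[OF fd])
    show "residue_dim D \<mm> (soc_component D \<mm> M) = enat (r \<mm>)"
      unfolding soc_component_eq[OF max[OF m]] r_def by (rule S.residue_dim_eq_dim[OF fd])
    show "num_isotypical D \<mm> (top_component D \<mm> dual) = enat (r \<mm>)"
      by (rule num_isotypical_top[OF fin max[OF m] \<Phi>[OF m]])
  next
    show "min_generators D dual = (MAX \<mm>\<in>ass D M. enat (r \<mm>))"
    proof (rule antisym)
      \<comment> \<open>An associated prime attaining the maximum exists because there are finitely
        many and at least one; its \<open>r\<close> is the number of generators to be
        achieved.\<close>
      have "Max (r ` ass D M) \<in> r ` ass D M" using fa ne by simp
      then obtain \<nn> where \<nn>: "\<nn> \<in> ass D M" "r \<nn> = Max (r ` ass D M)" by auto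
      have le: "r \<mm> \<le> r \<nn>" if "\<mm> \<in> ass D M" for \<mm> using that fa \<nn>(2) by simp
      have "\<exists>S. finite S \<and> S \<subseteq> carrier dual \<and> dual.span S = carrier dual \<and> card S \<le> r \<nn>"
        by (rule dual_generated[OF fin]) (fact \<Phi> le)+
      then obtain S where S: "finite S" "S \<subseteq> carrier dual" "dual.span S = carrier dual" "card S \<le> r \<nn>"
        by blast
      have "min_generators D dual \<le> enat (card S)"
        unfolding min_generators_def using S by (intro INF_lower) auto
      also have "\<dots> \<le> enat (r \<nn>)" using S by simp
      also have "\<dots> \<le> (MAX \<mm>\<in>ass D M. enat (r \<mm>))" using \<nn>(1) fa by (intro Max_ge) auto
      finally show "min_generators D dual \<le> (MAX \<mm>\<in>ass D M. enat (r \<mm>))" .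
      show "(MAX \<mm>\<in>ass D M. enat (r \<mm>)) \<le> min_generators D dual"
        unfolding min_generators_def
      proof (rule INF_greatest)
        fix S assume S: "S \<in> {S. finite S \<and> S \<subseteq> carrier dual \<and> dual.span S = carrier dual}"
        have "r \<mm> \<le> card S" if m: "\<mm> \<in> ass D M" for \<mm>
          using dual.card_generators_ge[OF max[OF m] socle_restrictionD(1,2)[OF \<Phi>[OF m]]] S by simp
        then show "(MAX \<mm>\<in>ass D M. enat (r \<mm>)) \<le> enat (card S)" using fa ne by simp
      qed
    qed
  qed
qed

end

theorem theorem5p2p5:
  fixes n :: nat
    and D :: "('k::field_char_0 mpoly) ring"
    and M :: "('k mpoly, 'm) module"
    and R :: "('k mpoly, 'm \<Rightarrow> 'k) module"
  assumes D: "D = poly_ring n"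
    and M: "module D M" "finitely_generated D M"
    and pure: "n_pure n M"
    and R: "R = inverse_system M"
  shows "finite (ass D M) \<and> ass D M \<noteq> {} \<and> min_generators D R \<noteq> \<infinity> \<and>
    min_generators D R = (MAX \<mm>\<in>ass D M. num_isotypical D \<mm> (soc_component D \<mm> M)) \<and>
    min_generators D R = (MAX \<mm>\<in>ass D M. num_isotypical D \<mm> (top_component D \<mm> R)) \<and>
    min_generators D R = (MAX \<mm>\<in>ass D M. residue_dim D \<mm> (soc_component D \<mm> M))"
proof -
  let ?D = "poly_ring n"
  interpret mpoly_module n M using M(1) unfolding D by (rule mpoly_module.intro)
  have fin: "k.fin_dim" using fin_dim_if_n_pure M(2) pure unfolding D by simp
  have nz: "carrier M \<noteq> {\<zero>\<^bsub>M\<^esub>}" using pure unfolding n_pure_def by simp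
  have fa: "finite (ass ?D M)" and ne: "ass ?D M \<noteq> {}"
    using finite_ass[OF fin] ass_nonempty[OF fin nz] by auto
  obtain r where r:
    "\<And>\<mm>. \<mm> \<in> ass ?D M \<Longrightarrow> num_isotypical ?D \<mm> (soc_component ?D \<mm> M) = enat (r \<mm>)"
    "\<And>\<mm>. \<mm> \<in> ass ?D M \<Longrightarrow> residue_dim ?D \<mm> (soc_component ?D \<mm> M) = enat (r \<mm>)"
    "\<And>\<mm>. \<mm> \<in> ass ?D M \<Longrightarrow> num_isotypical ?D \<mm> (top_component ?D \<mm> (inverse_system M)) = enat (r \<mm>)"
    "min_generators ?D (inverse_system M) = (MAX \<mm>\<in>ass ?D M. enat (r \<mm>))"
    using min_generators_dual[OF fin nz] by blast
  have "(MAX \<mm>\<in>ass ?D M. enat (r \<mm>)) \<in> (\<lambda>\<mm>. enat (r \<mm>)) ` ass ?D M"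
    using fa ne by (intro Max_in) auto
  then have "min_generators ?D (inverse_system M) \<noteq> \<infinity>" unfolding r(4) by auto
  then show ?thesis unfolding D R using fa ne r by (simp cong: image_cong_simp)
qed

end
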